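(* Let $p$ be a regular point of a sub-Riemannian manifold $M$. Then there exists a neighborhood $T\subset M$ of $p$ such that for every $0<\varepsilon<1$ there exists a radius $r_\varepsilon>0$ such that $$2r(1-\varepsilon)\le\operatorname{diam}(B(q,r))\le2r$$ for every $q\in T$ and $0<r<r_\varepsilon$.
   Context: Sub-Riemannian manifolds. Let $M$ be a smooth connected manifold, let $\mathbf U$ be a Euclidean vector bundle over $M$ (a vector bundle with a smooth scalar product on the fibers) and let $f\colon\mathbf U\to TM$ be a smooth morphism of vector bundles over $M$ (linear on fibers, $f(\mathbf U_p)\subset T_pM$). The horizontal vector fields are $\mathcal D=\{f\circ\sigma:\sigma\in\Gamma(\mathbf U)\}$, and $\mathcal D_p=\{X(p):X\in\mathcal D\}$. Chow's condition $\mathrm{Lie}_p(\mathcal D)=T_pM$ is assumed for all $p\in M$. For $v\in\mathcal D_p$ set $G_p(v)=\min\{|u|_p^2:u\in\mathbf U_p,\ f(u)=v\}$; this is a quadratic form, and the scalar product $g_p$ on $\mathcal D_p$ with $g_p(v,v)=G_p(v)$ defines the sub-Riemannian metric $g$. The triple $(M,\mathcal D,g)$ is a sub-Riemannian manifold. Its sub-Riemannian distance $d(q_1,q_2)$ is the infimum of $\int_0^1\sqrt{g(\dot\gamma,\dot\gamma)}\,dt$ over absolutely continuous curves $\gamma\colon[0,1]\to M$ from $q_1$ to $q_2$ with $\dot\gamma(t)\in\mathcal D_{\gamma(t)}$ for a.e. $t$. $B(q,r)=\{z\in M:d(q,z)<r\}$, and $\operatorname{diam}$ is the diameter with respect to $d$.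 Regular points. Set $\mathcal D^1=\mathcal D$, $\mathcal D^{k+1}=\mathcal D^k+[\mathcal D^k,\mathcal D]$, $\mathcal D^k_p=\{X(p):X\in\mathcal D^k\}$. $(M,\mathcal D,g)$ is equiregular of step $s$ if $\mathcal D^s_p=T_pM$ and $\dim\mathcal D^k_p=n_k$ for all $k=1,\dots,s$ and $p\in M$, with $n_k$ independent of $p$. A point is regular if it has an open neighborhood that is an equiregular sub-Riemannian manifold with the restricted structure. *)

theory Defs
  imports "HOL-Analysis.Analysis" "HOL-Library.Function_Algebras"
begin

section \<open>Smooth maps between Euclidean spaces\<close>

primrec Ck_on :: "nat \<Rightarrow> 'e::euclidean_space set \<Rightarrow> ('e \<Rightarrow> 'c::real_normed_vector) \<Rightarrow> bool" where
  "Ck_on 0 S f \<longleftrightarrow> continuous_on S f"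
| "Ck_on (Suc k) S f \<longleftrightarrow>
     (\<forall>x\<in>S. f differentiable (at x)) \<and> (\<forall>v. Ck_on k S (\<lambda>x. frechet_derivative f (at x) v))"

text \<open>Only meant for open \<open>S\<close>, because the derivatives are two-sided.\<close>

definition smooth_on :: "'e::euclidean_space set \<Rightarrow> ('e \<Rightarrow> 'c::real_normed_vector) \<Rightarrow> bool" where
  "smooth_on S f \<longleftrightarrow> (\<forall>k. Ck_on k S f)"


section \<open>Charts and smooth manifolds\<close>

text \<open>A chart is a pair of a domain and a coordinate map; the values of the coordinate map outside
  the domain are irrelevant.\<close>

type_synonym ('a, 'e) chart = "'a set \<times> ('a \<Rightarrow> 'e)"

definition chart_union :: "('a, 'e) chart set \<Rightarrow> 'a set" where
  "chart_union A = (\<Union>(U, \<phi>)\<in>A. U)"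

definition smoothly_compatible :: "('a, 'e::euclidean_space) chart set \<Rightarrow> bool" where
  "smoothly_compatible A \<longleftrightarrow>
     (\<forall>(U, \<phi>)\<in>A. \<forall>(V, \<psi>)\<in>A. smooth_on (\<phi> ` (U \<inter> V)) (\<psi> \<circ> inv_into U \<phi>))"

text \<open>The manifold is the open set \<^term>\<open>chart_union A\<close> of the ambient topological space \<open>'a\<close>, and its
  dimension is \<open>DIM('e)\<close>, hence positive.\<close>

definition smooth_atlas ::
    "('a::{t2_space, second_countable_topology}, 'e::euclidean_space) chart set \<Rightarrow> bool" where
  "smooth_atlas A \<longleftrightarrow>
     (\<forall>(U, \<phi>)\<in>A. open U \<and> inj_on \<phi> U \<and> open (\<phi> ` U) \<and> homeomorphism U (\<phi> ` U) \<phi> (inv_into U \<phi>)) \<and>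
     smoothly_compatible A"

text \<open>The openness condition expresses continuity: it says that the part of \<open>U\<close> mapped into \<open>V\<close> is open.\<close>

definition smooth_map ::
    "('a, 'e::euclidean_space) chart set \<Rightarrow> ('b, 'c::euclidean_space) chart set \<Rightarrow> ('a \<Rightarrow> 'b) \<Rightarrow> bool" where
  "smooth_map A B F \<longleftrightarrow>
     F ` chart_union A \<subseteq> chart_union B \<and>
     (\<forall>(U, \<phi>)\<in>A. \<forall>(V, \<psi>)\<in>B.
        open (\<phi> ` (U \<inter> F -` V)) \<and> smooth_on (\<phi> ` (U \<inter> F -` V)) (\<psi> \<circ> F \<circ> inv_into U \<phi>))"

definition smooth_fun_on :: "('a, 'e::euclidean_space) chart set \<Rightarrow> 'a set \<Rightarrow> ('a \<Rightarrow> real) \<Rightarrow> bool" where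
  "smooth_fun_on A W h \<longleftrightarrow> (\<forall>(U, \<phi>)\<in>A. smooth_on (\<phi> ` (U \<inter> W)) (h \<circ> inv_into U \<phi>))"

definition smooth_near ::
    "('a::topological_space, 'e::euclidean_space) chart set \<Rightarrow> 'a \<Rightarrow> ('a \<Rightarrow> real) \<Rightarrow> bool" where
  "smooth_near A p h \<longleftrightarrow> (\<exists>W. open W \<and> p \<in> W \<and> W \<subseteq> chart_union A \<and> smooth_fun_on A W h)"


section \<open>The tangent bundle\<close>

text \<open>Tangent vectors at \<open>p\<close> are the derivations of the algebra of germs at \<open>p\<close> of smooth functions.
  As functions on all of \<open>'a \<Rightarrow> real\<close> they are normalised to vanish on the functions that are not smooth
  near \<open>p\<close>. Thus the tangent space at \<open>p\<close> does not change on passing to an open submanifold.\<close>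

type_synonym 'a tvec = "('a \<Rightarrow> real) \<Rightarrow> real"
type_synonym 'a vfield = "'a \<Rightarrow> 'a tvec"

definition tangent_space ::
    "('a::topological_space, 'e::euclidean_space) chart set \<Rightarrow> 'a \<Rightarrow> 'a tvec set" where
  "tangent_space A p = {v.
     (\<forall>h. \<not> smooth_near A p h \<longrightarrow> v h = 0) \<and>
     (\<forall>h k. smooth_near A p h \<longrightarrow> smooth_near A p k \<longrightarrow> (\<forall>\<^sub>F q in nhds p. h q = k q) \<longrightarrow> v h = v k) \<and>
     (\<forall>h k. smooth_near A p h \<longrightarrow> smooth_near A p k \<longrightarrow> v (\<lambda>q. h q + k q) = v h + v k) \<and>
     (\<forall>c h. smooth_near A p h \<longrightarrow> v (\<lambda>q. c * h q) = c * v h) \<and>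
     (\<forall>h k. smooth_near A p h \<longrightarrow> smooth_near A p k \<longrightarrow>
        v (\<lambda>q. h q * k q) = h p * v k + k p * v h)}"

definition tangent_charts ::
    "('a::topological_space, 'e::euclidean_space) chart set \<Rightarrow> ('a \<times> 'a tvec, 'e \<times> 'e) chart set" where
  "tangent_charts A =
     (\<lambda>(U, \<phi>). (Sigma U (tangent_space A), \<lambda>(p, v). (\<phi> p, \<Sum>b\<in>Basis. v (\<lambda>q. \<phi> q \<bullet> b) *\<^sub>R b))) ` A"

definition tvec_scale :: "real \<Rightarrow> 'a tvec \<Rightarrow> 'a tvec" where
  "tvec_scale c v = (\<lambda>h. c * v h)"

definition vfield_scale :: "real \<Rightarrow> 'a vfield \<Rightarrow> 'a vfield" where
  "vfield_scale c X = (\<lambda>p. tvec_scale c (X p))"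

interpretation tvec: vector_space "tvec_scale :: real \<Rightarrow> 'a tvec \<Rightarrow> 'a tvec"
  by unfold_locales (auto simp: tvec_scale_def fun_eq_iff algebra_simps)

interpretation vfield: vector_space "vfield_scale :: real \<Rightarrow> 'a vfield \<Rightarrow> 'a vfield"
  by unfold_locales (auto simp: vfield_scale_def tvec_scale_def fun_eq_iff algebra_simps)

definition lie_bracket ::
    "('a::topological_space, 'e::euclidean_space) chart set \<Rightarrow> 'a vfield \<Rightarrow> 'a vfield \<Rightarrow> 'a vfield" where
  "lie_bracket A X Y =
     (\<lambda>p h. if smooth_near A p h then X p (\<lambda>q. Y q h) - Y p (\<lambda>q. X q h) else 0)"


section \<open>Sub-Riemannian manifolds\<close>

text \<open>A manifold with an atlas, a vector bundle over it (total space, projection, fibrewise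
  operations, local trivialisations), a scalar product on the fibres and a map from the bundle to tangent
  vectors. In a trivialisation \<open>(W, \<tau>)\<close>, the map \<open>\<tau>\<close> is the fibre component only, so that
  \<open>u \<mapsto> (\<pi> u, \<tau> u)\<close> identifies the bundle over \<open>W\<close> with \<open>W \<times> 'u\<close>.\<close>

record ('a, 'e, 'b, 'u) sr_structure =
  atlas :: "('a, 'e) chart set"
  total :: "'b set"
  proj :: "'b \<Rightarrow> 'a"
  fib_add :: "'b \<Rightarrow> 'b \<Rightarrow> 'b"
  fib_scale :: "real \<Rightarrow> 'b \<Rightarrow> 'b"
  trivs :: "('a set \<times> ('b \<Rightarrow> 'u)) set"
  fib_inner :: "'b \<Rightarrow> 'b \<Rightarrow> real"
  anchor :: "'b \<Rightarrow> 'a tvec"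

definition points :: "('a, 'e, 'b, 'u) sr_structure \<Rightarrow> 'a set" where
  "points S = chart_union (atlas S)"

definition fiber :: "('a, 'e, 'b, 'u) sr_structure \<Rightarrow> 'a \<Rightarrow> 'b set" where
  "fiber S p = {u \<in> total S. proj S u = p}"

definition bundle_charts :: "('a, 'e, 'b, 'u) sr_structure \<Rightarrow> ('b, 'e \<times> 'u) chart set" where
  "bundle_charts S =
     (\<lambda>((U, \<phi>), (W, \<tau>)). (total S \<inter> proj S -` (U \<inter> W), \<lambda>u. (\<phi> (proj S u), \<tau> u))) ` (atlas S \<times> trivs S)"

text \<open>The vector space axioms in the fibres follow from the linearity of the bijections \<open>\<tau>\<close>. The
  topology and the smooth structure of the total space are those given by \<^const>\<open>bundle_charts\<close>.\<close>

definition vector_bundle ::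
    "('a::{t2_space, second_countable_topology}, 'e::euclidean_space, 'b, 'u::euclidean_space) sr_structure
      \<Rightarrow> bool" where
  "vector_bundle S \<longleftrightarrow>
     proj S ` total S \<subseteq> points S \<and>
     (\<Union>(W, \<tau>)\<in>trivs S. W) = points S \<and>
     (\<forall>p\<in>points S. \<forall>u\<in>fiber S p. \<forall>v\<in>fiber S p. fib_add S u v \<in> fiber S p) \<and>
     (\<forall>p\<in>points S. \<forall>c. \<forall>u\<in>fiber S p. fib_scale S c u \<in> fiber S p) \<and>
     (\<forall>(W, \<tau>)\<in>trivs S. open W \<and>
        (\<forall>p\<in>W. bij_betw \<tau> (fiber S p) UNIV \<and>
           (\<forall>u\<in>fiber S p. \<forall>v\<in>fiber S p. \<tau> (fib_add S u v) = \<tau> u + \<tau> v) \<and>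
           (\<forall>c. \<forall>u\<in>fiber S p. \<tau> (fib_scale S c u) = c *\<^sub>R \<tau> u))) \<and>
     smoothly_compatible (bundle_charts S)"

definition euclidean_structure ::
    "('a::{t2_space, second_countable_topology}, 'e::euclidean_space, 'b, 'u::euclidean_space) sr_structure
      \<Rightarrow> bool" where
  "euclidean_structure S \<longleftrightarrow>
     (\<forall>p\<in>points S. \<forall>u\<in>fiber S p. \<forall>v\<in>fiber S p.
        fib_inner S u v = fib_inner S v u \<and>
        (\<forall>w\<in>fiber S p. fib_inner S (fib_add S u v) w = fib_inner S u w + fib_inner S v w) \<and>
        (\<forall>c. fib_inner S (fib_scale S c u) v = c * fib_inner S u v) \<and>
        0 \<le> fib_inner S u u \<and>
        (fib_inner S u u = 0 \<longrightarrow> u = fib_scale S 0 u)) \<and>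
     (\<forall>(W, \<tau>)\<in>trivs S. \<forall>x y. smooth_fun_on (atlas S) W
        (\<lambda>p. fib_inner S (inv_into (fiber S p) \<tau> x) (inv_into (fiber S p) \<tau> y)))"

definition anchor_morphism ::
    "('a::{t2_space, second_countable_topology}, 'e::euclidean_space, 'b, 'u::euclidean_space) sr_structure
      \<Rightarrow> bool" where
  "anchor_morphism S \<longleftrightarrow>
     (\<forall>p\<in>points S. \<forall>u\<in>fiber S p. anchor S u \<in> tangent_space (atlas S) p \<and>
        (\<forall>v\<in>fiber S p. anchor S (fib_add S u v) = anchor S u + anchor S v) \<and>
        (\<forall>c. anchor S (fib_scale S c u) = tvec_scale c (anchor S u))) \<and>
     smooth_map (bundle_charts S) (tangent_charts (atlas S)) (\<lambda>u. (proj S u, anchor S u))"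

definition smooth_sections ::
    "('a::{t2_space, second_countable_topology}, 'e::euclidean_space, 'b, 'u::euclidean_space) sr_structure
      \<Rightarrow> ('a \<Rightarrow> 'b) set" where
  "smooth_sections S =
     {\<sigma>. (\<forall>p\<in>points S. \<sigma> p \<in> fiber S p) \<and> smooth_map (atlas S) (bundle_charts S) \<sigma>}"

text \<open>Vector fields are functions on the whole type \<open>'a\<close>; their values outside \<^term>\<open>points S\<close> are
  irrelevant throughout.\<close>

definition horizontal_fields ::
    "('a::{t2_space, second_countable_topology}, 'e::euclidean_space, 'b, 'u::euclidean_space) sr_structure
      \<Rightarrow> 'a vfield set" where
  "horizontal_fields S = {anchor S \<circ> \<sigma> | \<sigma>. \<sigma> \<in> smooth_sections S}"

definition field_values :: "'a vfield set \<Rightarrow> 'a \<Rightarrow> 'a tvec set" where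
  "field_values \<F> p = {X p | X. X \<in> \<F>}"

inductive_set lie_algebra ::
    "('a::{t2_space, second_countable_topology}, 'e::euclidean_space, 'b, 'u::euclidean_space) sr_structure
      \<Rightarrow> 'a vfield set" for S where
  "X \<in> horizontal_fields S \<Longrightarrow> X \<in> lie_algebra S"
| "X \<in> lie_algebra S \<Longrightarrow> Y \<in> lie_algebra S \<Longrightarrow> X + Y \<in> lie_algebra S"
| "X \<in> lie_algebra S \<Longrightarrow> vfield_scale c X \<in> lie_algebra S"
| "X \<in> lie_algebra S \<Longrightarrow> Y \<in> lie_algebra S \<Longrightarrow> lie_bracket (atlas S) X Y \<in> lie_algebra S"

definition sub_riemannian ::
    "('a::{t2_space, second_countable_topology}, 'e::euclidean_space, 'b, 'u::euclidean_space) sr_structure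
      \<Rightarrow> bool" where
  "sub_riemannian S \<longleftrightarrow>
     smooth_atlas (atlas S) \<and> connected (points S) \<and>
     vector_bundle S \<and> euclidean_structure S \<and> anchor_morphism S \<and>
     (\<forall>p\<in>points S. field_values (lie_algebra S) p = tangent_space (atlas S) p)"


section \<open>The sub-Riemannian distance\<close>

text \<open>The least value exists for \<open>v\<close> in the horizontal space at \<open>p\<close>, where it equals \<open>g\<^sub>p(v,v)\<close>.\<close>

definition sr_norm_sq :: "('a, 'e, 'b, 'u) sr_structure \<Rightarrow> 'a \<Rightarrow> 'a tvec \<Rightarrow> real" where
  "sr_norm_sq S p v = (LEAST x. \<exists>u\<in>fiber S p. anchor S u = v \<and> x = fib_inner S u u)"

definition abs_continuous_on :: "real \<Rightarrow> real \<Rightarrow> (real \<Rightarrow> 'e::real_normed_vector) \<Rightarrow> bool" where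
  "abs_continuous_on a b f \<longleftrightarrow>
     (\<forall>e>0. \<exists>\<delta>>0. \<forall>d t. d division_of t \<and> t \<subseteq> {a..b} \<and> (\<Sum>k\<in>d. Sup k - Inf k) < \<delta> \<longrightarrow>
        (\<Sum>k\<in>d. norm (f (Sup k) - f (Inf k))) < e)"

definition abs_continuous_curve ::
    "('a::topological_space, 'e::euclidean_space) chart set \<Rightarrow> (real \<Rightarrow> 'a) \<Rightarrow> bool" where
  "abs_continuous_curve A \<gamma> \<longleftrightarrow>
     continuous_on {0..1} \<gamma> \<and> \<gamma> ` {0..1} \<subseteq> chart_union A \<and>
     (\<forall>(U, \<phi>)\<in>A. \<forall>a b. 0 \<le> a \<and> a \<le> b \<and> b \<le> 1 \<and> \<gamma> ` {a..b} \<subseteq> U \<longrightarrow> abs_continuous_on a b (\<phi> \<circ> \<gamma>))"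

definition curve_differentiable ::
    "('a::topological_space, 'e::euclidean_space) chart set \<Rightarrow> (real \<Rightarrow> 'a) \<Rightarrow> real \<Rightarrow> bool" where
  "curve_differentiable A \<gamma> t \<longleftrightarrow>
     (\<forall>h. smooth_near A (\<gamma> t) h \<longrightarrow> (h \<circ> \<gamma>) differentiable (at t within {0..1}))"

definition velocity ::
    "('a::topological_space, 'e::euclidean_space) chart set \<Rightarrow> (real \<Rightarrow> 'a) \<Rightarrow> real \<Rightarrow> 'a tvec" where
  "velocity A \<gamma> t =
     (\<lambda>h. if smooth_near A (\<gamma> t) h then vector_derivative (h \<circ> \<gamma>) (at t within {0..1}) else 0)"

definition horizontal_curve ::
    "('a::{t2_space, second_countable_topology}, 'e::euclidean_space, 'b, 'u::euclidean_space) sr_structure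
      \<Rightarrow> (real \<Rightarrow> 'a) \<Rightarrow> bool" where
  "horizontal_curve S \<gamma> \<longleftrightarrow>
     abs_continuous_curve (atlas S) \<gamma> \<and>
     (AE t in lebesgue_on {0..1}. curve_differentiable (atlas S) \<gamma> t \<and>
        velocity (atlas S) \<gamma> t \<in> field_values (horizontal_fields S) (\<gamma> t))"

text \<open>The length of a horizontal curve may be infinite.\<close>

definition sr_length ::
    "('a::{t2_space, second_countable_topology}, 'e::euclidean_space, 'b, 'u::euclidean_space) sr_structure
      \<Rightarrow> (real \<Rightarrow> 'a) \<Rightarrow> ennreal" where
  "sr_length S \<gamma> =
     (\<integral>\<^sup>+ t. ennreal (sqrt (sr_norm_sq S (\<gamma> t) (velocity (atlas S) \<gamma> t))) \<partial>lebesgue_on {0..1})"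

definition sr_dist ::
    "('a::{t2_space, second_countable_topology}, 'e::euclidean_space, 'b, 'u::euclidean_space) sr_structure
      \<Rightarrow> 'a \<Rightarrow> 'a \<Rightarrow> ennreal" where
  "sr_dist S x y = (INF \<gamma>\<in>{\<gamma>. horizontal_curve S \<gamma> \<and> \<gamma> 0 = x \<and> \<gamma> 1 = y}. sr_length S \<gamma>)"

definition sr_ball ::
    "('a::{t2_space, second_countable_topology}, 'e::euclidean_space, 'b, 'u::euclidean_space) sr_structure
      \<Rightarrow> 'a \<Rightarrow> real \<Rightarrow> 'a set" where
  "sr_ball S q r = {z \<in> points S. sr_dist S q z < ennreal r}"

definition sr_diam ::
    "('a::{t2_space, second_countable_topology}, 'e::euclidean_space, 'b, 'u::euclidean_space) sr_structure
      \<Rightarrow> 'a set \<Rightarrow> ennreal" where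
  "sr_diam S B = (SUP x\<in>B. SUP y\<in>B. sr_dist S x y)"


section \<open>Regular points\<close>

text \<open>\<open>\<D>\<^bsup>k+1\<^esup> = \<D>\<^bsup>k\<^esup> + [\<D>\<^bsup>k\<^esup>, \<D>]\<close>, where the second summand is the real linear span of the
  brackets; the flag starts at \<open>k = 1\<close> and the value at \<open>0\<close> is a dummy.\<close>

fun flag ::
    "('a::{t2_space, second_countable_topology}, 'e::euclidean_space, 'b, 'u::euclidean_space) sr_structure
      \<Rightarrow> nat \<Rightarrow> 'a vfield set" where
  "flag S 0 = {0}"
| "flag S (Suc 0) = horizontal_fields S"
| "flag S (Suc (Suc k)) =
     {X + Z | X Z. X \<in> flag S (Suc k) \<and>
        Z \<in> vfield.span {lie_bracket (atlas S) Y H | Y H. Y \<in> flag S (Suc k) \<and> H \<in> horizontal_fields S}}"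

definition equiregular ::
    "('a::{t2_space, second_countable_topology}, 'e::euclidean_space, 'b, 'u::euclidean_space) sr_structure
      \<Rightarrow> nat \<Rightarrow> bool" where
  "equiregular S s \<longleftrightarrow>
     1 \<le> s \<and>
     (\<forall>p\<in>points S. field_values (flag S s) p = tangent_space (atlas S) p) \<and>
     (\<exists>n :: nat \<Rightarrow> nat. \<forall>k\<in>{1..s}. \<forall>p\<in>points S. tvec.dim (field_values (flag S k) p) = n k)"

definition sr_restrict :: "('a, 'e, 'b, 'u) sr_structure \<Rightarrow> 'a set \<Rightarrow> ('a, 'e, 'b, 'u) sr_structure" where
  "sr_restrict S V =
     S\<lparr>atlas := (\<lambda>(U, \<phi>). (U \<inter> V, \<phi>)) ` atlas S,
       total := total S \<inter> proj S -` V,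
       trivs := (\<lambda>(W, \<tau>). (W \<inter> V, \<tau>)) ` trivs S\<rparr>"

definition regular_point ::
    "('a::{t2_space, second_countable_topology}, 'e::euclidean_space, 'b, 'u::euclidean_space) sr_structure
      \<Rightarrow> 'a \<Rightarrow> bool" where
  "regular_point S p \<longleftrightarrow>
     (\<exists>V s. open V \<and> p \<in> V \<and> V \<subseteq> points S \<and>
        sub_riemannian (sr_restrict S V) \<and> equiregular (sr_restrict S V) s)"

end

theory Submission
  imports Defs
begin

text \<open>
  The upper bound is the triangle inequality through the centre of the ball: two curves that start at
  the centre can be joined, the first one reversed, to a curve between their endpoints
  (\<open>join_horizontal_curves\<close>).

  The lower bound is a calibration argument. By Chow's condition there is a nonzero horizontal vector at
  every point \<open>q0\<close> (\<open>anchor_nonzero\<close>). Hence some linear function \<open>h = \<phi> \<bullet> w\<close> of the coordinates of a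
  chart \<open>\<phi>\<close> has a horizontal gradient of norm \<open>1\<close> at \<open>q0\<close>; let \<open>\<xi>0\<close> be the unit vector of the fibre
  that realises this norm (\<open>calibrating_covector\<close>). By continuity the horizontal gradient of \<open>h\<close> has norm
  at most \<open>1 + \<delta>\<close> near \<open>q0\<close>, so a horizontal curve that stays near \<open>q0\<close> changes \<open>h\<close> by at most \<open>1 + \<delta>\<close>
  times its length, while a curve that goes farther away has a length bounded from below
  (\<open>near_bounds\<close>, \<open>length_ge_of_exit\<close>, \<open>sr_dist_lower_bound\<close>). On the other hand \<open>\<xi>0\<close> extends to a
  smooth section, whose horizontal field has norm at most \<open>1 + \<delta>\<close> and derives \<open>h\<close> by at least \<open>1 - \<delta>\<close>
  near \<open>q0\<close>. Flowing along it from \<open>q\<close> forwards and backwards for a time \<open>s\<close> slightly shorter than \<open>r\<close>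
  (\<open>flow_point\<close>) leads to two points of the ball \<open>B(q,r)\<close> at which \<open>h\<close> differs by \<open>2 s (1 - \<delta>)\<close> or more;
  their distance is therefore at least \<open>2 r (1 - \<epsilon>)\<close> (\<open>local_diam_lower_bound\<close>). All constants are
  uniform for \<open>q\<close> near \<open>q0\<close>, so on a compact neighbourhood \<open>T\<close> of \<open>p\<close>, chosen before \<open>\<epsilon>\<close>, finitely
  many of the radii suffice for each \<open>\<epsilon>\<close>.

  The argument rests on some calculus for the notions of the definitions. Tangent vectors are derivations of germs;
  they are determined by their coordinates because of Hadamard's lemma (\<open>derivation_formula\<close>). The minimum
  in the definition of the metric is attained (\<open>min_norm_lift\<close>). Increments of absolutely continuous functions are
  integrals of the derivative (\<open>ftc_abs_continuous\<close>). The speed of a horizontal curve is not known to be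
  measurable, so lengths are treated as lower integrals (\<open>abs_continuous_increment_le\<close>,
  \<open>nn_integral_unit_interval_halves\<close>). Integral curves come from Picard iteration
  (\<open>ode_solution_unit_interval\<close>), and horizontal fields are globally defined with the help of bump functions
  (\<open>section_extension\<close>).
\<close>

section \<open>Calculus of smooth maps\<close>

lemma linear_eq_sum_Basis:
  fixes L :: "'e::euclidean_space \<Rightarrow> 'c::real_vector"
  assumes "linear L"
  shows "L u = (\<Sum>b\<in>Basis. (u \<bullet> b) *\<^sub>R L b)"
proof -
  have "L u = L (\<Sum>b\<in>Basis. (u \<bullet> b) *\<^sub>R b)"
    by (simp add: euclidean_representation)
  also have "\<dots> = (\<Sum>b\<in>Basis. (u \<bullet> b) *\<^sub>R L b)"
    by (simp add: linear_sum[OF assms] linear_scale[OF assms])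
  finally show ?thesis .
qed

lemma Ck_on_cong:
  assumes "open S" "\<And>x. x \<in> S \<Longrightarrow> f x = g x" "Ck_on k S f"
  shows "Ck_on k S g"
  using assms(2,3)
proof (induction k arbitrary: f g)
  case 0
  then show ?case by (simp cong: continuous_on_cong)
next
  case (Suc k)
  have d: "f differentiable (at x)" if "x \<in> S" for x
    using Suc.prems(2) that by simp
  have "g differentiable (at x)" if "x \<in> S" for x
    using d[OF that] that assms(1) Suc.prems(1)
    unfolding differentiable_def by (metis has_derivative_transform_within_open)
  moreover have "Ck_on k S (\<lambda>x. frechet_derivative g (at x) v)" for v
  proof (rule Suc.IH)
    show "Ck_on k S (\<lambda>x. frechet_derivative f (at x) v)"
      using Suc.prems(2) by simp
    show "frechet_derivative f (at x) v = frechet_derivative g (at x) v" if "x \<in> S" for x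
      using frechet_derivative_transform_within_open[OF d[OF that] assms(1) that] Suc.prems(1) by metis
  qed
  ultimately show ?case by simp
qed

text \<open>The constant \<^const>\<open>Ck_on\<close> speaks of \<^const>\<open>frechet_derivative\<close>, a choice. This rule replaces it by any family
  of derivatives that is at hand, and all closure properties below go through it.\<close>

lemma Ck_on_SucI:
  assumes "open S" "\<And>x. x \<in> S \<Longrightarrow> (f has_derivative f' x) (at x)"
    and "\<And>v. Ck_on k S (\<lambda>x. f' x v)"
  shows "Ck_on (Suc k) S f"
proof -
  have "f' x = frechet_derivative f (at x)" if "x \<in> S" for x
    using frechet_derivative_at assms(2) that by blast
  then have "Ck_on k S (\<lambda>x. frechet_derivative f (at x) v)" for v
    using Ck_on_cong[OF assms(1) _ assms(3)[of v]] by simp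
  then show ?thesis
    using assms(2) by (auto simp: differentiable_def)
qed

lemma Ck_on_SucD:
  assumes "Ck_on (Suc k) S f"
  shows "\<And>x. x \<in> S \<Longrightarrow> (f has_derivative frechet_derivative f (at x)) (at x)"
    and "\<And>v. Ck_on k S (\<lambda>x. frechet_derivative f (at x) v)"
  using assms frechet_derivative_works by auto

lemma Ck_on_lower: "Ck_on (Suc k) S f \<Longrightarrow> Ck_on k S f"
proof (induction k arbitrary: f)
  case 0
  then show ?case
    by (auto intro!: continuous_at_imp_continuous_on differentiable_imp_continuous_within)
next
  case (Suc k)
  then show ?case by (metis Ck_on.simps(2))
qed

lemma Ck_on_continuous: "Ck_on k S f \<Longrightarrow> continuous_on S f"
proof (induction k)
  case (Suc k)
  then show ?case using Ck_on_lower by blast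
qed simp

lemma Ck_on_subset: "Ck_on k S f \<Longrightarrow> T \<subseteq> S \<Longrightarrow> Ck_on k T f"
proof (induction k arbitrary: f)
  case 0
  then show ?case using continuous_on_subset by auto
qed auto

text \<open>Two-sided derivatives at a point only see a neighbourhood of it, so smoothness can be checked on
  a different open set around each point. Fields that are defined by cases rely on this.\<close>

lemma Ck_on_locally:
  assumes "\<And>x. x \<in> S \<Longrightarrow> \<exists>T. open T \<and> x \<in> T \<and> Ck_on k T f"
  shows "Ck_on k S f"
  using assms
proof (induction k arbitrary: f)
  case 0
  then show ?case
    by (auto intro!: continuous_at_imp_continuous_on) (metis continuous_on_eq_continuous_at)
next
  case (Suc k)
  have "f differentiable at x" if "x \<in> S" for x
    using Suc.prems[OF that] by auto
  moreover have "Ck_on k S (\<lambda>x. frechet_derivative f (at x) v)" for v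
    by (rule Suc.IH) (use Suc.prems in fastforce)
  ultimately show ?case by simp
qed

lemma Ck_on_const [simp]: "Ck_on k S (\<lambda>x. c)"
  by (induction k arbitrary: c) auto

lemma Ck_on_bounded_linear:
  assumes "bounded_linear L" shows "Ck_on k S L"
proof -
  have "frechet_derivative L (at x) = L" for x
    using frechet_derivative_at[OF bounded_linear_imp_has_derivative[OF assms]] by simp
  then show ?thesis
    using assms bounded_linear_imp_differentiable
    by (cases k) (auto intro: linear_continuous_on)
qed

lemma Ck_on_bounded_linear_comp:
  assumes "bounded_linear L" "open S" "Ck_on k S f"
  shows "Ck_on k S (\<lambda>x. L (f x))"
  using assms(3)
proof (induction k arbitrary: f)
  case 0
  then show ?case
    using bounded_linear.continuous_on[OF assms(1)] by auto
next
  case (Suc k)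
  show ?case
  proof (rule Ck_on_SucI[OF assms(2)])
    show "((\<lambda>x. L (f x)) has_derivative (\<lambda>v. L (frechet_derivative f (at x) v))) (at x)"
      if "x \<in> S" for x
      using Ck_on_SucD(1)[OF Suc.prems that] bounded_linear.has_derivative[OF assms(1)] by blast
  qed (use Suc in auto)
qed

lemma Ck_on_add:
  assumes "open S" "Ck_on k S f" "Ck_on k S g"
  shows "Ck_on k S (\<lambda>x. f x + g x)"
  using assms(2,3)
proof (induction k arbitrary: f g)
  case 0
  then show ?case by (auto intro: continuous_intros)
next
  case (Suc k)
  show ?case
  proof (rule Ck_on_SucI[OF assms(1)])
    show "((\<lambda>x. f x + g x) has_derivative (\<lambda>v. frechet_derivative f (at x) v + frechet_derivative g (at x) v)) (at x)" if "x \<in> S" for x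
      using Suc.prems[THEN Ck_on_SucD(1), OF that] by (rule has_derivative_add)
  qed (use Suc in auto)
qed

lemma Ck_on_sum:
  assumes "open S" "\<And>i. i \<in> I \<Longrightarrow> Ck_on k S (f i)"
  shows "Ck_on k S (\<lambda>x. \<Sum>i\<in>I. f i x)"
  using assms(2)
  by (induction I rule: infinite_finite_induct) (auto intro: Ck_on_add[OF assms(1)])

lemma Ck_on_bilinear:
  assumes "bounded_bilinear B" "open S" "Ck_on k S f" "Ck_on k S g"
  shows "Ck_on k S (\<lambda>x. B (f x) (g x))"
  using assms(3,4)
proof (induction k arbitrary: f g)
  case 0
  then show ?case
    using bounded_bilinear.continuous_on[OF assms(1)] by auto
next
  case (Suc k)
  show ?case
  proof (rule Ck_on_SucI[OF assms(2)])
    show "((\<lambda>x. B (f x) (g x)) has_derivative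
        (\<lambda>v. B (f x) (frechet_derivative g (at x) v) + B (frechet_derivative f (at x) v) (g x))) (at x)"
      if "x \<in> S" for x
      using Suc.prems[THEN Ck_on_SucD(1), OF that] bounded_bilinear.FDERIV[OF assms(1)] by blast
    show "Ck_on k S (\<lambda>x. B (f x) (frechet_derivative g (at x) v) + B (frechet_derivative f (at x) v) (g x))"
      for v
      using Suc by (intro Ck_on_add[OF assms(2)] Suc.IH) (auto intro: Ck_on_lower)
  qed
qed

lemmas Ck_on_scaleR = Ck_on_bilinear[OF bounded_bilinear_scaleR]
lemmas Ck_on_inner = Ck_on_bilinear[OF bounded_bilinear_inner]
lemmas Ck_on_mult = Ck_on_bilinear[OF bounded_bilinear_mult]

lemma Ck_on_Pair:
  assumes "open S" "Ck_on k S f" "Ck_on k S g"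
  shows "Ck_on k S (\<lambda>x. (f x, g x))"
  using assms(2,3)
proof (induction k arbitrary: f g)
  case 0
  then show ?case by (auto intro: continuous_intros)
next
  case (Suc k)
  show ?case
  proof (rule Ck_on_SucI[OF assms(1)])
    show "((\<lambda>x. (f x, g x)) has_derivative (\<lambda>v. (frechet_derivative f (at x) v, frechet_derivative g (at x) v))) (at x)" if "x \<in> S" for x
      using Suc.prems[THEN Ck_on_SucD(1), OF that] by (rule has_derivative_Pair)
  qed (use Suc in auto)
qed

text \<open>Since the derivatives of \<open>f\<close> are only available direction by direction, the chain rule is
  expanded over the basis; then the derivative of \<open>f \<circ> g\<close> is a sum of products of functions to which
  the induction hypothesis applies.\<close>

lemma Ck_on_compose:
  fixes f :: "'d::euclidean_space \<Rightarrow> 'c::real_normed_vector" and g :: "'e::euclidean_space \<Rightarrow> 'd"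
  assumes "open S" "open T" "g ` S \<subseteq> T" "Ck_on k T f" "Ck_on k S g"
  shows "Ck_on k S (\<lambda>x. f (g x))"
  using assms(4,5)
proof (induction k arbitrary: f)
  case 0
  then show ?case using assms(3) by (auto intro: continuous_on_compose2)
next
  case (Suc k)
  let ?D = "\<lambda>x v. \<Sum>b\<in>Basis. (frechet_derivative g (at x) v \<bullet> b) *\<^sub>R frechet_derivative f (at (g x)) b"
  show ?case
  proof (rule Ck_on_SucI[OF assms(1)])
    show "((\<lambda>x. f (g x)) has_derivative ?D x) (at x)" if x: "x \<in> S" for x
    proof -
      have df: "(f has_derivative frechet_derivative f (at (g x))) (at (g x))"
        using Suc.prems(1)[THEN Ck_on_SucD(1)] assms(3) x by blast
      have "frechet_derivative f (at (g x)) u = (\<Sum>b\<in>Basis. (u \<bullet> b) *\<^sub>R frechet_derivative f (at (g x)) b)" for u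
        by (rule linear_eq_sum_Basis[OF has_derivative_linear[OF df]])
      then have "?D x = (\<lambda>v. frechet_derivative f (at (g x)) (frechet_derivative g (at x) v))"
        by (intro ext) (rule sym)
      with diff_chain_at[OF Suc.prems(2)[THEN Ck_on_SucD(1), OF x] df]
      show ?thesis by (simp add: o_def)
    qed
    have "Ck_on k S (\<lambda>x. frechet_derivative f (at (g x)) b)" for b
      using Suc by (intro Suc.IH) (auto intro: Ck_on_lower)
    then show "Ck_on k S (\<lambda>x. ?D x v)" for v
      using Suc by (intro Ck_on_sum Ck_on_scaleR Ck_on_inner assms(1)) auto
  qed
qed

text \<open>Differentiating under the integral sign in a direction \<open>v\<close> produces one more factor \<open>t\<close> and
  replaces \<open>F\<close> by its derivative along \<open>v\<close>. With the weight \<open>t ^ n\<close> built into the statement, the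
  derivative is again an integral of the same form, which closes the induction on \<open>k\<close>.\<close>

lemma Ck_on_line_integral:
  fixes F :: "'e::euclidean_space \<Rightarrow> real"
  assumes "open S" "convex S" "x0 \<in> S" "Ck_on k S F"
  shows "Ck_on k S (\<lambda>x. integral {0..1} (\<lambda>t. t ^ n * F (x0 + t *\<^sub>R (x - x0))))"
  using assms(4)
proof (induction k arbitrary: F n)
  have seg: "x0 + t *\<^sub>R (x - x0) \<in> S" if "x \<in> S" "t \<in> cbox 0 1" for x and t :: real
    using convexD[OF assms(2,3) that(1), of "1 - t" t] that(2)
    by (simp add: algebra_simps)
  have cont: "continuous_on (S \<times> cbox 0 1) (\<lambda>(x, t). t ^ n * F (x0 + t *\<^sub>R (x - x0)))"
    if "continuous_on S F" for n and F :: "'e \<Rightarrow> real"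
    unfolding split_beta
    by (intro continuous_intros continuous_on_compose2[OF that]) (use seg in auto)
  {
    case 0
    then show ?case
      using integral_continuous_on_param[OF cont[of F n]] by simp
  next
    case (Suc k)
    let ?D = "\<lambda>x. frechet_derivative F (at x)"
    let ?fx = "\<lambda>x t. Blinfun (\<lambda>v. t ^ Suc n * ?D (x0 + t *\<^sub>R (x - x0)) v)"
    have bl: "bounded_linear (?D x)" if "x \<in> S" for x
      using Ck_on_SucD(1)[OF Suc.prems that] has_derivative_bounded_linear by blast
    have app: "blinfun_apply (?fx x t) = (\<lambda>v. t ^ Suc n * ?D (x0 + t *\<^sub>R (x - x0)) v)"
      if "x \<in> S" "t \<in> cbox 0 1" for x t
      by (rule bounded_linear_Blinfun_apply)
        (intro bounded_linear_const_mult bl seg that)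
    have cD: "continuous_on S (\<lambda>x. ?D x v)" for v
      using Ck_on_continuous[OF Ck_on_SucD(2)[OF Suc.prems]] .
    have cF: "continuous_on S F"
      using Suc.prems by (auto intro!: continuous_at_imp_continuous_on differentiable_imp_continuous_within)
    have contD: "continuous_on (S \<times> cbox 0 1) (\<lambda>(x, t). ?fx x t)"
      unfolding split_beta
    proof (rule continuous_on_blinfun_componentwise)
      fix i :: 'e
      show "continuous_on (S \<times> cbox 0 1) (\<lambda>z. blinfun_apply (?fx (fst z) (snd z)) i)"
        by (rule continuous_on_eq[OF cont[OF cD[of i], of "Suc n"]]) (use app in force)
    qed
    have cPair: "continuous_on (cbox 0 1) (\<lambda>t::real. (x, t))" for x :: 'e
      by (intro continuous_intros)
    have intD: "(\<lambda>t. ?fx x t) integrable_on cbox 0 1" if "x \<in> S" for x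
    proof (rule integrable_continuous)
      show "continuous_on (cbox 0 1) (?fx x)"
        using continuous_on_compose2[OF contD cPair, of x] that by (simp add: image_subset_iff)
    qed
    have der: "((\<lambda>x. integral (cbox 0 1) (\<lambda>t. t ^ n * F (x0 + t *\<^sub>R (x - x0)))) has_derivative
        blinfun_apply (integral (cbox 0 1) (?fx x))) (at x within S)" if x: "x \<in> S" for x
    proof (rule leibniz_rule[OF _ _ contD x assms(2)])
      fix x t assume xt: "x \<in> S" "t \<in> cbox (0::real) 1"
      have "((\<lambda>x. F (x0 + t *\<^sub>R (x - x0))) has_derivative
          (\<lambda>v. ?D (x0 + t *\<^sub>R (x - x0)) (t *\<^sub>R v))) (at x)"
        by (rule has_derivative_compose[where g = F and f = "\<lambda>x. x0 + t *\<^sub>R (x - x0)", OF _ Ck_on_SucD(1)[OF Suc.prems seg[OF xt]]])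
          (auto intro!: derivative_eq_intros)
      then have "((\<lambda>x. t ^ n * F (x0 + t *\<^sub>R (x - x0))) has_derivative
          (\<lambda>v. t ^ n * ?D (x0 + t *\<^sub>R (x - x0)) (t *\<^sub>R v))) (at x)"
        by (auto intro!: derivative_eq_intros)
      also have "(\<lambda>v. t ^ n * ?D (x0 + t *\<^sub>R (x - x0)) (t *\<^sub>R v)) = blinfun_apply (?fx x t)"
        unfolding app[OF xt] linear_scale[OF bounded_linear.linear[OF bl[OF seg[OF xt]]]]
        by (simp add: ac_simps)
      finally show "((\<lambda>x. t ^ n * F (x0 + t *\<^sub>R (x - x0))) has_derivative
          blinfun_apply (?fx x t)) (at x within S)"
        by (rule has_derivative_at_withinI)
    next
      fix x assume "x \<in> S"
      then show "(\<lambda>t. t ^ n * F (x0 + t *\<^sub>R (x - x0))) integrable_on cbox 0 1"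
        using continuous_on_compose2[OF cont[OF cF] cPair, of x n]
        by (intro integrable_continuous) (simp add: image_subset_iff)
    qed
    show ?case
    proof (rule Ck_on_SucI[OF assms(1)])
      fix x assume x: "x \<in> S"
      have "blinfun_apply (integral (cbox 0 1) (?fx x)) =
          (\<lambda>v. integral {0..1} (\<lambda>t. t ^ Suc n * ?D (x0 + t *\<^sub>R (x - x0)) v))"
      proof
        fix v
        have "blinfun_apply (integral (cbox 0 1) (?fx x)) v =
            integral (cbox 0 1) (\<lambda>t. blinfun_apply (?fx x t) v)"
          using blinfun_apply_integral[OF intD[OF x]] by simp
        also have "\<dots> = integral {0..1} (\<lambda>t. t ^ Suc n * ?D (x0 + t *\<^sub>R (x - x0)) v)"
          using app[OF x] by (auto intro!: integral_cong)
        finally show "blinfun_apply (integral (cbox 0 1) (?fx x)) v = \<dots>" .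
      qed
      with der[OF x] show "((\<lambda>x. integral {0..1} (\<lambda>t. t ^ n * F (x0 + t *\<^sub>R (x - x0))))
          has_derivative (\<lambda>v. integral {0..1} (\<lambda>t. t ^ Suc n * ?D (x0 + t *\<^sub>R (x - x0)) v))) (at x)"
        using at_within_open[OF x assms(1)] by simp
    qed (rule Suc.IH[OF Ck_on_SucD(2)[OF Suc.prems]])
  }
qed

lemma smooth_on_Ck: "smooth_on S f \<Longrightarrow> Ck_on k S f"
  by (simp add: smooth_on_def)

lemma smooth_on_cong: "smooth_on S f \<Longrightarrow> open S \<Longrightarrow> (\<And>x. x \<in> S \<Longrightarrow> f x = g x) \<Longrightarrow> smooth_on S g"
  by (metis Ck_on_cong smooth_on_def)

lemma smooth_on_subset: "smooth_on S f \<Longrightarrow> T \<subseteq> S \<Longrightarrow> smooth_on T f"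
  by (meson Ck_on_subset smooth_on_def)

lemma smooth_on_locally:
  "(\<And>x. x \<in> S \<Longrightarrow> \<exists>T. open T \<and> x \<in> T \<and> smooth_on T f) \<Longrightarrow> smooth_on S f"
  unfolding smooth_on_def by (meson Ck_on_locally)

lemma smooth_on_const [simp]: "smooth_on S (\<lambda>x. c)"
  by (simp add: smooth_on_def)

lemma smooth_on_bounded_linear: "bounded_linear L \<Longrightarrow> smooth_on S L"
  by (simp add: smooth_on_def Ck_on_bounded_linear)

lemma smooth_on_bounded_linear_comp:
  "bounded_linear L \<Longrightarrow> open S \<Longrightarrow> smooth_on S f \<Longrightarrow> smooth_on S (\<lambda>x. L (f x))"
  by (simp add: smooth_on_def Ck_on_bounded_linear_comp)

lemma smooth_on_id [simp]: "smooth_on S (\<lambda>x. x)"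
  by (simp add: smooth_on_bounded_linear bounded_linear_ident)

lemma smooth_on_add: "open S \<Longrightarrow> smooth_on S f \<Longrightarrow> smooth_on S g \<Longrightarrow> smooth_on S (\<lambda>x. f x + g x)"
  by (simp add: smooth_on_def Ck_on_add)

lemma smooth_on_scaleR: "open S \<Longrightarrow> smooth_on S f \<Longrightarrow> smooth_on S g \<Longrightarrow> smooth_on S (\<lambda>x. f x *\<^sub>R g x)"
  by (simp add: smooth_on_def Ck_on_scaleR)

lemma smooth_on_inner: "open S \<Longrightarrow> smooth_on S f \<Longrightarrow> smooth_on S g \<Longrightarrow> smooth_on S (\<lambda>x. f x \<bullet> g x)"
  by (simp add: smooth_on_def Ck_on_inner)

lemma smooth_on_mult:
  fixes f g :: "'a::euclidean_space \<Rightarrow> 'b::real_normed_algebra"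
  shows "open S \<Longrightarrow> smooth_on S f \<Longrightarrow> smooth_on S g \<Longrightarrow> smooth_on S (\<lambda>x. f x * g x)"
  by (simp add: smooth_on_def Ck_on_mult)

lemma smooth_on_Pair: "open S \<Longrightarrow> smooth_on S f \<Longrightarrow> smooth_on S g \<Longrightarrow> smooth_on S (\<lambda>x. (f x, g x))"
  by (simp add: smooth_on_def Ck_on_Pair)

lemma smooth_on_compose:
  fixes f :: "'d::euclidean_space \<Rightarrow> 'c::real_normed_vector" and g :: "'e::euclidean_space \<Rightarrow> 'd"
  shows "smooth_on T f \<Longrightarrow> smooth_on S g \<Longrightarrow> open S \<Longrightarrow> open T \<Longrightarrow> g ` S \<subseteq> T \<Longrightarrow> smooth_on S (\<lambda>x. f (g x))"
  by (simp add: smooth_on_def Ck_on_compose)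

lemma smooth_on_continuous: "smooth_on S f \<Longrightarrow> continuous_on S f"
  using smooth_on_Ck[of S f 0] by simp

lemma smooth_on_has_derivative:
  "smooth_on S f \<Longrightarrow> x \<in> S \<Longrightarrow> (f has_derivative frechet_derivative f (at x)) (at x)"
  by (meson Ck_on_SucD(1) smooth_on_Ck)

lemma smooth_on_derivative: "smooth_on S f \<Longrightarrow> smooth_on S (\<lambda>x. frechet_derivative f (at x) v)"
  unfolding smooth_on_def using Ck_on_SucD(2)[of _ S f v] by blast

text \<open>The remainder is written as \<open>f x - f x0 = \<integral> D f (x0 + t (x - x0)) (x - x0) dt\<close> over the unit
  interval, and \<open>x - x0\<close> is expanded in the basis. This is what shows that a derivation at a point is
  determined by its values on the coordinates.\<close>

lemma hadamard:
  fixes f :: "'e::euclidean_space \<Rightarrow> real"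
  assumes "open S" "convex S" "x0 \<in> S" "smooth_on S f"
  obtains g where "\<And>b. smooth_on S (g b)"
    and "\<And>x. x \<in> S \<Longrightarrow> f x = f x0 + (\<Sum>b\<in>Basis. ((x - x0) \<bullet> b) * g b x)"
    and "\<And>b. g b x0 = frechet_derivative f (at x0) b"
proof
  define g where "g b x = integral {0..1} (\<lambda>t. t ^ 0 * frechet_derivative f (at (x0 + t *\<^sub>R (x - x0))) b)"
    for b x
  show "smooth_on S (g b)" for b
    unfolding smooth_on_def g_def
    using Ck_on_line_integral[OF assms(1-3)] smooth_on_derivative[OF assms(4)] smooth_on_Ck by blast
  show "g b x0 = frechet_derivative f (at x0) b" for b
    by (simp add: g_def)
  fix x assume x: "x \<in> S"
  have seg: "x0 + t *\<^sub>R (x - x0) \<in> S" if "t \<in> {0..1}" for t :: real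
    using convexD[OF assms(2,3) x, of "1 - t" t] that
    by (simp add: algebra_simps)
  let ?D = "\<lambda>t. frechet_derivative f (at (x0 + t *\<^sub>R (x - x0)))"
  have der: "((\<lambda>t. f (x0 + t *\<^sub>R (x - x0))) has_vector_derivative ?D t (x - x0)) (at t within {0..1})"
    if "t \<in> {0..1}" for t
  proof -
    have "((\<lambda>t. f (x0 + t *\<^sub>R (x - x0))) has_derivative (\<lambda>s. ?D t (s *\<^sub>R (x - x0)))) (at t within {0..1})"
      by (rule has_derivative_compose[where g = f and f = "\<lambda>t. x0 + t *\<^sub>R (x - x0)", OF _ smooth_on_has_derivative[OF assms(4) seg[OF that]]])
        (auto intro!: derivative_eq_intros)
    then show ?thesis
      using linear_scale[OF has_derivative_linear[OF smooth_on_has_derivative[OF assms(4) seg[OF that]]]]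
      by (simp add: has_vector_derivative_def)
  qed
  have intg: "(\<lambda>t. ?D t b) integrable_on {0..1}" for b
    by (intro integrable_continuous_real continuous_on_compose2[OF smooth_on_continuous[OF smooth_on_derivative[OF assms(4)]]]
        continuous_intros) (use seg in auto)
  have rep: "?D t (x - x0) = (\<Sum>b\<in>Basis. ((x - x0) \<bullet> b) * ?D t b)" if "t \<in> {0..1}" for t
  proof -
    have l: "linear (?D t)"
      using has_derivative_linear[OF smooth_on_has_derivative[OF assms(4) seg[OF that]]] .
    show ?thesis
      using linear_eq_sum_Basis[OF l, of "x - x0"] by simp
  qed
  have "f x - f x0 = integral {0..1} (\<lambda>t. ?D t (x - x0))"
    using integral_unique[OF fundamental_theorem_of_calculus[OF _ der]] by simp
  also have "\<dots> = integral {0..1} (\<lambda>t. \<Sum>b\<in>Basis. ((x - x0) \<bullet> b) * ?D t b)"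
    by (rule integral_cong) (rule rep)
  also have "\<dots> = (\<Sum>b\<in>Basis. ((x - x0) \<bullet> b) * g b x)"
    using integrable_cmul[OF intg] by (subst integral_sum) (auto simp: g_def)
  finally show "f x = f x0 + (\<Sum>b\<in>Basis. ((x - x0) \<bullet> b) * g b x)" by simp
qed

section \<open>Bump functions\<close>

text \<open>For \<open>n = 0\<close> this is the classical smooth function that vanishes to infinite order at \<open>0\<close>. The
  whole family is introduced because it is closed under differentiation up to linear combinations.\<close>

definition flat_exp :: "nat \<Rightarrow> real \<Rightarrow> real" where
  "flat_exp n t = (if t > 0 then exp (- 1 / t) / t ^ n else 0)"

lemma flat_exp_has_derivative:
  "(flat_exp n has_real_derivative (flat_exp (n + 2) t - n * flat_exp (n + 1) t)) (at t)"
proof -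
  consider "t > 0" | "t < 0" | "t = 0" by linarith
  then show ?thesis
  proof cases
    case 1
    have "((\<lambda>t. exp (- 1 / t) / t ^ n) has_real_derivative
        exp (- 1 / t) / t ^ (n + 2) - n * (exp (- 1 / t) / t ^ (n + 1))) (at t)"
      using 1 by (cases n; auto intro!: derivative_eq_intros simp: field_simps power2_eq_square)
        (metis Suc_pred' neq0_conv power_Suc One_nat_def)
    then have "(flat_exp n has_real_derivative
        exp (- 1 / t) / t ^ (n + 2) - n * (exp (- 1 / t) / t ^ (n + 1))) (at t)"
      by (rule DERIV_cong_ev[THEN iffD1, rotated -1])
        (use 1 eventually_nhds_in_open[of "{0<..}" t] in \<open>auto simp: flat_exp_def elim!: eventually_mono\<close>)
    then show ?thesis using 1 by (simp add: flat_exp_def)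
  next
    case 2
    have "(flat_exp n has_real_derivative 0) (at t)"
      by (rule DERIV_cong_ev[THEN iffD1, rotated -1, OF DERIV_const])
        (use 2 eventually_nhds_in_open[of "{..<0}" t] in \<open>auto simp: flat_exp_def elim!: eventually_mono\<close>)
    then show ?thesis using 2 by (simp add: flat_exp_def)
  next
    case 3
    have r: "((\<lambda>h. flat_exp (Suc n) h) \<longlongrightarrow> 0) (at_right 0)"
    proof -
      have "((\<lambda>x::real. x ^ Suc n / exp x) \<longlongrightarrow> 0) at_top"
        by (rule tendsto_power_div_exp_0)
      then have "((\<lambda>t::real. inverse t ^ Suc n / exp (inverse t)) \<longlongrightarrow> 0) (at_right 0)"
        by (rule filterlim_compose) (rule filterlim_inverse_at_top_right)
      then show ?thesis
        by (rule Lim_transform_eventually)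
          (auto simp: flat_exp_def eventually_at_filter exp_minus field_simps)
    qed
    have l: "((\<lambda>h. flat_exp (Suc n) h) \<longlongrightarrow> 0) (at_left 0)"
      by (rule Lim_transform_eventually[OF tendsto_const])
        (auto simp: flat_exp_def eventually_at_filter)
    have "((\<lambda>h. flat_exp (Suc n) h) \<longlongrightarrow> 0) (at 0)"
      using l r by (simp add: filterlim_split_at)
    then have "((\<lambda>h. (flat_exp n (0 + h) - flat_exp n 0) / h) \<longlongrightarrow> 0) (at 0)"
      by (rule Lim_transform_eventually) (auto simp: flat_exp_def eventually_at_filter)
    then show ?thesis
      using 3 by (simp add: DERIV_def flat_exp_def)
  qed
qed

lemma smooth_on_flat_exp: "smooth_on UNIV (flat_exp n)"
proof -
  have "Ck_on k UNIV (flat_exp n)" for k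
  proof (induction k arbitrary: n)
    case 0
    show ?case
      using DERIV_isCont[OF flat_exp_has_derivative]
      by (auto intro!: continuous_at_imp_continuous_on)
  next
    case (Suc k)
    show ?case
    proof (rule Ck_on_SucI)
      show "(flat_exp n has_derivative (\<lambda>v. (flat_exp (n + 2) t - n * flat_exp (n + 1) t) * v)) (at t)" for t
        using flat_exp_has_derivative has_field_derivative_imp_has_derivative by blast
      have "Ck_on k UNIV (\<lambda>t. (flat_exp (n + 2) t + (- real n) * flat_exp (n + 1) t) * v)" for v
        by (intro Ck_on_mult Ck_on_add Suc.IH Ck_on_const open_UNIV)
      then show "Ck_on k UNIV (\<lambda>t. (flat_exp (n + 2) t - n * flat_exp (n + 1) t) * v)" for v
        by simp
    qed simp
  qed
  then show ?thesis by (simp add: smooth_on_def)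
qed

text \<open>The flat exponential of \<open>\<rho>\<^sup>2 - |x - x0|\<^sup>2\<close>, scaled so that its maximum, attained at \<open>x0\<close>, is \<open>1\<close>.\<close>

lemma smooth_bump:
  fixes x0 :: "'e::euclidean_space"
  assumes "0 < \<rho>"
  obtains \<beta> :: "'e \<Rightarrow> real" where "smooth_on UNIV \<beta>" "\<beta> x0 = 1" "\<And>x. 0 \<le> \<beta> x" "\<And>x. \<beta> x \<le> 1"
    "\<And>x. x \<notin> ball x0 \<rho> \<Longrightarrow> \<beta> x = 0" "\<And>x. x \<in> ball x0 \<rho> \<Longrightarrow> \<beta> x > 0"
proof
  define g where "g x = \<rho>\<^sup>2 - (x - x0) \<bullet> (x - x0)" for x
  define \<beta> where "\<beta> x = exp (1 / \<rho>\<^sup>2) * flat_exp 0 (g x)" for x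
  have pos: "0 < g x \<longleftrightarrow> x \<in> ball x0 \<rho>" for x
    using assms power_strict_mono[of "norm (x - x0)" \<rho> 2] power2_less_imp_less[of "norm (x - x0)" \<rho>]
    by (auto simp: g_def dist_norm norm_minus_commute[of x0 x] simp flip: power2_norm_eq_inner)
  have "smooth_on UNIV g"
  proof -
    have "smooth_on UNIV (\<lambda>x. \<rho>\<^sup>2 + (- 1) * ((x + (- x0)) \<bullet> (x + (- x0))))"
      by (intro smooth_on_add smooth_on_mult smooth_on_inner) auto
    then show ?thesis by (simp add: g_def[abs_def])
  qed
  then have "smooth_on UNIV (\<lambda>x. flat_exp 0 (g x))"
    by (intro smooth_on_compose[OF smooth_on_flat_exp]) auto
  then show "smooth_on UNIV \<beta>"
    unfolding \<beta>_def[abs_def] by (intro smooth_on_mult) auto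
  show "\<beta> x0 = 1"
    using assms by (simp add: \<beta>_def flat_exp_def g_def exp_minus)
  show "0 \<le> \<beta> x" for x
    by (simp add: \<beta>_def flat_exp_def)
  show "\<beta> x \<le> 1" for x
  proof (cases "0 < g x")
    case True
    have "1 / \<rho>\<^sup>2 + - 1 / g x \<le> 0"
      using True assms frac_le[of 1 1 "g x" "\<rho>\<^sup>2"] by (simp add: g_def)
    with True show ?thesis
      by (simp add: \<beta>_def flat_exp_def flip: exp_add)
  qed (simp add: \<beta>_def flat_exp_def)
  show "x \<notin> ball x0 \<rho> \<Longrightarrow> \<beta> x = 0" for x
    using pos[of x] by (simp add: \<beta>_def flat_exp_def)
  show "x \<in> ball x0 \<rho> \<Longrightarrow> \<beta> x > 0" for x
    using pos[of x] by (simp add: \<beta>_def flat_exp_def)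
qed

section \<open>Absolutely continuous curves\<close>

text \<open>An indexed version of the families that occur in the definition of absolute continuity. Repeated
  and degenerate intervals are harmless here, whereas a division is a set; this makes the notion stable
  under cutting, affine maps and selecting part of a tagged division.\<close>

definition disjoint_intervals :: "real \<Rightarrow> real \<Rightarrow> 'i set \<Rightarrow> ('i \<Rightarrow> real) \<Rightarrow> ('i \<Rightarrow> real) \<Rightarrow> bool" where
  "disjoint_intervals a b I l r \<longleftrightarrow> finite I \<and> (\<forall>i\<in>I. a \<le> l i \<and> l i \<le> r i \<and> r i \<le> b) \<and>
     (\<forall>i\<in>I. \<forall>j\<in>I. i \<noteq> j \<longrightarrow> {l i<..<r i} \<inter> {l j<..<r j} = {})"

lemma disjoint_intervalsD:
  assumes "disjoint_intervals a b I l r"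
  shows "finite I" "\<forall>i\<in>I. a \<le> l i \<and> l i \<le> r i \<and> r i \<le> b"
    "\<forall>i\<in>I. \<forall>j\<in>I. i \<noteq> j \<longrightarrow> {l i<..<r i} \<inter> {l j<..<r j} = {}"
  using assms unfolding disjoint_intervals_def by blast+

lemma disjoint_intervalsI:
  assumes "finite I" "\<And>i. i \<in> I \<Longrightarrow> a \<le> l i \<and> l i \<le> r i \<and> r i \<le> b"
    "\<And>i j. i \<in> I \<Longrightarrow> j \<in> I \<Longrightarrow> i \<noteq> j \<Longrightarrow> {l i<..<r i} \<inter> {l j<..<r j} = {}"
  shows "disjoint_intervals a b I l r"
  using assms unfolding disjoint_intervals_def by blast+

abbreviation small_increments :: "real \<Rightarrow> real \<Rightarrow> (real \<Rightarrow> 'e::real_normed_vector) \<Rightarrow> real \<Rightarrow> real \<Rightarrow> bool" where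
  "small_increments a b f \<delta> e \<equiv> \<forall>(I :: (real \<times> real set) set) l r. disjoint_intervals a b I l r \<longrightarrow>
     (\<Sum>i\<in>I. r i - l i) < \<delta> \<longrightarrow> (\<Sum>i\<in>I. norm (f (r i) - f (l i))) < e"

text \<open>From left to right the degenerate intervals are discarded first: they contribute nothing, and the
  remaining ones are pairwise different as sets, hence form a division of their union.\<close>

lemma abs_continuous_on_alt:
  fixes f :: "real \<Rightarrow> 'e::real_normed_vector"
  shows "abs_continuous_on a b f \<longleftrightarrow>
    (\<forall>e>0. \<exists>\<delta>>0. small_increments a b f \<delta> e)"
    (is "_ \<longleftrightarrow> (\<forall>e>0. \<exists>\<delta>>0. ?P e \<delta>)")
proof
  assume ac: "abs_continuous_on a b f"
  show "\<forall>e>0. \<exists>\<delta>>0. ?P e \<delta>"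
  proof (intro allI impI)
    fix e :: real assume "e > 0"
    from ac[unfolded abs_continuous_on_def, rule_format, OF this] obtain \<delta> where \<delta>: "\<delta> > 0"
      "\<And>d t. d division_of t \<Longrightarrow> t \<subseteq> {a..b} \<Longrightarrow> (\<Sum>k\<in>d. Sup k - Inf k) < \<delta> \<Longrightarrow>
        (\<Sum>k\<in>d. norm (f (Sup k) - f (Inf k))) < e"
      by blast
    have "?P e \<delta>"
    proof (intro allI impI)
      fix I :: "(real \<times> real set) set" and l r
      assume DI: "disjoint_intervals a b I l r"
        and sm: "(\<Sum>i\<in>I. r i - l i) < \<delta>"
    note I = disjoint_intervalsD(1)[OF DI] and lr = disjoint_intervalsD(2)[OF DI]
      and dj = disjoint_intervalsD(3)[OF DI]
      define J where "J = {i\<in>I. l i < r i}"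
      have J: "finite J" "J \<subseteq> I" using I by (auto simp: J_def)
      let ?k = "\<lambda>i. {l i..r i}"
      have inj: "inj_on ?k J"
      proof (rule inj_onI)
        fix i j assume ij: "i \<in> J" "j \<in> J" "{l i..r i} = {l j..r j}"
        then have "l i = l j" "r i = r j" "l i < r i" by (auto simp: J_def Icc_eq_Icc)
        then have "{l i<..<r i} \<inter> {l j<..<r j} \<noteq> {}" using dense by auto
        then show "i = j" using dj ij J(2) by blast
      qed
      have div: "(?k ` J) division_of (\<Union>i\<in>J. ?k i)"
      proof (rule division_ofI)
        show "finite (?k ` J)" using J by simp
        fix K assume "K \<in> ?k ` J"
        then obtain i where i: "i \<in> J" "K = {l i..r i}" by auto
        show "K \<subseteq> (\<Union>i\<in>J. ?k i)" using i by auto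
        show "K \<noteq> {}" using i by (auto simp: J_def)
        show "\<exists>a b. K = cbox a b" using i by auto
        fix K' assume "K' \<in> ?k ` J" "K \<noteq> K'"
        then obtain j where "j \<in> J" "K' = {l j..r j}" "i \<noteq> j" using i by auto
        moreover from this have "{l i<..<r i} \<inter> {l j<..<r j} = {}" using dj i J(2) by blast
        ultimately show "interior K \<inter> interior K' = {}" using i(2) by simp
      qed simp
      have sub: "(\<Union>i\<in>J. ?k i) \<subseteq> {a..b}" using lr J(2) by force
      have SI: "Sup {l i..r i} = r i" "Inf {l i..r i} = l i" if "i \<in> J" for i
        using that by (auto simp: J_def)
      have "(\<Sum>k\<in>?k ` J. Sup k - Inf k) = (\<Sum>i\<in>J. r i - l i)"
        using inj SI by (simp add: sum.reindex)
      also have "\<dots> \<le> (\<Sum>i\<in>I. r i - l i)"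
        using lr I J by (intro sum_mono2) auto
      finally have "(\<Sum>k\<in>?k ` J. norm (f (Sup k) - f (Inf k))) < e"
        using \<delta>(2)[OF div sub] sm by linarith
      moreover have "(\<Sum>k\<in>?k ` J. norm (f (Sup k) - f (Inf k))) = (\<Sum>i\<in>J. norm (f (r i) - f (l i)))"
        using inj SI by (simp add: sum.reindex)
      moreover have "\<dots> = (\<Sum>i\<in>I. norm (f (r i) - f (l i)))"
      proof (rule sum.mono_neutral_left[OF I J(2)], rule ballI)
        fix i assume "i \<in> I - J"
        with lr have "l i = r i" by (force simp: J_def)
        then show "norm (f (r i) - f (l i)) = 0" by simp
      qed
      ultimately show "(\<Sum>i\<in>I. norm (f (r i) - f (l i))) < e" by simp
    qed
    with \<delta>(1) show "\<exists>\<delta>>0. ?P e \<delta>" by blast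
  qed
next
  assume alt: "\<forall>e>0. \<exists>\<delta>>0. ?P e \<delta>"
  show "abs_continuous_on a b f"
    unfolding abs_continuous_on_def
  proof (intro allI impI)
    fix e :: real assume "e > 0"
    then obtain \<delta> where \<delta>: "\<delta> > 0" "?P e \<delta>" using alt by blast
    have "\<forall>d t. d division_of t \<and> t \<subseteq> {a..b} \<and> (\<Sum>k\<in>d. Sup k - Inf k) < \<delta> \<longrightarrow>
        (\<Sum>k\<in>d. norm (f (Sup k) - f (Inf k))) < e"
    proof (intro allI impI, elim conjE)
      fix d t assume d: "d division_of t" "t \<subseteq> {a..b}" "(\<Sum>k\<in>d. Sup k - Inf k) < \<delta>"
      let ?I = "Pair (0::real) ` d"
      have inj: "inj_on (Pair (0::real)) d" by (auto simp: inj_on_def)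
      have K: "\<exists>u v. K = {u..v} \<and> u \<le> v \<and> a \<le> u \<and> v \<le> b" if Kd: "K \<in> d" for K
      proof -
        obtain u v where uv: "K = {u..v}" using division_ofD(4)[OF d(1) Kd] by auto
        have "K \<noteq> {}" "K \<subseteq> t" using division_ofD(2,3)[OF d(1) Kd] by auto
        then have "u \<le> v" "{u..v} \<subseteq> {a..b}" using uv subset_trans[of K t "{a..b}"] d(2) by auto
        then show ?thesis using uv by auto
      qed
      have "(\<Sum>i\<in>?I. norm (f (Sup (snd i)) - f (Inf (snd i)))) < e"
      proof (rule \<delta>(2)[rule_format, OF disjoint_intervalsI])
        show "finite ?I" using d(1) by auto
        fix i assume i: "i \<in> ?I"
        then have "snd i \<in> d" by auto
        from K[OF this] obtain u v where uv: "snd i = {u..v}" "u \<le> v" "a \<le> u" "v \<le> b" by blast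
        then show "a \<le> Inf (snd i) \<and> Inf (snd i) \<le> Sup (snd i) \<and> Sup (snd i) \<le> b" by auto
        fix j assume j: "j \<in> ?I" and "i \<noteq> j"
        then have "snd j \<in> d" by auto
        from K[OF this] obtain u' v' where uv': "snd j = {u'..v'}" "u' \<le> v'" by blast
        have "interior (snd i) \<inter> interior (snd j) = {}"
          using \<open>snd i \<in> d\<close> \<open>snd j \<in> d\<close> \<open>i \<noteq> j\<close> i j
          by (intro division_ofD(5)[OF d(1)]) auto
        then show "{Inf (snd i)<..<Sup (snd i)} \<inter> {Inf (snd j)<..<Sup (snd j)} = {}"
          using uv uv' by simp
      next
        show "(\<Sum>i\<in>?I. Sup (snd i) - Inf (snd i)) < \<delta>"
          using d(3) inj by (simp add: sum.reindex)
      qed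
      then show "(\<Sum>k\<in>d. norm (f (Sup k) - f (Inf k))) < e"
        using inj by (simp add: sum.reindex)
    qed
    with \<delta>(1) show "\<exists>\<delta>>0. \<forall>d t. d division_of t \<and> t \<subseteq> {a..b} \<and> (\<Sum>k\<in>d. Sup k - Inf k) < \<delta> \<longrightarrow>
        (\<Sum>k\<in>d. norm (f (Sup k) - f (Inf k))) < e" by blast
  qed
qed

lemma abs_continuous_onD:
  fixes f :: "real \<Rightarrow> 'e::real_normed_vector"
  assumes "abs_continuous_on a b f" "e > 0"
  shows "\<exists>\<delta>>0. small_increments a b f \<delta> e"
  using abs_continuous_on_alt[THEN iffD1, rule_format, OF assms] .

lemma abs_continuous_onI:
  fixes f :: "real \<Rightarrow> 'e::real_normed_vector"
  assumes "\<And>e. e > 0 \<Longrightarrow> \<exists>\<delta>>0. small_increments a b f \<delta> e"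
  shows "abs_continuous_on a b f"
  unfolding abs_continuous_on_alt by (intro allI impI assms)

lemma abs_continuous_on_lipschitz:
  fixes f :: "real \<Rightarrow> 'e::real_normed_vector"
  assumes "\<And>s t. a \<le> s \<Longrightarrow> s \<le> t \<Longrightarrow> t \<le> b \<Longrightarrow> norm (f t - f s) \<le> L * (t - s)"
  shows "abs_continuous_on a b f"
proof (rule abs_continuous_onI)
  fix e :: real assume e: "e > 0"
  define L' where "L' = max L 1"
  show "\<exists>\<delta>>0. small_increments a b f \<delta> e"
  proof (intro exI[of _ "e / L'"] conjI allI impI)
    have L': "L' > 0" by (simp add: L'_def)
    with e show "e / L' > 0" by simp
    fix I :: "(real \<times> real set) set" and l r
    assume DI: "disjoint_intervals a b I l r" and sm: "(\<Sum>i\<in>I. r i - l i) < e / L'"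
    note I = disjoint_intervalsD(1)[OF DI] and lr = disjoint_intervalsD(2)[OF DI]
      and dj = disjoint_intervalsD(3)[OF DI]
    have "(\<Sum>i\<in>I. norm (f (r i) - f (l i))) \<le> (\<Sum>i\<in>I. L' * (r i - l i))"
    proof (rule sum_mono)
      fix i assume "i \<in> I"
      with lr have "norm (f (r i) - f (l i)) \<le> L * (r i - l i)" "l i \<le> r i" using assms by auto
      moreover have "L * (r i - l i) \<le> L' * (r i - l i)"
        using \<open>l i \<le> r i\<close> by (intro mult_right_mono) (auto simp: L'_def)
      ultimately show "norm (f (r i) - f (l i)) \<le> L' * (r i - l i)" by linarith
    qed
    also have "\<dots> < e"
      using sm L' by (simp only: sum_distrib_left[symmetric] pos_less_divide_eq mult.commute)
    finally show "(\<Sum>i\<in>I. norm (f (r i) - f (l i))) < e" .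
  qed
qed

lemma abs_continuous_on_dominated:
  fixes f :: "real \<Rightarrow> 'e::real_normed_vector" and g :: "real \<Rightarrow> 'f::real_normed_vector"
  assumes ac: "abs_continuous_on a b f" and c: "0 < c"
    and le: "\<And>s t. s \<in> {a..b} \<Longrightarrow> t \<in> {a..b} \<Longrightarrow> norm (g t - g s) \<le> c * norm (f t - f s)"
  shows "abs_continuous_on a b g"
proof (rule abs_continuous_onI)
  fix e :: real assume e: "e > 0"
  obtain \<delta> where \<delta>: "\<delta> > 0" "small_increments a b f \<delta> (e / c)"
    using abs_continuous_onD[OF ac divide_pos_pos[OF e c]] by blast
  show "\<exists>\<delta>>0. small_increments a b g \<delta> e"
  proof (intro exI[of _ \<delta>] conjI allI impI \<delta>(1))
    fix I :: "(real \<times> real set) set" and l r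
    assume DI: "disjoint_intervals a b I l r" and sm: "(\<Sum>i\<in>I. r i - l i) < \<delta>"
    have "(\<Sum>i\<in>I. norm (g (r i) - g (l i))) \<le> (\<Sum>i\<in>I. c * norm (f (r i) - f (l i)))"
      using disjoint_intervalsD(2)[OF DI] by (intro sum_mono le) force+
    also have "\<dots> < c * (e / c)"
      unfolding sum_distrib_left[symmetric]
      by (rule mult_strict_left_mono[OF \<delta>(2)[rule_format, OF DI sm] c])
    finally show "(\<Sum>i\<in>I. norm (g (r i) - g (l i))) < e" using c by simp
  qed
qed

lemma abs_continuous_on_inner:
  fixes f :: "real \<Rightarrow> 'e::real_inner"
  assumes "abs_continuous_on a b f"
  shows "abs_continuous_on a b (\<lambda>t. f t \<bullet> w)"
proof (rule abs_continuous_on_dominated[OF assms, of "norm w + 1"])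
  fix s t
  have "norm (f t \<bullet> w - f s \<bullet> w) \<le> norm (f t - f s) * norm w"
    by (simp add: Cauchy_Schwarz_ineq2 flip: inner_diff_left)
  also have "\<dots> \<le> (norm w + 1) * norm (f t - f s)"
    by (simp add: algebra_simps)
  finally show "norm (f t \<bullet> w - f s \<bullet> w) \<le> (norm w + 1) * norm (f t - f s)" .
qed (simp add: add_nonneg_pos)

text \<open>Every interval of a family on \<open>[a,b]\<close> is cut at \<open>c\<close> by taking minima and maxima of its endpoints
  with \<open>c\<close>; an interval on one side of \<open>c\<close> leaves a degenerate remainder on the other.\<close>

lemma abs_continuous_on_join:
  fixes f :: "real \<Rightarrow> 'e::real_normed_vector"
  assumes "abs_continuous_on a c f" "abs_continuous_on c b f" "a \<le> c" "c \<le> b"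
  shows "abs_continuous_on a b f"
proof (rule abs_continuous_onI)
  fix e :: real assume e: "e > 0"
  obtain \<delta>1 where \<delta>1: "\<delta>1 > 0" "small_increments a c f \<delta>1 (e / 2)"
    using abs_continuous_onD[OF assms(1) half_gt_zero[OF e]] by blast
  obtain \<delta>2 where \<delta>2: "\<delta>2 > 0" "small_increments c b f \<delta>2 (e / 2)"
    using abs_continuous_onD[OF assms(2) half_gt_zero[OF e]] by blast
  show "\<exists>\<delta>>0. small_increments a b f \<delta> e"
  proof (intro exI[of _ "min \<delta>1 \<delta>2"] conjI allI impI)
    show "min \<delta>1 \<delta>2 > 0" using \<delta>1 \<delta>2 by simp
    fix I :: "(real \<times> real set) set" and l r
    assume DI: "disjoint_intervals a b I l r"
        and sm: "(\<Sum>i\<in>I. r i - l i) < min \<delta>1 \<delta>2"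
    note I = disjoint_intervalsD(1)[OF DI] and lr = disjoint_intervalsD(2)[OF DI]
      and dj = disjoint_intervalsD(3)[OF DI]
    have "(\<Sum>i\<in>I. min (r i) c - min (l i) c) \<le> (\<Sum>i\<in>I. r i - l i)"
      by (rule sum_mono) (use lr in \<open>auto simp: min_def\<close>)
    then have 1: "(\<Sum>i\<in>I. norm (f (min (r i) c) - f (min (l i) c))) < e / 2"
    proof (intro \<delta>1(2)[rule_format, OF disjoint_intervalsI[OF I]])
      show "{min (l i) c<..<min (r i) c} \<inter> {min (l j) c<..<min (r j) c} = {}"
        if "i \<in> I" "j \<in> I" "i \<noteq> j" for i j
      proof -
        have "{min (l i) c<..<min (r i) c} \<inter> {min (l j) c<..<min (r j) c} \<subseteq> {l i<..<r i} \<inter> {l j<..<r j}"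
          by (auto simp: min_less_iff_disj)
        then show ?thesis using dj that by blast
      qed
    qed (use lr sm assms(3,4) in auto)
    have "(\<Sum>i\<in>I. max (r i) c - max (l i) c) \<le> (\<Sum>i\<in>I. r i - l i)"
      by (rule sum_mono) (use lr in \<open>auto simp: max_def\<close>)
    then have 2: "(\<Sum>i\<in>I. norm (f (max (r i) c) - f (max (l i) c))) < e / 2"
    proof (intro \<delta>2(2)[rule_format, OF disjoint_intervalsI[OF I]])
      show "{max (l i) c<..<max (r i) c} \<inter> {max (l j) c<..<max (r j) c} = {}"
        if "i \<in> I" "j \<in> I" "i \<noteq> j" for i j
      proof -
        have "{max (l i) c<..<max (r i) c} \<inter> {max (l j) c<..<max (r j) c} \<subseteq> {l i<..<r i} \<inter> {l j<..<r j}"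
          by (auto simp: less_max_iff_disj)
        then show ?thesis using dj that by blast
      qed
    qed (use lr sm assms(3,4) in auto)
    have "(\<Sum>i\<in>I. norm (f (r i) - f (l i))) \<le>
        (\<Sum>i\<in>I. norm (f (min (r i) c) - f (min (l i) c)) + norm (f (max (r i) c) - f (max (l i) c)))"
    proof (rule sum_mono)
      fix i assume "i \<in> I"
      have "f (r i) - f (l i) = (f (min (r i) c) - f (min (l i) c)) + (f (max (r i) c) - f (max (l i) c))"
        by (auto simp: min_def max_def)
      then show "norm (f (r i) - f (l i)) \<le>
          norm (f (min (r i) c) - f (min (l i) c)) + norm (f (max (r i) c) - f (max (l i) c))"
        by (metis norm_triangle_ineq)
    qed
    then show "(\<Sum>i\<in>I. norm (f (r i) - f (l i))) < e"
      using 1 2 by (simp add: sum.distrib)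
  qed
qed

lemma abs_continuous_on_affine:
  fixes f :: "real \<Rightarrow> 'e::real_normed_vector"
  assumes "abs_continuous_on a' b' f" "m \<noteq> 0" "(\<lambda>t. m * t + q) ` {a..b} \<subseteq> {a'..b'}"
  shows "abs_continuous_on a b (\<lambda>t. f (m * t + q))"
proof (rule abs_continuous_onI)
  fix e :: real assume e: "e > 0"
  obtain \<delta> where \<delta>: "\<delta> > 0" "small_increments a' b' f \<delta> e"
    using abs_continuous_onD[OF assms(1) e] by blast
  show "\<exists>\<delta>>0. small_increments a b (\<lambda>t. f (m * t + q)) \<delta> e"
  proof (intro exI[of _ "\<delta> / \<bar>m\<bar>"] conjI allI impI)
    show "\<delta> / \<bar>m\<bar> > 0" using \<delta>(1) assms(2) by simp
    fix I :: "(real \<times> real set) set" and l r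
    assume DI: "disjoint_intervals a b I l r"
        and sm: "(\<Sum>i\<in>I. r i - l i) < \<delta> / \<bar>m\<bar>"
    note I = disjoint_intervalsD(1)[OF DI] and lr = disjoint_intervalsD(2)[OF DI]
      and dj = disjoint_intervalsD(3)[OF DI]
    let ?l = "\<lambda>i. min (m * l i + q) (m * r i + q)" and ?r = "\<lambda>i. max (m * l i + q) (m * r i + q)"
    have "(\<Sum>i\<in>I. norm (f (?r i) - f (?l i))) < e"
    proof (rule \<delta>(2)[rule_format, OF disjoint_intervalsI[OF I]])
      fix i assume i: "i \<in> I"
      show "a' \<le> ?l i \<and> ?l i \<le> ?r i \<and> ?r i \<le> b'"
        using lr i assms(3) by (auto simp: image_subset_iff)
      fix j assume j: "j \<in> I" "i \<noteq> j"
      have *: "x \<in> {?l i<..<?r i} \<Longrightarrow> (x - q) / m \<in> {l i<..<r i}" if "i \<in> I" for x i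
      proof -
        have le: "l i \<le> r i" using lr that by blast
        assume x: "x \<in> {?l i<..<?r i}"
        show ?thesis
        proof (cases "m > 0")
          case True
          then have "m * l i \<le> m * r i" using le by simp
          with True x show ?thesis by (auto simp: field_simps)
        next
          case False
          then have m: "m < 0" using assms(2) by simp
          then have "m * r i \<le> m * l i" using le by simp
          with m x show ?thesis by (auto simp: field_simps)
        qed
      qed
      show "{?l i<..<?r i} \<inter> {?l j<..<?r j} = {}"
        using *[OF i] *[OF j(1)] dj i j by (meson disjoint_iff)
    next
      have "(\<Sum>i\<in>I. ?r i - ?l i) = (\<Sum>i\<in>I. \<bar>m\<bar> * (r i - l i))"
      proof (rule sum.cong[OF refl])
        fix i assume "i \<in> I"
        then have "\<bar>m\<bar> * (r i - l i) = \<bar>m * r i - m * l i\<bar>"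
          using lr by (auto simp: abs_mult right_diff_distrib[symmetric])
        then show "?r i - ?l i = \<bar>m\<bar> * (r i - l i)" by auto
      qed
      then show "(\<Sum>i\<in>I. ?r i - ?l i) < \<delta>"
        using sm assms(2)
        by (simp only: sum_distrib_left[symmetric]) (simp add: pos_less_divide_eq mult.commute)
    qed
    moreover have "norm (f (?r i) - f (?l i)) = norm (f (m * r i + q) - f (m * l i + q))" for i
      by (auto simp: min_def max_def norm_minus_commute)
    ultimately show "(\<Sum>i\<in>I. norm (f (m * r i + q) - f (m * l i + q))) < e" by simp
  qed
qed

lemma abs_continuous_on_cong:
  fixes f g :: "real \<Rightarrow> 'e::real_normed_vector"
  assumes "abs_continuous_on a b f" "\<And>t. t \<in> {a..b} \<Longrightarrow> f t = g t"
  shows "abs_continuous_on a b g"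
  by (rule abs_continuous_on_dominated[OF assms(1), of 1]) (simp_all add: assms(2)[symmetric])

text \<open>The fundamental theorem with a null set of exceptional points. In a fine tagged division the
  intervals with regular tags are controlled by differentiability, as in the usual proof. Those with a tag
  in \<open>N\<close> lie in an open set of small measure around \<open>N\<close>, so absolute continuity makes the sum of
  their increments small. The gauge integral is the convenient one because its gauge may depend on the
  tag.\<close>

lemma ftc_abs_continuous:
  fixes f :: "real \<Rightarrow> real"
  assumes ab: "a \<le> b" and ac: "abs_continuous_on a b f" and N: "negligible N"
    and der: "\<And>t. t \<in> {a..b} - N \<Longrightarrow> (f has_vector_derivative f' t) (at t within {a..b})"
  shows "(f' has_integral (f b - f a)) {a..b}"
proof -
  define g where "g t = (if t \<in> N then 0 else f' t)" for t
  have "(g has_integral (f b - f a)) {a..b}"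
    unfolding has_integral_real
  proof (intro allI impI)
    fix e :: real assume e: "e > 0"
    \<comment> \<open>the summand 1 avoids a separate treatment of the case a = b\<close>
    define e1 where "e1 = e / 2 / (b - a + 1)"
    have e1: "e1 > 0" "e1 * (b - a) < e / 2"
      using e ab by (auto simp: e1_def field_simps)
    obtain \<delta> where \<delta>: "\<delta> > 0" "small_increments a b f \<delta> (e / 2)"
      using abs_continuous_onD[OF ac half_gt_zero[OF e]] by blast
    obtain G where G: "open G" "N \<subseteq> G" "emeasure lebesgue G < ennreal \<delta>"
    proof -
      have Ns: "N \<in> null_sets lebesgue" using N by (simp add: negligible_iff_null_sets)
      obtain G where G: "open G" "N \<subseteq> G" "G - N \<in> lmeasurable" "emeasure lebesgue (G - N) < ennreal \<delta>"
        using sets_lebesgue_outer_open[of N \<delta>] Ns \<delta>(1) by auto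
      have "emeasure lebesgue G = emeasure lebesgue (G - N)"
        using emeasure_Diff_null_set[OF Ns, of G] G(1) by simp
      with G show thesis by (intro that[of G]) auto
    qed
    have "\<forall>x. \<exists>d>0. x \<in> {a..b} - N \<longrightarrow>
         (\<forall>y\<in>{a..b}. norm (y-x) < d \<longrightarrow> norm (f y - f x - (y-x) *\<^sub>R f' x) \<le> e1 * norm (y-x))"
      using der[unfolded has_vector_derivative_def has_derivative_within_alt] e1(1)
      by (metis zero_less_one)
    then obtain d where d: "\<And>x. 0 < d x"
      "\<And>x y. \<lbrakk>x \<in> {a..b} - N; y \<in> {a..b}; norm (y-x) < d x\<rbrakk>
          \<Longrightarrow> norm (f y - f x - (y-x) *\<^sub>R f' x) \<le> e1 * norm (y-x)"
      by metis
    \<comment> \<open>regular tags get the differentiability radius, exceptional tags the small open set\<close>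
    define \<gamma> where "\<gamma> x = (if x \<in> N then G else ball x (d x))" for x
    have gauge: "gauge \<gamma>"
      using G(1,2) d(1) by (auto simp: gauge_def \<gamma>_def)
    have main: "norm ((\<Sum>(x,k)\<in>p. measure lborel k *\<^sub>R g x) - (f b - f a)) < e"
      if p: "p tagged_division_of {a..b}" and fine: "\<gamma> fine p" for p
    proof -
      define pN where "pN = {z \<in> p. fst z \<in> N}"
      define pR where "pR = {z \<in> p. fst z \<notin> N}"
      have fin: "finite p" "finite pN" "finite pR" and split: "p = pN \<union> pR" "pN \<inter> pR = {}"
        using p by (auto simp: pN_def pR_def)
      have K: "\<exists>u v. k = {u..v} \<and> u \<le> v \<and> a \<le> u \<and> v \<le> b \<and> x \<in> {u..v}" if xk: "(x, k) \<in> p" for x k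
      proof -
        obtain u v where uv: "k = {u..v}" using tagged_division_ofD(4)[OF p xk] by auto
        moreover have "x \<in> k" "k \<subseteq> {a..b}" using tagged_division_ofD(2,3)[OF p xk] by auto
        ultimately show ?thesis by (intro exI[of _ u] exI[of _ v]) auto
      qed
      let ?F = "\<lambda>z. f (Sup (snd z)) - f (Inf (snd z))"
      let ?S = "\<lambda>z. measure lborel (snd z) *\<^sub>R g (fst z)"
      have total: "f b - f a = (\<Sum>z\<in>p. ?F z)" "b - a = (\<Sum>z\<in>p. Sup (snd z) - Inf (snd z))"
        using additive_tagged_division_1[OF ab p, of f] additive_tagged_division_1[OF ab p, of "\<lambda>x. x"]
        by (simp_all add: case_prod_unfold)
      have R: "norm (\<Sum>z\<in>pR. ?S z - ?F z) \<le> (\<Sum>z\<in>pR. e1 * (Sup (snd z) - Inf (snd z)))"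
      proof (rule sum_norm_le)
        fix z assume z: "z \<in> pR"
        obtain x k where xk: "z = (x, k)" by (cases z)
        with z K obtain u v where uv: "k = {u..v}" "u \<le> v" "a \<le> u" "v \<le> b" "x \<in> {u..v}"
          unfolding pR_def by blast
        have xN: "x \<in> {a..b} - N" using z xk uv by (auto simp: pR_def)
        have "u \<in> k" "v \<in> k" using uv(1,2) by auto
        moreover have "k \<subseteq> ball x (d x)"
          using fineD[OF fine, of x k] z xk by (simp add: \<gamma>_def pR_def)
        ultimately have "u \<in> ball x (d x)" "v \<in> ball x (d x)"
          by blast+
        then have "norm (u - x) < d x" "norm (v - x) < d x"
          by (simp_all add: dist_norm norm_minus_commute)
        moreover have "u \<in> {a..b}" "v \<in> {a..b}"
          using uv by auto
        ultimately have "norm (f u - f x - (u-x) *\<^sub>R f' x) \<le> e1 * norm (u-x)"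
          "norm (f v - f x - (v-x) *\<^sub>R f' x) \<le> e1 * norm (v-x)"
          by (simp_all only: d(2)[OF xN])
        then have "\<bar>(v - u) * f' x - (f v - f u)\<bar> \<le> e1 * (x - u) + e1 * (v - x)"
          using uv by (simp add: algebra_simps abs_if split: if_splits; linarith)
        then show "norm (?S z - ?F z) \<le> e1 * (Sup (snd z) - Inf (snd z))"
          using xk uv xN by (simp add: g_def algebra_simps)
      qed
      also have "\<dots> \<le> (\<Sum>z\<in>p. e1 * (Sup (snd z) - Inf (snd z)))"
      proof (rule sum_mono2)
        fix z assume z: "z \<in> p - pR"
        then have "(fst z, snd z) \<in> p" by simp
        from K[OF this] obtain u v where "snd z = {u..v}" "u \<le> v" by blast
        then show "0 \<le> e1 * (Sup (snd z) - Inf (snd z))" using e1 by simp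
      qed (auto simp: fin pR_def)
      also have "\<dots> = e1 * (b - a)" using total(2) by (simp add: sum_distrib_left)
      finally have R': "norm (\<Sum>z\<in>pR. ?S z - ?F z) < e / 2" using e1(2) by linarith
      have Nz: "(\<Sum>z\<in>pN. ?S z - ?F z) = - (\<Sum>z\<in>pN. ?F z)"
        unfolding sum_negf[symmetric] by (rule sum.cong) (auto simp: pN_def g_def)
      have DI: "disjoint_intervals a b pN (\<lambda>z. Inf (snd z)) (\<lambda>z. Sup (snd z))"
      proof (rule disjoint_intervalsI[OF fin(2)])
        fix z assume z: "z \<in> pN"
        obtain x k where xk: "z = (x, k)" by (cases z)
        with z K obtain u v where uv: "k = {u..v}" "u \<le> v" "a \<le> u" "v \<le> b"
          unfolding pN_def by blast
        with xk show "a \<le> Inf (snd z) \<and> Inf (snd z) \<le> Sup (snd z) \<and> Sup (snd z) \<le> b" by simp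
        fix w assume w: "w \<in> pN" "z \<noteq> w"
        obtain y k' where yk: "w = (y, k')" by (cases w)
        with w K obtain u' v' where uv': "k' = {u'..v'}" "u' \<le> v'"
          unfolding pN_def by blast
        have "interior k \<inter> interior k' = {}"
          using tagged_division_ofD(5)[OF p, of x k y k'] z w xk yk by (auto simp: pN_def)
        then show "{Inf (snd z)<..<Sup (snd z)} \<inter> {Inf (snd w)<..<Sup (snd w)} = {}"
          using uv uv' xk yk by simp
      qed
      have "ennreal (\<Sum>z\<in>pN. Sup (snd z) - Inf (snd z)) = (\<Sum>z\<in>pN. emeasure lebesgue {Inf (snd z)<..<Sup (snd z)})"
        using disjoint_intervalsD(2)[OF DI] by (subst sum_ennreal[symmetric]) (auto intro!: sum.cong)
      also have "\<dots> = emeasure lebesgue (\<Union>z\<in>pN. {Inf (snd z)<..<Sup (snd z)})"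
        using disjoint_intervalsD(3)[OF DI] fin(2)
        by (intro sum_emeasure) (auto simp: disjoint_family_on_def)
      also have "\<dots> \<le> emeasure lebesgue G"
      proof (rule emeasure_mono)
        show "(\<Union>z\<in>pN. {Inf (snd z)<..<Sup (snd z)}) \<subseteq> G"
        proof (rule UN_least)
          fix z assume z: "z \<in> pN"
          obtain x k where xk: "z = (x, k)" by (cases z)
          with z K obtain u v where uv: "k = {u..v}" "u \<le> v" unfolding pN_def by blast
          moreover have "k \<subseteq> G"
            using fineD[OF fine, of x k] z xk by (simp add: \<gamma>_def pN_def)
          ultimately show "{Inf (snd z)<..<Sup (snd z)} \<subseteq> G" using xk by auto
        qed
      qed (use G in auto)
      also have "\<dots> < ennreal \<delta>" by (rule G)
      finally have "(\<Sum>z\<in>pN. Sup (snd z) - Inf (snd z)) < \<delta>"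
        by (meson ennreal_leI leD not_le_imp_less)
      then have "(\<Sum>z\<in>pN. norm (?F z)) < e / 2"
        using \<delta>(2) DI by blast
      then have nN: "norm (\<Sum>z\<in>pN. ?F z) < e / 2"
        using norm_sum[of ?F pN] by linarith
      have eq: "(\<Sum>(x,k)\<in>p. measure lborel k *\<^sub>R g x) - (f b - f a) =
          (\<Sum>z\<in>pR. ?S z - ?F z) - (\<Sum>z\<in>pN. ?F z)"
      proof -
        have "(\<Sum>(x,k)\<in>p. measure lborel k *\<^sub>R g x) - (f b - f a) = (\<Sum>z\<in>p. ?S z - ?F z)"
          by (simp add: total(1) sum_subtractf case_prod_unfold)
        also have "\<dots> = (\<Sum>z\<in>pN. ?S z - ?F z) + (\<Sum>z\<in>pR. ?S z - ?F z)"
          unfolding split(1) by (rule sum.union_disjoint[OF fin(2,3) split(2)])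
        finally show ?thesis using Nz by simp
      qed
      show ?thesis unfolding eq using nN R' norm_triangle_ineq4[of "\<Sum>z\<in>pR. ?S z - ?F z" "\<Sum>z\<in>pN. ?F z"]
        by linarith
    qed
    show "\<exists>\<gamma>. gauge \<gamma> \<and> (\<forall>\<D>. \<D> tagged_division_of {a..b} \<and> \<gamma> fine \<D> \<longrightarrow>
        norm ((\<Sum>(x,k)\<in>\<D>. measure lborel k *\<^sub>R g x) - (f b - f a)) < e)"
      by (rule exI[of _ \<gamma>], intro conjI gauge allI impI, elim conjE, rule main)
  qed
  then show ?thesis
    by (rule has_integral_spike[OF N, rotated]) (simp add: g_def)
qed

text \<open>The bound \<open>g\<close> may be non-measurable, so its integral is a lower integral. The derivative itself
  is measurable, being integrable in the sense of gauge integration; if the lower integral of \<open>g\<close> is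
  finite, the derivative is Lebesgue integrable and the triangle inequality for integrals applies.\<close>

lemma abs_continuous_increment_le:
  fixes f :: "real \<Rightarrow> real"
  assumes ab: "0 \<le> a" "a \<le> b" "b \<le> 1" and ac: "abs_continuous_on a b f"
    and der: "AE t in lebesgue_on {0..1}. t \<in> {a..b} \<longrightarrow>
      (\<exists>D. (f has_vector_derivative D) (at t within {0..1}) \<and> ennreal \<bar>D\<bar> \<le> g t)"
  shows "ennreal \<bar>f b - f a\<bar> \<le> (\<integral>\<^sup>+ t. g t \<partial>lebesgue_on {0..1})"
proof (cases "(\<integral>\<^sup>+ t. g t \<partial>lebesgue_on {0..1}) = \<infinity>")
  case False
  let ?Q = "\<lambda>t D. (f has_vector_derivative D) (at t within {0..1}) \<and> ennreal \<bar>D\<bar> \<le> g t"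
  define f' where "f' t = (SOME D. ?Q t D)" for t
  have "AE t in lebesgue. t \<in> {0..1} \<longrightarrow> t \<in> {a..b} \<longrightarrow> (\<exists>D. ?Q t D)"
    using der by (simp add: AE_restrict_space_iff)
  then obtain N where N: "N \<in> null_sets lebesgue" "{t. \<not> (t \<in> {0..1} \<longrightarrow> t \<in> {a..b} \<longrightarrow> (\<exists>D. ?Q t D))} \<subseteq> N"
    unfolding eventually_ae_filter by auto
  have Q: "?Q t (f' t)" if "t \<in> {a..b} - N" for t
  proof -
    have "t \<in> {0..1}" "t \<in> {a..b}" "t \<notin> N" using that ab by auto
    then have "\<exists>D. ?Q t D" using N(2) by blast
    then show ?thesis unfolding f'_def by (rule someI_ex)
  qed
  have hi: "(f' has_integral (f b - f a)) {a..b}"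
  proof (rule ftc_abs_continuous[OF ab(2) ac])
    show "negligible N" using N(1) by (simp add: negligible_iff_null_sets)
    show "(f has_vector_derivative f' t) (at t within {a..b})" if "t \<in> {a..b} - N" for t
      using Q[OF that] ab by (auto intro: has_vector_derivative_within_subset)
  qed
  have "(\<integral>\<^sup>+ t. norm (f' t) \<partial>lebesgue_on {a..b}) = (\<integral>\<^sup>+ t. ennreal (norm (f' t)) * indicator {a..b} t \<partial>lebesgue)"
    by (simp add: nn_integral_restrict_space)
  also have "\<dots> \<le> (\<integral>\<^sup>+ t. g t * indicator {0..1} t \<partial>lebesgue)"
  proof (rule nn_integral_mono_AE)
    show "AE t in lebesgue. ennreal (norm (f' t)) * indicator {a..b} t \<le> g t * indicator {0..1} t"
      using AE_not_in[OF N(1)]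
    proof eventually_elim
      case (elim t)
      then show ?case using Q[of t] ab by (cases "t \<in> {a..b}") (auto simp: indicator_def)
    qed
  qed
  also have "\<dots> = (\<integral>\<^sup>+ t. g t \<partial>lebesgue_on {0..1})"
    by (simp add: nn_integral_restrict_space)
  finally have le: "(\<integral>\<^sup>+ t. norm (f' t) \<partial>lebesgue_on {a..b}) \<le> (\<integral>\<^sup>+ t. g t \<partial>lebesgue_on {0..1})" .
  have meas: "f' \<in> borel_measurable (lebesgue_on {a..b})"
    using has_integral_implies_lebesgue_measurable[OF hi]
    by (simp add: borel_measurable_restrict_space_iff)
  have int: "integrable (lebesgue_on {a..b}) f'"
    using meas le False by (intro integrableI_bounded) (auto simp: less_top[symmetric] top_unique)
  have "f b - f a = integral\<^sup>L (lebesgue_on {a..b}) f'"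
    using lebesgue_integral_eq_integral[OF int] integral_unique[OF hi] by simp
  then show ?thesis
    using integral_norm_bound_ennreal[OF int] le by simp
qed simp

section \<open>Lower integrals over the two halves of an interval\<close>

lemma AE_lebesgue_affine:
  assumes "c \<noteq> 0" "AE s in lebesgue. P s"
  shows "AE t in lebesgue. P (t0 + c * t :: real)"
proof -
  have "AE s in density (distr lebesgue lebesgue (\<lambda>x. t0 + c * x)) (\<lambda>_. ennreal \<bar>c\<bar>). P s"
    using assms(2) by (subst lebesgue_real_affine[OF assms(1), of t0, symmetric])
  then have "AE s in distr lebesgue lebesgue (\<lambda>x. t0 + c * x). P s"
    using assms(1) by (simp add: AE_density)
  then show ?thesis
    using lebesgue_affine_measurable[where c = "\<lambda>x::real. c"] assms(1)
    by (intro AE_distrD[of "\<lambda>x. t0 + c * x" lebesgue lebesgue P]) auto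
qed

text \<open>The maps \<open>s \<mapsto> (1 - s) / 2\<close> and \<open>s \<mapsto> (1 + s) / 2\<close> parametrise the two halves of the unit interval
  from its midpoint outwards. This is the reparametrisation that occurs when a reversed curve is
  followed by another one with the same starting point.\<close>

lemma AE_unit_interval_halves:
  assumes "AE s in lebesgue_on {0..1}. P ((1 - s) / 2)" "AE s in lebesgue_on {0..1}. P ((1 + s) / 2)"
  shows "AE t in lebesgue_on {0..1}. P (t::real)"
proof -
  have 1: "AE s in lebesgue. s \<in> {0..1} \<longrightarrow> P ((1 - s) / 2)"
    and 2: "AE s in lebesgue. s \<in> {0..1} \<longrightarrow> P ((1 + s) / 2)"
    using assms by (simp_all add: AE_restrict_space_iff)
  have "AE t in lebesgue. t \<in> {0..1/2} \<longrightarrow> P t"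
    using AE_lebesgue_affine[OF _ 1, of "-2" 1] by (auto elim!: eventually_mono)
  moreover have "AE t in lebesgue. t \<in> {1/2..1} \<longrightarrow> P t"
    using AE_lebesgue_affine[OF _ 2, of 2 "-1"] by (auto elim!: eventually_mono)
  ultimately have "AE t in lebesgue. t \<in> {0..1} \<longrightarrow> P t"
    by eventually_elim (metis atLeastAtMost_iff linear)
  then show ?thesis by (simp add: AE_restrict_space_iff)
qed

text \<open>Substitution and additivity are known for measurable integrands, while here \<open>F\<close>, \<open>f1\<close> and \<open>f2\<close>
  are arbitrary. The integral is a supremum over simple functions below \<open>F\<close>; each of these is measurable,
  can be split at the midpoint, and after substitution lies below \<open>f1\<close> and \<open>f2\<close> almost everywhere.\<close>

lemma nn_integral_unit_interval_halves:
  fixes F f1 f2 :: "real \<Rightarrow> ennreal"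
  assumes 1: "AE s in lebesgue_on {0..1}. F ((1 - s) / 2) \<le> 2 * f1 s"
    and 2: "AE s in lebesgue_on {0..1}. F ((1 + s) / 2) \<le> 2 * f2 s"
  shows "(\<integral>\<^sup>+ t. F t \<partial>lebesgue_on {0..1}) \<le>
    (\<integral>\<^sup>+ t. f1 t \<partial>lebesgue_on {0..1}) + (\<integral>\<^sup>+ t. f2 t \<partial>lebesgue_on {0..1})"
proof -
  have half: "(\<integral>\<^sup>+ t. g t * indicator A t \<partial>lebesgue) \<le> (\<integral>\<^sup>+ t. f t \<partial>lebesgue_on {0..1})"
    if g: "g \<in> borel_measurable lebesgue" and gF: "\<And>t. g t * indicator {0..1} t \<le> F t * indicator {0..1} t"
      and A: "A \<in> sets lebesgue" "\<And>s. 1/2 + c * s \<in> A \<Longrightarrow> s \<in> {0..1}" "A \<subseteq> {0..1}" and c: "\<bar>c\<bar> = 1/2"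
      and ae: "AE s in lebesgue_on {0..1}. F (1/2 + c * s) \<le> 2 * f s" for g A c f
  proof -
    have ae': "AE s in lebesgue. s \<in> {0..1} \<longrightarrow> F (1/2 + c * s) \<le> 2 * f s"
      using ae by (simp add: AE_restrict_space_iff)
    have "(\<integral>\<^sup>+ t. g t * indicator A t \<partial>lebesgue) =
        ennreal \<bar>c\<bar> * (\<integral>\<^sup>+ s. g (1/2 + c * s) * indicator A (1/2 + c * s) \<partial>lebesgue)"
      using g A(1) c by (intro nn_integral_real_affine_lebesgue) auto
    also have "\<dots> = (\<integral>\<^sup>+ s. ennreal (1/2) * (g (1/2 + c * s) * indicator A (1/2 + c * s)) \<partial>lebesgue)"
    proof -
      have [measurable]: "(\<lambda>x. 1/2 + c * x) \<in> lebesgue \<rightarrow>\<^sub>M lebesgue"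
        using lebesgue_affine_measurable[where c = "\<lambda>x::real. c" and t = "1/2"] c by fastforce
      have "(\<lambda>s. g (1/2 + c * s) * indicator A (1/2 + c * s)) \<in> borel_measurable lebesgue"
        using measurable_compose[OF \<open>(\<lambda>x. 1/2 + c * x) \<in> lebesgue \<rightarrow>\<^sub>M lebesgue\<close>, of "\<lambda>t. g t * indicator A t"] g A(1)
        by auto
      then show ?thesis unfolding c by (rule nn_integral_cmult[symmetric])
    qed
    also have "\<dots> \<le> (\<integral>\<^sup>+ s. f s * indicator {0..1} s \<partial>lebesgue)"
    proof (rule nn_integral_mono_AE)
      show "AE s in lebesgue. ennreal (1/2) * (g (1/2 + c * s) * indicator A (1/2 + c * s)) \<le> f s * indicator {0..1} s"
        using ae'
      proof eventually_elim
        case (elim s)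
        show ?case
        proof (cases "1/2 + c * s \<in> A")
          case True
          then have s: "s \<in> {0..1}" "1/2 + c * s \<in> {0..1}" using A(2,3) by auto
          then have "g (1/2 + c * s) \<le> 2 * f s"
            using order_trans[OF _ elim[rule_format, OF s(1)]] gF[of "1/2 + c * s"] by simp
          then have "ennreal (1/2) * g (1/2 + c * s) \<le> ennreal (1/2) * (2 * f s)"
            by (rule mult_left_mono) simp
          also have "\<dots> = (ennreal (1/2) * ennreal 2) * f s"
            by (simp add: mult.assoc)
          also have "\<dots> = f s"
            by (simp only: ennreal_mult[symmetric]) simp
          finally show ?thesis using s True by simp
        qed simp
      qed
    qed
    finally show ?thesis by (simp add: nn_integral_restrict_space)
  qed
  show ?thesis
    unfolding nn_integral_def[of "lebesgue_on {0..1}" F]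
  proof (rule SUP_least)
    fix g assume "g \<in> {g. simple_function (lebesgue_on {0..1}) g \<and> g \<le> F}"
    then have g: "simple_function (lebesgue_on {0..1}) g" "g \<le> F" by auto
    define h where "h t = g t * indicator {0..1} t" for t
    have h: "h \<in> borel_measurable lebesgue"
      using borel_measurable_simple_function[OF g(1)]
      unfolding h_def by (subst (asm) borel_measurable_restrict_space_iff_ennreal) (auto simp: mult.commute)
    have ae1: "AE s in lebesgue_on {0..1}. F (1 / 2 + (- 1 / 2) * s) \<le> 2 * f1 s"
      using 1 by (simp add: diff_divide_distrib)
    have ae2: "AE s in lebesgue_on {0..1}. F (1 / 2 + (1 / 2) * s) \<le> 2 * f2 s"
      using 2 by (simp add: add_divide_distrib)
    have hF: "h t * indicator {0..1} t \<le> F t * indicator {0..1} t" for t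
      using g(2) by (auto simp: h_def le_fun_def indicator_def)
    have "integral\<^sup>S (lebesgue_on {0..1}) g = (\<integral>\<^sup>+ t. g t \<partial>lebesgue_on {0..1})"
      using nn_integral_eq_simple_integral[OF g(1)] by simp
    also have "\<dots> = (\<integral>\<^sup>+ t. h t * indicator {0..1/2} t + h t * indicator {1/2<..1} t \<partial>lebesgue)"
      by (auto simp: nn_integral_restrict_space h_def indicator_def intro!: nn_integral_cong)
    also have "\<dots> = (\<integral>\<^sup>+ t. h t * indicator {0..1/2} t \<partial>lebesgue) + (\<integral>\<^sup>+ t. h t * indicator {1/2<..1} t \<partial>lebesgue)"
      by (intro nn_integral_add borel_measurable_times_ennreal h borel_measurable_indicator) auto
    also have "\<dots> \<le> (\<integral>\<^sup>+ t. f1 t \<partial>lebesgue_on {0..1}) + (\<integral>\<^sup>+ t. f2 t \<partial>lebesgue_on {0..1})"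
      by (intro add_mono half[OF h hF _ _ _ _ ae1] half[OF h hF _ _ _ _ ae2]) auto
    finally show "integral\<^sup>S (lebesgue_on {0..1}) g \<le>
        (\<integral>\<^sup>+ t. f1 t \<partial>lebesgue_on {0..1}) + (\<integral>\<^sup>+ t. f2 t \<partial>lebesgue_on {0..1})" .
  qed
qed

section \<open>Integral curves of contracting fields\<close>

text \<open>The Picard operator is a contraction of the bounded continuous functions on the line, with factor
  \<open>L\<close> because the time interval has length \<open>1\<close>. Functions on the unit interval are extended to the line by
  clamping the argument, so that boundedness is automatic. In the application, the condition \<open>L < 1\<close>
  is met by scaling the field, that is by flowing for a short time.\<close>

lemma ode_solution_unit_interval:
  fixes F :: "'e::euclidean_space \<Rightarrow> 'e"
  assumes lip: "\<And>x y. norm (F x - F y) \<le> L * norm (x - y)" and L: "0 \<le> L" "L < 1"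
  obtains c where "c 0 = x0" "\<And>t. t \<in> {0..1} \<Longrightarrow> (c has_vector_derivative F (c t)) (at t within {0..1})"
proof -
  have contF: "continuous_on S F" for S
    using lip by (intro lipschitz_on_continuous_on[of L S F] lipschitz_onI L(1)) (auto simp: dist_norm)
  define T where "T c t = x0 + integral {0..t} (\<lambda>s. F (apply_bcontfun c s))" for c :: "real \<Rightarrow>\<^sub>C 'e" and t
  have cFc: "continuous_on S (\<lambda>s. F (apply_bcontfun c s))" for c :: "real \<Rightarrow>\<^sub>C 'e" and S
    by (rule continuous_on_compose2[OF contF[of UNIV]]) auto
  have int: "(\<lambda>s. F (apply_bcontfun c s)) integrable_on {a..b}" for c :: "real \<Rightarrow>\<^sub>C 'e" and a b
    by (intro integrable_continuous_real cFc)
  have contT: "continuous_on (cbox 0 1) (T c)" for c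
    unfolding T_def using indefinite_integral_continuous_1[OF int[of c 0 1]]
    by (intro continuous_intros) auto
  have "\<exists>g. \<forall>t. apply_bcontfun g t = T c (clamp 0 1 t)" for c
    using continuous_on_cbox_bcontfunE[OF contT[of c]] by metis
  then obtain \<Phi> where \<Phi>: "\<And>c t. apply_bcontfun (\<Phi> c) t = T c (clamp 0 1 t)" by metis
  have "\<forall>c c'. dist (\<Phi> c) (\<Phi> c') \<le> L * dist c c'"
  proof (intro allI dist_bound)
    fix c c' and t
    let ?s = "clamp 0 1 t :: real"
    have s: "?s \<in> {0..1}" using clamp_in_interval[of "0::real" 1 t] by simp
    have "dist (\<Phi> c t) (\<Phi> c' t) = norm (integral {0..?s} (\<lambda>u. F (c u) - F (c' u)))"
      by (simp add: \<Phi> T_def dist_norm integral_diff[OF int int])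
    also have "\<dots> \<le> integral {0..?s} (\<lambda>u. L * dist c c')"
    proof (rule integral_norm_bound_integral)
      show "(\<lambda>u. F (c u) - F (c' u)) integrable_on {0..?s}" by (intro integrable_diff int)
      fix u
      have "norm (F (c u) - F (c' u)) \<le> L * dist (c u) (c' u)"
        using lip by (simp add: dist_norm)
      also have "\<dots> \<le> L * dist c c'"
        using L(1) by (intro mult_left_mono dist_bounded)
      finally show "norm (F (c u) - F (c' u)) \<le> L * dist c c'" .
    qed auto
    also have "\<dots> = ?s * (L * dist c c')" using s by simp
    also have "\<dots> \<le> 1 * (L * dist c c')"
      using s L(1) by (intro mult_right_mono) auto
    finally show "dist (\<Phi> c t) (\<Phi> c' t) \<le> L * dist c c'" by simp
  qed
  from banach_fix_type[OF L this] obtain c where c: "\<Phi> c = c" by blast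
  have eq: "apply_bcontfun c t = T c t" if "t \<in> {0..1}" for t
    using \<Phi>[of c t] c that by simp
  show thesis
  proof (rule that[of "apply_bcontfun c"])
    show "apply_bcontfun c 0 = x0" using eq[of 0] by (simp add: T_def)
    fix t :: real assume t: "t \<in> {0..1}"
    have "((\<lambda>u. integral {0..u} (\<lambda>s. F (c s))) has_vector_derivative F (c t)) (at t within {0..1})"
      by (rule integral_has_vector_derivative[OF cFc t])
    then have "(T c has_vector_derivative F (c t)) (at t within {0..1})"
      unfolding T_def by (auto intro!: derivative_eq_intros)
    then show "(apply_bcontfun c has_vector_derivative F (c t)) (at t within {0..1})"
      by (rule has_vector_derivative_transform[OF t, rotated]) (simp add: eq)
  qed
qed

section \<open>Derivations and velocities in a chart\<close>

text \<open>The coordinates of a derivation in a chart; this is the fibre part of the maps in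
  \<^const>\<open>tangent_charts\<close>.\<close>

definition coord_vec :: "('a \<Rightarrow> 'e::euclidean_space) \<Rightarrow> 'a tvec \<Rightarrow> 'e" where
  "coord_vec \<phi> v = (\<Sum>b\<in>Basis. v (\<lambda>q. \<phi> q \<bullet> b) *\<^sub>R b)"

locale atlas_chart =
  fixes A :: "('a::{t2_space, second_countable_topology}, 'e::euclidean_space) chart set" and U \<phi>
  assumes atlas: "smooth_atlas A" and chart: "(U, \<phi>) \<in> A"
begin

abbreviation \<psi> where "\<psi> \<equiv> inv_into U \<phi>"

lemma chart_props:
  shows "open U" "inj_on \<phi> U" "open (\<phi> ` U)" "continuous_on U \<phi>" "continuous_on (\<phi> ` U) \<psi>"
    "U \<subseteq> chart_union A"
  using atlas chart unfolding smooth_atlas_def chart_union_def homeomorphism_def by blast+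

lemma psi_phi [simp]: "q \<in> U \<Longrightarrow> \<psi> (\<phi> q) = q"
  using chart_props(2) by simp

lemma phi_psi [simp]: "x \<in> \<phi> ` U \<Longrightarrow> \<phi> (\<psi> x) = x"
  by (rule f_inv_into_f)

lemma psi_in [simp]: "x \<in> \<phi> ` U \<Longrightarrow> \<psi> x \<in> U"
  by (rule inv_into_into)

lemma open_chart_image:
  assumes "open W" shows "open (\<phi> ` (U \<inter> W))"
proof -
  have "\<phi> ` (U \<inter> W) = \<phi> ` U \<inter> \<psi> -` W"
    by auto
  moreover have "open (\<phi> ` U \<inter> \<psi> -` W)"
    using continuous_open_preimage[OF chart_props(5,3) assms] .
  ultimately show ?thesis by simp
qed

lemma open_chart_preimage:
  assumes "open X" shows "open (U \<inter> \<phi> -` X)"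
  using continuous_open_preimage[OF chart_props(4,1) assms] .

lemma transition_smooth:
  assumes "(V, \<theta>) \<in> A" shows "smooth_on (\<theta> ` (V \<inter> U)) (\<phi> \<circ> inv_into V \<theta>)"
  using atlas chart assms unfolding smooth_atlas_def smoothly_compatible_def by blast

lemma smooth_nearI:
  assumes W: "open W" "p \<in> W" "W \<subseteq> U" and f: "smooth_on (\<phi> ` W) f"
    and h: "\<And>q. q \<in> W \<Longrightarrow> h q = f (\<phi> q)"
  shows "smooth_near A p h"
  unfolding smooth_near_def smooth_fun_on_def
proof (intro exI[of _ W] conjI ballI W(1,2))
  show "W \<subseteq> chart_union A" using W chart_props(6) by blast
  fix z assume z: "z \<in> A"
  obtain V \<theta> where [simp]: "z = (V, \<theta>)" by (cases z)
  interpret V: atlas_chart A V \<theta> by unfold_locales (use atlas z in auto)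
  have opn: "open (\<theta> ` (V \<inter> W))" "open (\<phi> ` W)"
    using V.open_chart_image W(1) open_chart_image[OF W(1)] W(3) by (auto simp: Int_absorb1)
  have "smooth_on (\<theta> ` (V \<inter> W)) (\<lambda>x. f ((\<phi> \<circ> V.\<psi>) x))"
    by (rule smooth_on_compose[OF f smooth_on_subset[OF transition_smooth] opn])
      (use z W(3) in auto)
  then have "smooth_on (\<theta> ` (V \<inter> W)) (h \<circ> V.\<psi>)"
    by (rule smooth_on_cong[OF _ opn(1)]) (use h W(3) in auto)
  then show "case z of (U, \<phi>) \<Rightarrow> smooth_on (\<phi> ` (U \<inter> W)) (h \<circ> inv_into U \<phi>)" by simp
qed

text \<open>The definition of \<^const>\<open>smooth_near\<close> tests a function in all charts. By smoothness of the
  transition maps it can be tested in any single chart around the point.\<close>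

lemma smooth_near_iff:
  assumes p: "p \<in> U"
  shows "smooth_near A p h \<longleftrightarrow>
    (\<exists>\<rho>>0. ball (\<phi> p) \<rho> \<subseteq> \<phi> ` U \<and> smooth_on (ball (\<phi> p) \<rho>) (h \<circ> \<psi>))"
proof
  assume "smooth_near A p h"
  then obtain W where W: "open W" "p \<in> W" "smooth_on (\<phi> ` (U \<inter> W)) (h \<circ> \<psi>)"
    unfolding smooth_near_def smooth_fun_on_def using chart by fastforce
  then obtain \<rho> where "\<rho> > 0" "ball (\<phi> p) \<rho> \<subseteq> \<phi> ` (U \<inter> W)"
    using openE[OF open_chart_image[OF W(1)], of "\<phi> p"] p by blast
  with W(3) show "\<exists>\<rho>>0. ball (\<phi> p) \<rho> \<subseteq> \<phi> ` U \<and> smooth_on (ball (\<phi> p) \<rho>) (h \<circ> \<psi>)"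
    using smooth_on_subset by (intro exI[of _ \<rho>]) blast
next
  assume "\<exists>\<rho>>0. ball (\<phi> p) \<rho> \<subseteq> \<phi> ` U \<and> smooth_on (ball (\<phi> p) \<rho>) (h \<circ> \<psi>)"
  then obtain \<rho> where \<rho>: "\<rho> > 0" "ball (\<phi> p) \<rho> \<subseteq> \<phi> ` U" "smooth_on (ball (\<phi> p) \<rho>) (h \<circ> \<psi>)"
    by blast
  show "smooth_near A p h"
  proof (rule smooth_nearI[of "U \<inter> \<phi> -` ball (\<phi> p) \<rho>"])
    show "open (U \<inter> \<phi> -` ball (\<phi> p) \<rho>)" by (rule open_chart_preimage) simp
    show "p \<in> U \<inter> \<phi> -` ball (\<phi> p) \<rho>" using p \<rho>(1) by simp
    show "smooth_on (\<phi> ` (U \<inter> \<phi> -` ball (\<phi> p) \<rho>)) (h \<circ> \<psi>)"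
      by (rule smooth_on_subset[OF \<rho>(3)]) auto
  qed auto
qed

lemma smooth_near_chart_comp:
  assumes "p \<in> U" "\<rho> > 0" "smooth_on (ball (\<phi> p) \<rho>) f"
  shows "smooth_near A p (\<lambda>q. f (\<phi> q))"
proof (rule smooth_nearI[of "U \<inter> \<phi> -` ball (\<phi> p) \<rho>"])
  show "open (U \<inter> \<phi> -` ball (\<phi> p) \<rho>)" by (rule open_chart_preimage) simp
  show "p \<in> U \<inter> \<phi> -` ball (\<phi> p) \<rho>" using assms by simp
  show "smooth_on (\<phi> ` (U \<inter> \<phi> -` ball (\<phi> p) \<rho>)) f"
    by (rule smooth_on_subset[OF assms(3)]) auto
qed auto

lemma smooth_near_linear: "p \<in> U \<Longrightarrow> smooth_near A p (\<lambda>q. \<phi> q \<bullet> w)"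
  by (rule smooth_near_chart_comp[of _ 1]) (auto intro: smooth_on_bounded_linear bounded_linear_inner_left)

lemma smooth_near_has_derivative:
  assumes "p \<in> U" "smooth_near A p h"
  shows "((h \<circ> \<psi>) has_derivative frechet_derivative (h \<circ> \<psi>) (at (\<phi> p))) (at (\<phi> p))"
proof -
  obtain \<rho> where "\<rho> > 0" "smooth_on (ball (\<phi> p) \<rho>) (h \<circ> \<psi>)"
    using assms smooth_near_iff by blast
  then show ?thesis using smooth_on_has_derivative[of "ball (\<phi> p) \<rho>" "h \<circ> \<psi>" "\<phi> p"] by simp
qed

lemma smooth_near_add_mult:
  assumes p: "p \<in> U" and h: "smooth_near A p h" and k: "smooth_near A p k"
  shows "smooth_near A p (\<lambda>q. h q + k q)" "smooth_near A p (\<lambda>q. h q * k q)"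
proof -
  obtain \<rho>1 where 1: "\<rho>1 > 0" "ball (\<phi> p) \<rho>1 \<subseteq> \<phi> ` U" "smooth_on (ball (\<phi> p) \<rho>1) (h \<circ> \<psi>)"
    using h smooth_near_iff[OF p] by blast
  obtain \<rho>2 where 2: "\<rho>2 > 0" "ball (\<phi> p) \<rho>2 \<subseteq> \<phi> ` U" "smooth_on (ball (\<phi> p) \<rho>2) (k \<circ> \<psi>)"
    using k smooth_near_iff[OF p] by blast
  define \<rho> where "\<rho> = min \<rho>1 \<rho>2"
  have \<rho>: "\<rho> > 0" "ball (\<phi> p) \<rho> \<subseteq> \<phi> ` U" using 1 2 by (auto simp: \<rho>_def)
  have sm: "smooth_on (ball (\<phi> p) \<rho>) (h \<circ> \<psi>)" "smooth_on (ball (\<phi> p) \<rho>) (k \<circ> \<psi>)"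
    by (rule smooth_on_subset[OF 1(3)] smooth_on_subset[OF 2(3)], force simp: \<rho>_def)+
  show "smooth_near A p (\<lambda>q. h q + k q)"
    unfolding smooth_near_iff[OF p] using \<rho> smooth_on_add[OF _ sm]
    by (intro exI[of _ \<rho>]) (simp add: o_def)
  show "smooth_near A p (\<lambda>q. h q * k q)"
    unfolding smooth_near_iff[OF p] using \<rho> smooth_on_mult[OF _ sm]
    by (intro exI[of _ \<rho>]) (simp add: o_def)
qed

lemma smooth_near_const: "p \<in> U \<Longrightarrow> smooth_near A p (\<lambda>q. c)"
  by (rule smooth_near_chart_comp[of _ 1 "\<lambda>x. c"]) auto

text \<open>By Hadamard's lemma, \<open>h\<close> agrees near \<open>p\<close> with \<open>h p + (\<Sum>b. ((\<phi> - \<phi> p) \<bullet> b) * (g b \<circ> \<phi>))\<close>. A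
  derivation kills constants, and on each product only the term survives in which it hits the factor that
  vanishes at \<open>p\<close>; the other factor has the partial derivative of \<open>h\<close> as its value at \<open>p\<close>.\<close>

lemma derivation_formula:
  assumes v: "v \<in> tangent_space A p" and p: "p \<in> U" and h: "smooth_near A p h"
  shows "v h = frechet_derivative (h \<circ> \<psi>) (at (\<phi> p)) (coord_vec \<phi> v)"
proof -
  note sn = smooth_near_chart_comp[OF p]
  have germ: "v f = v k" if "smooth_near A p f" "smooth_near A p k" "\<forall>\<^sub>F q in nhds p. f q = k q" for f k
    using v that unfolding tangent_space_def by blast
  have add: "v (\<lambda>q. f q + k q) = v f + v k" if "smooth_near A p f" "smooth_near A p k" for f k
    using v that unfolding tangent_space_def by blast
  have scale: "v (\<lambda>q. c * f q) = c * v f" if "smooth_near A p f" for c f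
    using v that unfolding tangent_space_def by blast
  have prod: "v (\<lambda>q. f q * k q) = f p * v k + k p * v f" if "smooth_near A p f" "smooth_near A p k" for f k
    using v that unfolding tangent_space_def by blast
  \<comment> \<open>the product rule applied to 1 = 1 * 1 gives v 1 = v 1 + v 1\<close>
  have "v (\<lambda>q. 1) = 0"
    using prod[OF smooth_near_const smooth_near_const, OF p p, of 1 1] by simp
  then have const: "v (\<lambda>q. c) = 0" for c
    using scale[OF smooth_near_const, OF p, of c 1] by simp
  obtain \<rho> where \<rho>: "\<rho> > 0" "ball (\<phi> p) \<rho> \<subseteq> \<phi> ` U" "smooth_on (ball (\<phi> p) \<rho>) (h \<circ> \<psi>)"
    using h smooth_near_iff[OF p] by blast
  define B where "B = ball (\<phi> p) \<rho>"
  have B: "open B" "convex B" "\<phi> p \<in> B" "smooth_on B (h \<circ> \<psi>)"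
    using \<rho> by (auto simp: B_def)
  obtain g where g: "\<And>b. smooth_on B (g b)"
    "\<And>x. x \<in> B \<Longrightarrow> (h \<circ> \<psi>) x = (h \<circ> \<psi>) (\<phi> p) + (\<Sum>b\<in>Basis. ((x - \<phi> p) \<bullet> b) * g b x)"
    "\<And>b. g b (\<phi> p) = frechet_derivative (h \<circ> \<psi>) (at (\<phi> p)) b"
    using hadamard[OF B] by blast
  have lin: "smooth_on B (\<lambda>x. (x - \<phi> p) \<bullet> b)" for b
  proof -
    have "smooth_on B (\<lambda>x. (x + (- \<phi> p)) \<bullet> b)"
      by (intro smooth_on_inner smooth_on_add B) auto
    then show ?thesis by simp
  qed
  have X: "v (\<lambda>q. (\<phi> q - \<phi> p) \<bullet> b) = v (\<lambda>q. \<phi> q \<bullet> b)" for b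
    using add[OF smooth_near_linear[OF p, of b] smooth_near_const[OF p, of "- (\<phi> p \<bullet> b)"]] const
    by (simp add: inner_diff_left)
  have smG: "smooth_near A p (\<lambda>q. g b (\<phi> q))" and smX: "smooth_near A p (\<lambda>q. (\<phi> q - \<phi> p) \<bullet> b)"
    and smXG: "smooth_near A p (\<lambda>q. ((\<phi> q - \<phi> p) \<bullet> b) * g b (\<phi> q))" for b
    using sn[OF \<rho>(1)] g(1) lin smooth_on_mult[OF B(1) lin g(1)] unfolding B_def by blast+
  have XG: "v (\<lambda>q. ((\<phi> q - \<phi> p) \<bullet> b) * g b (\<phi> q)) = g b (\<phi> p) * v (\<lambda>q. \<phi> q \<bullet> b)" for b
    using prod[OF smX smG, of b b] X by simp
  have sum: "smooth_near A p (\<lambda>q. \<Sum>b\<in>F. ((\<phi> q - \<phi> p) \<bullet> b) * g b (\<phi> q)) \<and>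
      v (\<lambda>q. \<Sum>b\<in>F. ((\<phi> q - \<phi> p) \<bullet> b) * g b (\<phi> q)) = (\<Sum>b\<in>F. g b (\<phi> p) * v (\<lambda>q. \<phi> q \<bullet> b))"
    if "finite F" for F
    using that
  proof induction
    case empty
    then show ?case using const smooth_near_const[OF p] by simp
  next
    case (insert b F)
    then show ?case using add[OF smXG, of _ b] smooth_near_add_mult(1)[OF p smXG, of _ b] XG by simp
  qed
  let ?S = "\<lambda>q. \<Sum>b\<in>Basis. ((\<phi> q - \<phi> p) \<bullet> b) * g b (\<phi> q)"
  have "v h = v (\<lambda>q. h p + ?S q)"
  proof (rule germ[OF h])
    show "smooth_near A p (\<lambda>q. h p + ?S q)"
      using smooth_near_add_mult(1)[OF p smooth_near_const[OF p]] sum by simp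
    have "\<forall>\<^sub>F q in nhds p. q \<in> U \<inter> \<phi> -` B"
      by (rule eventually_nhds_in_open[OF open_chart_preimage[OF B(1)]]) (use p B in auto)
    then show "\<forall>\<^sub>F q in nhds p. h q = h p + ?S q"
    proof eventually_elim
      case (elim q)
      then show ?case using g(2)[of "\<phi> q"] p by simp
    qed
  qed
  also have "\<dots> = (\<Sum>b\<in>Basis. g b (\<phi> p) * v (\<lambda>q. \<phi> q \<bullet> b))"
    using add[OF smooth_near_const[OF p]] sum const by simp
  also have "\<dots> = frechet_derivative (h \<circ> \<psi>) (at (\<phi> p)) (coord_vec \<phi> v)"
  proof -
    have l: "linear (frechet_derivative (h \<circ> \<psi>) (at (\<phi> p)))"
      using has_derivative_linear[OF smooth_near_has_derivative[OF p h]] .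
    show ?thesis
      unfolding coord_vec_def g(3) by (simp add: linear_sum[OF l] linear_scale[OF l] mult.commute)
  qed
  finally show ?thesis .
qed

lemma coord_vec_inner:
  assumes v: "v \<in> tangent_space A p" and p: "p \<in> U"
  shows "coord_vec \<phi> v \<bullet> w = v (\<lambda>q. \<phi> q \<bullet> w)"
proof -
  have "frechet_derivative (\<lambda>x. x \<bullet> w) (at (\<phi> p)) = frechet_derivative ((\<lambda>q. \<phi> q \<bullet> w) \<circ> \<psi>) (at (\<phi> p))"
    by (rule frechet_derivative_transform_within_open[OF _ chart_props(3)])
      (use p in \<open>auto intro!: bounded_linear_imp_differentiable bounded_linear_inner_left\<close>)
  moreover have "frechet_derivative (\<lambda>x. x \<bullet> w) (at (\<phi> p)) = (\<lambda>x. x \<bullet> w)"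
    by (rule frechet_derivative_at[symmetric])
      (rule bounded_linear_imp_has_derivative[OF bounded_linear_inner_left])
  ultimately show ?thesis
    using derivation_formula[OF v p smooth_near_linear[OF p, of w]] by metis
qed

lemma tangent_space_eqI:
  assumes "v \<in> tangent_space A p" "w \<in> tangent_space A p" "p \<in> U" "coord_vec \<phi> v = coord_vec \<phi> w"
  shows "v = w"
proof
  fix h
  show "v h = w h"
  proof (cases "smooth_near A p h")
    case True
    then show ?thesis using derivation_formula assms by metis
  next
    case False
    then show ?thesis using assms(1,2) unfolding tangent_space_def by simp
  qed
qed

text \<open>The witness is the partial derivative along a basis vector, extended by \<open>0\<close> to functions that are
  not smooth near \<open>p\<close>.\<close>

lemma tangent_space_nontrivial:
  assumes p: "p \<in> U"
  shows "\<exists>v\<in>tangent_space A p. v \<noteq> (\<lambda>h. 0)"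
proof -
  obtain u :: 'e where u: "u \<in> Basis" using nonempty_Basis by blast
  let ?D = "\<lambda>h. frechet_derivative (h \<circ> \<psi>) (at (\<phi> p))"
  define v where "v h = (if smooth_near A p h then ?D h u else 0)" for h
  note der = smooth_near_has_derivative[OF p]
  have "v \<in> tangent_space A p"
    unfolding tangent_space_def
  proof (intro CollectI conjI allI impI)
    fix h k assume h: "smooth_near A p h"
    have "smooth_near A p (\<lambda>q. c * h q)" for c
      using smooth_near_add_mult(2)[OF p smooth_near_const[OF p] h] .
    moreover have "?D (\<lambda>q. c * h q) = (\<lambda>x. c * ?D h x)" for c
      by (rule frechet_derivative_at[symmetric])
        (use has_derivative_mult_right[OF der[OF h], of c] in \<open>simp add: o_def\<close>)
    ultimately show "v (\<lambda>q. c * h q) = c * v h" for c using h by (simp add: v_def)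
    assume k: "smooth_near A p k"
    show "v (\<lambda>q. h q + k q) = v h + v k"
    proof -
      have "?D (\<lambda>q. h q + k q) = (\<lambda>x. ?D h x + ?D k x)"
        by (rule frechet_derivative_at[symmetric])
          (use has_derivative_add[OF der[OF h] der[OF k]] in \<open>simp add: o_def\<close>)
      then show ?thesis using smooth_near_add_mult(1)[OF p h k] h k by (simp add: v_def)
    qed
    show "v (\<lambda>q. h q * k q) = h p * v k + k p * v h"
    proof -
      have "?D (\<lambda>q. h q * k q) = (\<lambda>x. h p * ?D k x + ?D h x * k p)"
        by (rule frechet_derivative_at[symmetric])
          (use has_derivative_mult[OF der[OF h] der[OF k]] p in \<open>simp add: o_def\<close>)
      then show ?thesis using smooth_near_add_mult(2)[OF p h k] h k by (simp add: v_def)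
    qed
    assume "\<forall>\<^sub>F q in nhds p. h q = k q"
    then obtain W where W: "open W" "p \<in> W" "\<And>q. q \<in> W \<Longrightarrow> h q = k q"
      unfolding eventually_nhds by blast
    have "?D h = ?D k"
    proof (rule frechet_derivative_transform_within_open[OF _ open_chart_image[OF W(1)]])
      show "(h \<circ> \<psi>) differentiable at (\<phi> p)" using der[OF h] differentiable_def by blast
      show "\<phi> p \<in> \<phi> ` (U \<inter> W)" using p W by blast
      show "(h \<circ> \<psi>) x = (k \<circ> \<psi>) x" if "x \<in> \<phi> ` (U \<inter> W)" for x
        using that W(3) by auto
    qed
    then show "v h = v k" using h k by (simp add: v_def)
  qed (simp add: v_def)
  moreover have "v (\<lambda>q. \<phi> q \<bullet> u) = 1"
  proof -
    have "?D (\<lambda>q. \<phi> q \<bullet> u) = (\<lambda>x. x \<bullet> u)"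
    proof (rule frechet_derivative_at[symmetric])
      show "((\<lambda>q. \<phi> q \<bullet> u) \<circ> \<psi> has_derivative (\<lambda>x. x \<bullet> u)) (at (\<phi> p))"
        by (rule has_derivative_transform_within_open[OF bounded_linear_imp_has_derivative[OF bounded_linear_inner_left] chart_props(3)])
          (use p in auto)
    qed
    then show ?thesis using smooth_near_linear[OF p] u by (simp add: v_def)
  qed
  ultimately show ?thesis by (metis zero_neq_one)
qed

lemma curve_has_derivative:
  assumes \<gamma>: "continuous_on {0..1} \<gamma>" "t \<in> {0..1}" "\<gamma> t \<in> U" and h: "smooth_near A (\<gamma> t) h"
    and d: "((\<phi> \<circ> \<gamma>) has_vector_derivative w) (at t within {0..1})"
  shows "((h \<circ> \<gamma>) has_vector_derivative frechet_derivative (h \<circ> \<psi>) (at (\<phi> (\<gamma> t))) w) (at t within {0..1})"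
proof -
  let ?D = "frechet_derivative (h \<circ> \<psi>) (at (\<phi> (\<gamma> t)))"
  have "\<forall>\<^sub>F s in at t within {0..1}. \<gamma> s \<in> U"
    using \<gamma> chart_props(1) by (metis continuous_on topological_tendstoD)
  then obtain S where S: "open S" "t \<in> S" "\<And>s. s \<in> S \<Longrightarrow> s \<in> {0..1} \<Longrightarrow> \<gamma> s \<in> U"
    unfolding eventually_at_topological using \<gamma>(3) by metis
  have "((\<lambda>s. (h \<circ> \<psi>) ((\<phi> \<circ> \<gamma>) s)) has_derivative (\<lambda>s. ?D (s *\<^sub>R w))) (at t within {0..1})"
    using has_derivative_compose[OF d[unfolded has_vector_derivative_def], of "h \<circ> \<psi>" ?D]
      smooth_near_has_derivative[OF \<gamma>(3) h] by simp
  then have "((h \<circ> \<gamma>) has_derivative (\<lambda>s. ?D (s *\<^sub>R w))) (at t within {0..1})"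
  proof (rule has_derivative_transform_eventually)
    show "\<forall>\<^sub>F s in at t within {0..1}. (h \<circ> \<psi>) ((\<phi> \<circ> \<gamma>) s) = (h \<circ> \<gamma>) s"
      unfolding eventually_at_topological using S by (intro exI[of _ S]) auto
  qed (use \<gamma> in auto)
  then show ?thesis
    unfolding has_vector_derivative_def
    using linear_scale[OF has_derivative_linear[OF smooth_near_has_derivative[OF \<gamma>(3) h]]] by simp
qed

text \<open>The velocity of a curve is a function on all germs, but by the derivation formula it suffices to
  compare its coordinates with those of a given tangent vector.\<close>

lemma velocityI:
  assumes \<gamma>: "continuous_on {0..1} \<gamma>" "t \<in> {0..1}" "\<gamma> t \<in> U" and v: "v \<in> tangent_space A (\<gamma> t)"
    and d: "((\<phi> \<circ> \<gamma>) has_vector_derivative coord_vec \<phi> v) (at t within {0..1})"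
  shows "curve_differentiable A \<gamma> t" "velocity A \<gamma> t = v"
proof -
  note hd = curve_has_derivative[OF \<gamma> _ d]
  show "curve_differentiable A \<gamma> t"
    unfolding curve_differentiable_def
    using hd unfolding has_vector_derivative_def differentiable_def by blast
  show "velocity A \<gamma> t = v"
  proof
    fix h
    show "velocity A \<gamma> t h = v h"
    proof (cases "smooth_near A (\<gamma> t) h")
      case True
      then show ?thesis
        using vector_derivative_within_cbox[OF _ _ hd[OF True, folded cbox_interval]] \<gamma>(2)
          derivation_formula[OF v \<gamma>(3) True]
        by (simp add: velocity_def)
    next
      case False
      then show ?thesis using v by (simp add: velocity_def tangent_space_def)
    qed
  qed
qed

lemma velocity_inner:
  assumes t: "t \<in> {0..1}" "\<gamma> t \<in> U" and d: "curve_differentiable A \<gamma> t"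
  shows "((\<lambda>s. \<phi> (\<gamma> s) \<bullet> w) has_vector_derivative velocity A \<gamma> t (\<lambda>q. \<phi> q \<bullet> w)) (at t within {0..1})"
proof -
  have "((\<lambda>q. \<phi> q \<bullet> w) \<circ> \<gamma>) differentiable (at t within {0..1})"
    using d smooth_near_linear[OF t(2)] unfolding curve_differentiable_def by blast
  then show ?thesis
    using smooth_near_linear[OF t(2), of w]
    by (simp add: velocity_def o_def vector_derivative_works)
qed

end

section \<open>Fibres, anchor and minimal norm\<close>

locale sr_manifold =
  fixes S :: "('a::{t2_space, second_countable_topology}, 'e::euclidean_space, 'b, 'u::euclidean_space) sr_structure"
  assumes sr: "sub_riemannian S"
begin

lemma bundle_axioms: "vector_bundle S" and metric_axioms: "euclidean_structure S" and anchor_axioms: "anchor_morphism S"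
  and atlas_axiom: "smooth_atlas (atlas S)"
  using sr by (auto simp: sub_riemannian_def)

lemma exists_chart: "q \<in> points S \<Longrightarrow> \<exists>U \<phi>. (U, \<phi>) \<in> atlas S \<and> q \<in> U"
  by (auto simp: points_def chart_union_def)

lemma exists_triv:
  assumes "q \<in> points S" shows "\<exists>W \<tau>. (W, \<tau>) \<in> trivs S \<and> q \<in> W"
proof -
  have "(\<Union>(W, \<tau>)\<in>trivs S. W) = points S" using bundle_axioms by (simp add: vector_bundle_def)
  with assms show ?thesis by blast
qed

lemma fiberD: "u \<in> fiber S q \<Longrightarrow> u \<in> total S" "u \<in> fiber S q \<Longrightarrow> proj S u = q"
  by (auto simp: fiber_def)

lemma fib_closed:
  assumes "q \<in> points S" "u \<in> fiber S q"
  shows "v \<in> fiber S q \<Longrightarrow> fib_add S u v \<in> fiber S q" "fib_scale S c u \<in> fiber S q"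
  using bundle_axioms assms by (auto simp: vector_bundle_def)

lemma anchor_props:
  assumes "q \<in> points S" "u \<in> fiber S q"
  shows "anchor S u \<in> tangent_space (atlas S) q"
    "v \<in> fiber S q \<Longrightarrow> anchor S (fib_add S u v) = anchor S u + anchor S v"
    "anchor S (fib_scale S c u) = tvec_scale c (anchor S u)"
  using anchor_axioms assms by (auto simp: anchor_morphism_def)

end

text \<open>Over a trivialisation \<open>(W, \<tau>)\<close> every fibre is identified with the Euclidean space \<open>'u\<close>; \<open>lift q\<close> is
  the inverse identification and \<open>gram\<close> the scalar product of the fibre, transported to \<open>'u\<close>.\<close>

locale sr_triv = sr_manifold S
  for S :: "('a::{t2_space, second_countable_topology}, 'e::euclidean_space, 'b, 'u::euclidean_space) sr_structure" +
  fixes W :: "'a set" and \<tau> :: "'b \<Rightarrow> 'u"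
  assumes triv: "(W, \<tau>) \<in> trivs S"
begin

abbreviation lift :: "'a \<Rightarrow> 'u \<Rightarrow> 'b" where "lift q \<equiv> inv_into (fiber S q) \<tau>"

lemma open_triv: "open W" and triv_subset: "W \<subseteq> points S"
proof -
  show "open W" using bundle_axioms triv unfolding vector_bundle_def by blast
  have "(\<Union>(W, \<tau>)\<in>trivs S. W) = points S" using bundle_axioms by (simp add: vector_bundle_def)
  with triv show "W \<subseteq> points S" by blast
qed

context
  fixes q assumes q: "q \<in> W"
begin

lemma triv_point: "q \<in> points S" using q triv_subset by blast

lemma triv_props:
  shows "bij_betw \<tau> (fiber S q) UNIV"
    "\<And>u v. u \<in> fiber S q \<Longrightarrow> v \<in> fiber S q \<Longrightarrow> \<tau> (fib_add S u v) = \<tau> u + \<tau> v"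
    "\<And>c u. u \<in> fiber S q \<Longrightarrow> \<tau> (fib_scale S c u) = c *\<^sub>R \<tau> u"
proof -
  have "\<forall>(W, \<tau>)\<in>trivs S. open W \<and>
        (\<forall>p\<in>W. bij_betw \<tau> (fiber S p) UNIV \<and>
           (\<forall>u\<in>fiber S p. \<forall>v\<in>fiber S p. \<tau> (fib_add S u v) = \<tau> u + \<tau> v) \<and>
           (\<forall>c. \<forall>u\<in>fiber S p. \<tau> (fib_scale S c u) = c *\<^sub>R \<tau> u))"
    using bundle_axioms by (simp add: vector_bundle_def)
  from bspec[OF this triv] show "bij_betw \<tau> (fiber S q) UNIV"
    "\<And>u v. u \<in> fiber S q \<Longrightarrow> v \<in> fiber S q \<Longrightarrow> \<tau> (fib_add S u v) = \<tau> u + \<tau> v"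
    "\<And>c u. u \<in> fiber S q \<Longrightarrow> \<tau> (fib_scale S c u) = c *\<^sub>R \<tau> u"
    using q by auto
qed

lemma lift_in: "lift q \<xi> \<in> fiber S q"
  using triv_props(1) by (auto simp: bij_betw_def intro: inv_into_into)

lemma tau_lift: "\<tau> (lift q \<xi>) = \<xi>"
  using triv_props(1) by (auto simp: bij_betw_def intro: f_inv_into_f)

lemma lift_tau: "u \<in> fiber S q \<Longrightarrow> lift q (\<tau> u) = u"
  using triv_props(1) by (auto simp: bij_betw_def)

lemma lift_add: "lift q (\<xi> + \<eta>) = fib_add S (lift q \<xi>) (lift q \<eta>)"
  using lift_tau[OF fib_closed(1)[OF triv_point lift_in lift_in]] triv_props(2)[OF lift_in lift_in]
  by (simp add: tau_lift)

lemma lift_scale: "lift q (c *\<^sub>R \<xi>) = fib_scale S c (lift q \<xi>)"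
  using lift_tau[OF fib_closed(2)[OF triv_point lift_in]] triv_props(3)[OF lift_in]
  by (simp add: tau_lift)

definition gram :: "'u \<Rightarrow> 'u \<Rightarrow> real" where
  "gram \<xi> \<eta> = fib_inner S (lift q \<xi>) (lift q \<eta>)"

lemma inner_fiber:
  assumes "u \<in> fiber S q" "v \<in> fiber S q"
  shows "fib_inner S u v = fib_inner S v u"
    "w \<in> fiber S q \<Longrightarrow> fib_inner S (fib_add S u v) w = fib_inner S u w + fib_inner S v w"
    "fib_inner S (fib_scale S c u) v = c * fib_inner S u v"
    "0 \<le> fib_inner S u u" "fib_inner S u u = 0 \<Longrightarrow> u = fib_scale S 0 u"
  using metric_axioms assms triv_point unfolding euclidean_structure_def by blast+

lemma gram_sym: "gram \<xi> \<eta> = gram \<eta> \<xi>"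
  unfolding gram_def by (intro inner_fiber lift_in)

lemma gram_bilinear: "bilinear gram"
proof -
  have "linear (\<lambda>\<xi>. gram \<xi> \<eta>)" for \<eta>
    by (rule linearI) (simp_all add: gram_def lift_add lift_scale inner_fiber lift_in)
  moreover from this have "linear (\<lambda>\<eta>. gram \<xi> \<eta>)" for \<xi>
    by (subst gram_sym)
  ultimately show ?thesis by (simp add: bilinear_def)
qed

lemma gram_nonneg: "0 \<le> gram \<xi> \<xi>"
  unfolding gram_def by (rule inner_fiber(4)[OF lift_in lift_in])

lemma gram_pos: "\<xi> \<noteq> 0 \<Longrightarrow> 0 < gram \<xi> \<xi>"
proof (rule ccontr)
  assume "\<xi> \<noteq> 0" "\<not> 0 < gram \<xi> \<xi>"
  then have "lift q \<xi> = fib_scale S 0 (lift q \<xi>)"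
    using gram_nonneg[of \<xi>] inner_fiber(5)[OF lift_in lift_in, of \<xi>] by (simp add: gram_def)
  then have "\<tau> (lift q \<xi>) = 0 *\<^sub>R \<tau> (lift q \<xi>)"
    using triv_props(3)[OF lift_in, of 0 \<xi>] by metis
  with \<open>\<xi> \<noteq> 0\<close> show False by (simp add: tau_lift)
qed

lemma continuous_gram: "continuous_on T (\<lambda>\<xi>. gram \<xi> \<xi>)"
  using bounded_bilinear.continuous_on[OF gram_bilinear[unfolded bilinear_conv_bounded_bilinear]]
    continuous_on_id by blast

text \<open>The minimum of the quadratic form on the compact unit sphere is positive, and the form is
  homogeneous.\<close>

lemma gram_coercive: "\<exists>c>0. \<forall>\<xi>. c * (norm \<xi>)\<^sup>2 \<le> gram \<xi> \<xi>"
proof -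
  obtain b :: 'u where b: "b \<in> Basis" using nonempty_Basis by blast
  have ne: "sphere 0 1 \<noteq> ({} :: 'u set)" using b by (auto intro!: exI[of _ b] simp: dist_norm)
  obtain \<xi>0 where \<xi>0: "\<xi>0 \<in> sphere 0 1" "\<And>\<xi>. \<xi> \<in> sphere 0 1 \<Longrightarrow> gram \<xi>0 \<xi>0 \<le> gram \<xi> \<xi>"
    using continuous_attains_inf[OF compact_sphere ne continuous_gram] by blast
  have "gram \<xi>0 \<xi>0 * (norm \<xi>)\<^sup>2 \<le> gram \<xi> \<xi>" for \<xi>
  proof (cases "\<xi> = 0")
    case False
    let ?e = "(1 / norm \<xi>) *\<^sub>R \<xi>"
    have "gram \<xi>0 \<xi>0 \<le> gram ?e ?e" using False by (intro \<xi>0) simp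
    also have "\<dots> = gram \<xi> \<xi> / (norm \<xi>)\<^sup>2"
      using bilinear_lmul[OF gram_bilinear] bilinear_rmul[OF gram_bilinear]
      by (simp add: power2_eq_square)
    finally show ?thesis using False by (simp add: field_simps)
  qed (simp add: gram_nonneg)
  moreover have "gram \<xi>0 \<xi>0 > 0" using \<xi>0(1) by (intro gram_pos) auto
  ultimately show ?thesis by blast
qed

lemma linear_anchor_lift: "linear (\<lambda>\<xi>. anchor S (lift q \<xi>) h)"
  by (rule linearI)
    (simp_all add: lift_add lift_scale anchor_props[OF triv_point lift_in] lift_in tvec_scale_def)

text \<open>The constant \<^const>\<open>sr_norm_sq\<close> is defined by \<open>LEAST\<close> over the reals, which is meaningful only if
  the minimum is attained. The vectors with a given anchor form a closed set because the anchor is linear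
  on the fibre, and by coercivity the minimisation takes place in a ball, which is compact.\<close>

lemma min_norm_lift:
  assumes "u \<in> fiber S q"
  obtains u' where "u' \<in> fiber S q" "anchor S u' = anchor S u"
    "sr_norm_sq S q (anchor S u) = fib_inner S u' u'" "fib_inner S u' u' \<le> fib_inner S u u"
proof -
  define C where "C = {\<xi>. anchor S (lift q \<xi>) = anchor S u}"
  define r where "r = gram (\<tau> u) (\<tau> u)"
  obtain c where c: "c > 0" "\<And>\<xi>. c * (norm \<xi>)\<^sup>2 \<le> gram \<xi> \<xi>" using gram_coercive by blast
  have clC: "closed C"
  proof -
    have "C = (\<Inter>h. {\<xi>. anchor S (lift q \<xi>) h = anchor S u h})"
      by (auto simp: C_def fun_eq_iff)
    moreover have "closed {\<xi>. anchor S (lift q \<xi>) h = anchor S u h}" for h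
      by (intro closed_Collect_eq linear_continuous_on continuous_on_const
          linear_conv_bounded_linear[THEN iffD1] linear_anchor_lift)
    ultimately show ?thesis by auto
  qed
  let ?K = "C \<inter> cball 0 (sqrt (r / c))"
  have inK: "\<xi> \<in> ?K" if "\<xi> \<in> C" "gram \<xi> \<xi> \<le> r" for \<xi>
  proof -
    have "(norm \<xi>)\<^sup>2 \<le> r / c" using c(1) order_trans[OF c(2) that(2)] by (simp add: field_simps)
    then show ?thesis using that(1) by (simp add: real_le_rsqrt)
  qed
  have uC: "\<tau> u \<in> C" using assms by (simp add: C_def lift_tau)
  have ne: "?K \<noteq> {}" using inK[OF uC] by (auto simp: r_def)
  have cpt: "compact ?K" using clC by (intro closed_Int_compact) auto
  from continuous_attains_inf[OF cpt ne continuous_gram]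
  obtain \<xi>0 where \<xi>0: "\<xi>0 \<in> ?K" "\<And>\<xi>. \<xi> \<in> ?K \<Longrightarrow> gram \<xi>0 \<xi>0 \<le> gram \<xi> \<xi>"
    by blast
  have min: "gram \<xi>0 \<xi>0 \<le> gram \<xi> \<xi>" if "\<xi> \<in> C" for \<xi>
  proof (cases "gram \<xi> \<xi> \<le> r")
    case False
    have "gram \<xi>0 \<xi>0 \<le> r" using \<xi>0(2)[OF inK[OF uC]] by (simp add: r_def)
    with False show ?thesis by simp
  qed (use \<xi>0(2) inK that in blast)
  let ?u = "lift q \<xi>0"
  have anchor_axioms: "anchor S ?u = anchor S u" using \<xi>0(1) by (simp add: C_def)
  have le: "fib_inner S ?u ?u \<le> fib_inner S v v" if "v \<in> fiber S q" "anchor S v = anchor S u" for v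
    using min[of "\<tau> v"] that by (simp add: C_def gram_def lift_tau)
  have "sr_norm_sq S q (anchor S u) = fib_inner S ?u ?u"
    unfolding sr_norm_sq_def
    by (rule Least_equality) (use anchor_axioms le lift_in in blast)+
  with that[OF lift_in anchor_axioms] le[OF assms refl] show thesis by blast
qed

end

end

section \<open>The bundle over a chart and extension of sections\<close>

locale sr_chart = sr_triv S W \<tau> + chart: atlas_chart "atlas S" U \<phi>
  for S :: "('a::{t2_space, second_countable_topology}, 'e::euclidean_space, 'b, 'u::euclidean_space) sr_structure"
    and W \<tau> U \<phi>
begin

definition bundle_dom :: "'b set" where "bundle_dom = total S \<inter> proj S -` (U \<inter> W)"
abbreviation bundle_map :: "'b \<Rightarrow> 'e \<times> 'u" where "bundle_map \<equiv> \<lambda>u. (\<phi> (proj S u), \<tau> u)"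
abbreviation chart_image :: "'e set" where "chart_image \<equiv> \<phi> ` (U \<inter> W)"

lemma bundle_map_mem: "(bundle_dom, bundle_map) \<in> bundle_charts S"
  unfolding bundle_charts_def bundle_dom_def using chart.chart triv by force

lemma open_chart_overlap: "open chart_image"
  by (rule chart.open_chart_image[OF open_triv])

lemma bundle_dom_fiber: "u \<in> bundle_dom \<Longrightarrow> u \<in> fiber S (proj S u)"
  by (simp add: fiber_def bundle_dom_def)

lemma bundle_map_inj: "inj_on bundle_map bundle_dom"
proof (rule inj_onI)
  fix u v assume uv: "u \<in> bundle_dom" "v \<in> bundle_dom" "bundle_map u = bundle_map v"
  have d: "proj S u \<in> U" "proj S v \<in> U" "proj S u \<in> W" using uv(1,2) by (auto simp: bundle_dom_def)
  have eq: "proj S u = proj S v"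
    using uv(3) inj_onD[OF chart.chart_props(2) _ d(1,2)] by simp
  have L: "lift (proj S u) (\<tau> u) = u" "lift (proj S u) (\<tau> v) = v"
    using bundle_dom_fiber[OF uv(1)] bundle_dom_fiber[OF uv(2)] unfolding eq[symmetric]
    by (simp_all add: lift_tau d(3))
  have t: "\<tau> u = \<tau> v" using uv(3) by simp
  show "u = v" using L unfolding t by (rule trans[OF sym])
qed

lemma bundle_map_inv:
  assumes "x \<in> chart_image" shows "inv_into bundle_dom bundle_map (x, \<xi>) = lift (chart.\<psi> x) \<xi>"
proof -
  obtain q where q: "q \<in> U" "q \<in> W" "x = \<phi> q" using assms by blast
  have "lift q \<xi> \<in> bundle_dom" "bundle_map (lift q \<xi>) = (x, \<xi>)"
    using fiberD[OF lift_in[OF q(2)], of \<xi>] q tau_lift[OF q(2)] by (auto simp: bundle_dom_def)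
  then show ?thesis using inv_into_f_f[OF bundle_map_inj, of "lift q \<xi>"] q by simp
qed

lemma bundle_map_image:
  assumes R: "R \<subseteq> U \<inter> W"
  shows "bundle_map ` (total S \<inter> proj S -` R) = \<phi> ` R \<times> UNIV" (is "?L = ?R")
proof
  show "?L \<subseteq> ?R" by blast
  show "?R \<subseteq> ?L"
  proof (rule subrelI)
    fix x \<xi> assume "(x, \<xi>) \<in> \<phi> ` R \<times> (UNIV :: 'u set)"
    then obtain q where q: "q \<in> R" "x = \<phi> q" by (elim SigmaE2 imageE)
    then have qW: "q \<in> W" using R by blast
    have "proj S (lift q \<xi>) = q" "lift q \<xi> \<in> total S"
      using fiberD[OF lift_in[OF qW]] by blast+
    then have "lift q \<xi> \<in> total S \<inter> proj S -` R" "bundle_map (lift q \<xi>) = (x, \<xi>)"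
      using q tau_lift[OF qW] by simp_all
    then show "(x, \<xi>) \<in> ?L" by (intro image_eqI[of _ bundle_map "lift q \<xi>"] sym[of "bundle_map (lift q \<xi>)"])
  qed
qed

text \<open>The anchor map in coordinates, through which its smoothness and all length estimates are
  expressed.\<close>

definition anchor_coords :: "'e \<Rightarrow> 'u \<Rightarrow> 'e" where
  "anchor_coords x \<xi> = coord_vec \<phi> (anchor S (lift (chart.\<psi> x) \<xi>))"

lemma linear_anchor_coords:
  assumes "x \<in> chart_image" shows "linear (anchor_coords x)"
proof (rule linearI)
  have q: "chart.\<psi> x \<in> W" using assms by auto
  show "anchor_coords x (\<xi> + \<eta>) = anchor_coords x \<xi> + anchor_coords x \<eta>" for \<xi> \<eta>
    unfolding anchor_coords_def lift_add[OF q] anchor_props(2)[OF triv_point[OF q] lift_in[OF q] lift_in[OF q]]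
    by (simp add: coord_vec_def scaleR_left_distrib sum.distrib)
  show "anchor_coords x (c *\<^sub>R \<xi>) = c *\<^sub>R anchor_coords x \<xi>" for c \<xi>
    unfolding anchor_coords_def lift_scale[OF q] anchor_props(3)[OF triv_point[OF q] lift_in[OF q]]
    by (simp add: coord_vec_def tvec_scale_def scaleR_sum_right)
qed

lemma anchor_coords_smooth: "smooth_on (chart_image \<times> UNIV) (\<lambda>z. anchor_coords (fst z) (snd z))"
proof -
  let ?F = "\<lambda>u. (proj S u, anchor S u)"
  let ?T = "Sigma U (tangent_space (atlas S))"
  let ?c = "\<lambda>(p, v). (\<phi> p, \<Sum>b\<in>Basis. v (\<lambda>q. \<phi> q \<bullet> b) *\<^sub>R b)"
  have "(?T, ?c) \<in> tangent_charts (atlas S)"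
    unfolding tangent_charts_def using chart.chart by force
  moreover have "smooth_map (bundle_charts S) (tangent_charts (atlas S)) ?F"
    using anchor_axioms by (simp add: anchor_morphism_def)
  ultimately have sm: "smooth_on (bundle_map ` (bundle_dom \<inter> ?F -` ?T)) (?c \<circ> ?F \<circ> inv_into bundle_dom bundle_map)"
    unfolding smooth_map_def using bundle_map_mem by blast
  have "bundle_dom \<inter> ?F -` ?T = bundle_dom"
    using anchor_props(1)[OF subsetD[OF triv_subset] bundle_dom_fiber] by (auto simp: bundle_dom_def)
  with sm have "smooth_on (chart_image \<times> UNIV) (?c \<circ> ?F \<circ> inv_into bundle_dom bundle_map)"
    using bundle_map_image[OF order_refl, folded bundle_dom_def] by simp
  then have "smooth_on (chart_image \<times> UNIV) (\<lambda>z. snd ((?c \<circ> ?F \<circ> inv_into bundle_dom bundle_map) z))"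
    by (rule smooth_on_bounded_linear_comp[OF bounded_linear_snd open_Times[OF open_chart_overlap open_UNIV]])
  then show ?thesis
    by (rule smooth_on_cong[OF _ open_Times[OF open_chart_overlap open_UNIV]])
      (auto simp: anchor_coords_def coord_vec_def bundle_map_inv)
qed

lemma gram_smooth: "smooth_on chart_image (\<lambda>x. gram (chart.\<psi> x) \<xi> \<eta>)"
proof -
  from bspec[OF conjunct2[OF metric_axioms[unfolded euclidean_structure_def]] triv]
  have "smooth_fun_on (atlas S) W (\<lambda>p. fib_inner S (lift p \<xi>) (lift p \<eta>))"
    by simp
  from bspec[OF this[unfolded smooth_fun_on_def] chart.chart]
  have "smooth_on chart_image ((\<lambda>p. fib_inner S (lift p \<xi>) (lift p \<eta>)) \<circ> chart.\<psi>)"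
    by simp
  then show ?thesis
    by (rule smooth_on_cong[OF _ open_chart_overlap]) (auto simp: gram_def)
qed

lemma gram_continuous: "continuous_on (chart_image \<times> UNIV) (\<lambda>z. gram (chart.\<psi> (fst z)) (snd z) (snd z))"
proof -
  have "continuous_on (chart_image \<times> UNIV)
      (\<lambda>z. \<Sum>i\<in>Basis. \<Sum>j\<in>Basis. (snd z \<bullet> i) * (snd z \<bullet> j) * gram (chart.\<psi> (fst z)) i j)"
    by (intro continuous_intros continuous_on_compose2[OF smooth_on_continuous[OF gram_smooth]]) auto
  then show ?thesis
  proof (rule continuous_on_eq)
    fix z :: "'e \<times> 'u" assume "z \<in> chart_image \<times> UNIV"
    then have q: "chart.\<psi> (fst z) \<in> W" by auto
    let ?g = "gram (chart.\<psi> (fst z))" and ?\<xi> = "snd z"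
    have "?g ?\<xi> ?\<xi> = (\<Sum>i\<in>Basis. (?\<xi> \<bullet> i) *\<^sub>R ?g i ?\<xi>)"
      using linear_eq_sum_Basis[of "\<lambda>\<xi>. ?g \<xi> ?\<xi>" ?\<xi>] gram_bilinear[OF q] by (simp add: bilinear_def)
    also have "\<dots> = (\<Sum>i\<in>Basis. (?\<xi> \<bullet> i) *\<^sub>R (\<Sum>j\<in>Basis. (?\<xi> \<bullet> j) *\<^sub>R ?g i j))"
      using linear_eq_sum_Basis[of "?g i" ?\<xi> for i] gram_bilinear[OF q] by (simp add: bilinear_def)
    finally show "(\<Sum>i\<in>Basis. \<Sum>j\<in>Basis. (?\<xi> \<bullet> i) * (?\<xi> \<bullet> j) * ?g i j) = ?g ?\<xi> ?\<xi>"
      by (simp add: sum_distrib_left mult.assoc)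
  qed
qed

lemma triv_transition_smooth:
  assumes "sr_chart S W2 \<tau>2 V2 \<theta>2"
  shows "smooth_on (\<phi> ` (U \<inter> W \<inter> (V2 \<inter> W2))) (\<lambda>x. \<tau>2 (lift (chart.\<psi> x) \<xi>))"
proof -
  interpret two: sr_chart S W2 \<tau>2 V2 \<theta>2 by fact
  let ?R = "U \<inter> W \<inter> (V2 \<inter> W2)"
  have opn: "open (\<phi> ` ?R)"
    using chart.open_chart_image[OF open_Int[OF open_triv open_Int[OF two.chart.chart_props(1) two.open_triv]]]
    by (simp only: Int_assoc)
  have "smoothly_compatible (bundle_charts S)" using bundle_axioms by (simp add: vector_bundle_def)
  from bspec[OF this[unfolded smoothly_compatible_def] bundle_map_mem]
  have "\<forall>(V, \<psi>)\<in>bundle_charts S. smooth_on (bundle_map ` (bundle_dom \<inter> V)) (\<psi> \<circ> inv_into bundle_dom bundle_map)"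
    by (simp only: prod.case)
  from bspec[OF this two.bundle_map_mem]
  have "smooth_on (bundle_map ` (bundle_dom \<inter> two.bundle_dom)) (two.bundle_map \<circ> inv_into bundle_dom bundle_map)"
    by (simp only: prod.case)
  moreover have "bundle_dom \<inter> two.bundle_dom = total S \<inter> proj S -` ?R" by (auto simp: bundle_dom_def two.bundle_dom_def)
  ultimately have "smooth_on (\<phi> ` ?R \<times> UNIV) (two.bundle_map \<circ> inv_into bundle_dom bundle_map)"
    using bundle_map_image[of ?R] by (simp only: Int_lower1)
  then have "smooth_on (\<phi> ` ?R \<times> UNIV) (\<lambda>z. snd ((two.bundle_map \<circ> inv_into bundle_dom bundle_map) z))"
    by (rule smooth_on_bounded_linear_comp[OF bounded_linear_snd open_Times[OF opn open_UNIV]])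
  then have "smooth_on (\<phi> ` ?R) (\<lambda>x. snd ((two.bundle_map \<circ> inv_into bundle_dom bundle_map) (x, \<xi>)))"
    by (rule smooth_on_compose[where g = "\<lambda>x. (x, \<xi>)"])
      (auto intro: smooth_on_Pair opn open_Times)
  then show ?thesis
    by (rule smooth_on_cong[OF _ opn]) (auto simp: bundle_map_inv)
qed

text \<open>Horizontal fields come from global sections, so vectors of a fibre have to be extended to the
  whole manifold: the constant section in the trivialisation is multiplied by a bump function in the chart.
  The preimage of the closed ball is compact, hence closed in the Hausdorff space \<open>'a\<close>; its
  complement and the overlap of chart and trivialisation cover the manifold, and smoothness is clear on
  each of them.\<close>

lemma section_extension:
  assumes \<rho>: "cball x0 \<rho> \<subseteq> chart_image" and \<beta>: "smooth_on UNIV \<beta>" "\<And>x. x \<notin> ball x0 \<rho> \<Longrightarrow> \<beta> x = (0::real)"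
  obtains \<sigma> where "\<sigma> \<in> smooth_sections S" "\<And>q. q \<in> U \<inter> W \<Longrightarrow> \<sigma> q = lift q (\<beta> (\<phi> q) *\<^sub>R \<xi>)"
proof -
  define b where "b q = (if q \<in> U \<inter> W then \<beta> (\<phi> q) else 0)" for q
  \<comment> \<open>outside the trivialisation any vector will do, because it is multiplied by 0\<close>
  define e where "e q = (if q \<in> U \<inter> W then lift q \<xi> else (SOME u. u \<in> fiber S q))" for q
  define \<sigma> where "\<sigma> q = fib_scale S (b q) (e q)" for q
  have e: "e q \<in> fiber S q" if q: "q \<in> points S" for q
  proof (cases "q \<in> U \<inter> W")
    case True
    then show ?thesis unfolding e_def if_P[OF True] by (intro lift_in) blast
  next
    case False
    obtain W' \<tau>' where "(W', \<tau>') \<in> trivs S" "q \<in> W'" using exists_triv[OF q] by blast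
    then interpret t: sr_triv S W' \<tau>' by unfold_locales
    have "\<exists>u. u \<in> fiber S q" using t.lift_in[OF \<open>q \<in> W'\<close>] by blast
    from someI_ex[OF this] show ?thesis unfolding e_def if_not_P[OF False] .
  qed
  have \<sigma>: "\<sigma> q \<in> fiber S q" if "q \<in> points S" for q
    unfolding \<sigma>_def by (intro fib_closed e that)
  define K where "K = chart.\<psi> ` cball x0 \<rho>"
  have "cball x0 \<rho> \<subseteq> \<phi> ` U" using \<rho> by blast
  then have "compact K"
    unfolding K_def by (intro compact_continuous_image continuous_on_subset[OF chart.chart_props(5)]) auto
  then have openK: "open (- K)" using compact_imp_closed by blast
  have KUW: "K \<subseteq> U \<inter> W" using \<rho> by (auto simp: K_def)
  have b0: "b q = 0" if "q \<notin> K" for q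
  proof (cases "q \<in> U \<inter> W")
    case True
    have "\<phi> q \<notin> ball x0 \<rho>"
    proof
      assume "\<phi> q \<in> ball x0 \<rho>"
      then have "chart.\<psi> (\<phi> q) \<in> K" unfolding K_def by (intro imageI) auto
      with True that show False by simp
    qed
    then show ?thesis using \<beta>(2) by (simp add: b_def)
  next
    case False
    then show ?thesis unfolding b_def by (rule if_not_P)
  qed
  have "smooth_map (atlas S) (bundle_charts S) \<sigma>"
    unfolding smooth_map_def
  proof (intro conjI ballI)
    show "\<sigma> ` chart_union (atlas S) \<subseteq> chart_union (bundle_charts S)"
    proof
      fix u assume "u \<in> \<sigma> ` chart_union (atlas S)"
      then obtain q where q: "q \<in> points S" "u = \<sigma> q" by (auto simp: points_def)
      obtain V \<theta> where V: "(V, \<theta>) \<in> atlas S" "q \<in> V" using exists_chart[OF q(1)] by blast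
      obtain W' \<tau>' where W': "(W', \<tau>') \<in> trivs S" "q \<in> W'" using exists_triv[OF q(1)] by blast
      interpret c: sr_chart S W' \<tau>' V \<theta> by unfold_locales (use V W' atlas_axiom in auto)
      have "u \<in> c.bundle_dom" using fiberD[OF \<sigma>[OF q(1)]] q V W' by (auto simp: c.bundle_dom_def)
      then show "u \<in> chart_union (bundle_charts S)"
        unfolding chart_union_def using c.bundle_map_mem by blast
    qed
  next
    fix z1 assume z1: "z1 \<in> atlas S"
    obtain V \<theta> where V: "z1 = (V, \<theta>)" by (cases z1)
    show "case z1 of (U, \<phi>) \<Rightarrow> \<forall>(V, \<psi>)\<in>bundle_charts S.
        open (\<phi> ` (U \<inter> \<sigma> -` V)) \<and> smooth_on (\<phi> ` (U \<inter> \<sigma> -` V)) (\<psi> \<circ> \<sigma> \<circ> inv_into U \<phi>)"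
      unfolding V prod.case
    proof (rule ballI)
      fix z2 assume z2: "z2 \<in> bundle_charts S"
      obtain y where y: "y \<in> atlas S \<times> trivs S"
        "z2 = (\<lambda>((U, \<phi>), (W, \<tau>)). (total S \<inter> proj S -` (U \<inter> W), \<lambda>u. (\<phi> (proj S u), \<tau> u))) y"
        using z2 unfolding bundle_charts_def by (elim imageE)
      obtain V2 \<theta>2 W2 \<tau>2 where y2: "y = ((V2, \<theta>2), (W2, \<tau>2))" by (metis surj_pair)
      have 2: "(V2, \<theta>2) \<in> atlas S" "(W2, \<tau>2) \<in> trivs S"
        "z2 = (total S \<inter> proj S -` (V2 \<inter> W2), \<lambda>u. (\<theta>2 (proj S u), \<tau>2 u))"
        using y unfolding y2 by (simp_all only: prod.case mem_Sigma_iff)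
      interpret one: atlas_chart "atlas S" V \<theta> by unfold_locales (use z1 V atlas_axiom in auto)
      interpret two: sr_chart S W2 \<tau>2 V2 \<theta>2 by unfold_locales (fact 2(2), fact atlas_axiom, fact 2(1))
      have VP: "V \<subseteq> points S" using one.chart_props(6) by (simp add: points_def)
      let ?X = "V \<inter> (V2 \<inter> W2)"
      have X: "V \<inter> \<sigma> -` two.bundle_dom = ?X"
      proof (rule set_eqI)
        fix q
        show "q \<in> V \<inter> \<sigma> -` two.bundle_dom \<longleftrightarrow> q \<in> ?X"
        proof (cases "q \<in> V")
          case True
          from fiberD[OF \<sigma>[OF subsetD[OF VP True]]] show ?thesis
            by (simp add: two.bundle_dom_def)
        qed simp
      qed
      have opn: "open (\<theta> ` (V \<inter> (V2 \<inter> W2 \<inter> R)))" if "open R" for R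
        by (intro one.open_chart_image open_Int two.chart.chart_props(1) two.open_triv that)
      have opnX: "open (\<theta> ` ?X)" using opn[of UNIV] by simp
      have first: "smooth_on (\<theta> ` ?X) (\<theta>2 \<circ> one.\<psi>)"
        by (rule smooth_on_subset[OF two.chart.transition_smooth[OF one.chart]]) auto
      have \<tau>2\<sigma>: "\<tau>2 (\<sigma> q) = b q *\<^sub>R \<tau>2 (e q)" if "q \<in> W2" for q
        unfolding \<sigma>_def using two.triv_props(3)[OF that e] that two.triv_subset by blast
      have second: "smooth_on (\<theta> ` ?X) (\<lambda>x. \<tau>2 (\<sigma> (one.\<psi> x)))"
      proof (rule smooth_on_locally)
        fix x assume x: "x \<in> \<theta> ` ?X"
        show "\<exists>T. open T \<and> x \<in> T \<and> smooth_on T (\<lambda>x. \<tau>2 (\<sigma> (one.\<psi> x)))"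
        proof (cases "one.\<psi> x \<in> U \<inter> W")
          case True
          let ?T = "\<theta> ` (V \<inter> (V2 \<inter> W2 \<inter> (U \<inter> W)))"
          have T: "open ?T" "x \<in> ?T"
            using opn[OF open_Int[OF chart.chart_props(1) open_triv]] x True by auto
          have tr: "smooth_on ?T (\<phi> \<circ> one.\<psi>)"
            by (rule smooth_on_subset[OF chart.transition_smooth[OF one.chart]]) blast
          have "smooth_on ?T (\<lambda>x. \<beta> ((\<phi> \<circ> one.\<psi>) x))"
            by (rule smooth_on_compose[OF \<beta>(1) tr T(1)]) auto
          moreover have "smooth_on ?T (\<lambda>x. \<tau>2 (lift (chart.\<psi> ((\<phi> \<circ> one.\<psi>) x)) \<xi>))"
            by (rule smooth_on_compose[OF triv_transition_smooth[OF two.sr_chart_axioms] tr T(1)])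
              (use chart.open_chart_image[of "W \<inter> (V2 \<inter> W2)"] open_triv two.open_triv
                two.chart.chart_props(1) in \<open>auto simp: Int_assoc open_Int\<close>)
          ultimately have "smooth_on ?T (\<lambda>x. \<beta> ((\<phi> \<circ> one.\<psi>) x) *\<^sub>R \<tau>2 (lift (chart.\<psi> ((\<phi> \<circ> one.\<psi>) x)) \<xi>))"
            by (rule smooth_on_scaleR[OF T(1)])
          then have "smooth_on ?T (\<lambda>x. \<tau>2 (\<sigma> (one.\<psi> x)))"
            by (rule smooth_on_cong[OF _ T(1)]) (auto simp: \<tau>2\<sigma> b_def e_def)
          with T show ?thesis by blast
        next
          case False
          let ?T = "\<theta> ` (V \<inter> (V2 \<inter> W2 \<inter> - K))"
          have T: "open ?T" "x \<in> ?T"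
            using opn[OF openK] x False KUW by auto
          have "smooth_on ?T (\<lambda>x. \<tau>2 (\<sigma> (one.\<psi> x)))"
            by (rule smooth_on_cong[OF smooth_on_const[of _ 0] T(1)]) (auto simp: \<tau>2\<sigma> b0)
          with T show ?thesis by blast
        qed
      qed
      have "smooth_on (\<theta> ` ?X) (\<lambda>x. ((\<theta>2 \<circ> one.\<psi>) x, \<tau>2 (\<sigma> (one.\<psi> x))))"
        by (rule smooth_on_Pair[OF opnX first second])
      then have "smooth_on (\<theta> ` ?X) (two.bundle_map \<circ> \<sigma> \<circ> one.\<psi>)"
        by (rule smooth_on_cong[OF _ opnX]) (use fiberD(2)[OF \<sigma>] VP in auto)
      then show "case z2 of (V', \<psi>) \<Rightarrow>
          open (\<theta> ` (V \<inter> \<sigma> -` V')) \<and> smooth_on (\<theta> ` (V \<inter> \<sigma> -` V')) (\<psi> \<circ> \<sigma> \<circ> inv_into V \<theta>)"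
        unfolding 2(3) two.bundle_dom_def[symmetric] prod.case X using opnX by blast
    qed
  qed
  with \<sigma> have "\<sigma> \<in> smooth_sections S" by (simp add: smooth_sections_def)
  moreover have "\<sigma> q = lift q (\<beta> (\<phi> q) *\<^sub>R \<xi>)" if "q \<in> U \<inter> W" for q
    using that by (simp add: \<sigma>_def b_def e_def lift_scale)
  ultimately show thesis by (rule that)
qed

end

context sr_manifold
begin

lemma chart_at:
  assumes "q \<in> points S"
  obtains W \<tau> U \<phi> where "sr_chart S W \<tau> U \<phi>" "q \<in> U \<inter> W"
proof -
  obtain U \<phi> where U: "(U, \<phi>) \<in> atlas S" "q \<in> U" using exists_chart[OF assms] by blast
  obtain W \<tau> where W: "(W, \<tau>) \<in> trivs S" "q \<in> W" using exists_triv[OF assms] by blast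
  have "sr_chart S W \<tau> U \<phi>" by unfold_locales (use U W atlas_axiom in auto)
  with U W show thesis by (intro that[of W \<tau> U \<phi>]) auto
qed

text \<open>Every vector of a fibre is the value of a global section, by the extension lemma with a bump
  function that equals \<open>1\<close> at the point.\<close>

lemma field_values_horizontal:
  assumes q: "q \<in> points S"
  shows "field_values (horizontal_fields S) q = anchor S ` fiber S q"
proof (intro equalityI subsetI)
  fix v assume "v \<in> field_values (horizontal_fields S) q"
  then show "v \<in> anchor S ` fiber S q"
    using q by (auto simp: field_values_def horizontal_fields_def smooth_sections_def)
next
  fix v assume "v \<in> anchor S ` fiber S q"
  then obtain u where u: "u \<in> fiber S q" "v = anchor S u" by blast
  obtain W \<tau> U \<phi> where c: "sr_chart S W \<tau> U \<phi>" and qUW: "q \<in> U \<inter> W" using chart_at[OF q] .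
  interpret c: sr_chart S W \<tau> U \<phi> by fact
  obtain \<rho> where \<rho>: "\<rho> > 0" "cball (\<phi> q) \<rho> \<subseteq> c.chart_image"
    using open_contains_cball[of c.chart_image] c.open_chart_overlap qUW by blast
  obtain \<beta> :: "'e \<Rightarrow> real" where \<beta>: "smooth_on UNIV \<beta>" "\<beta> (\<phi> q) = 1" "\<And>x. x \<notin> ball (\<phi> q) \<rho> \<Longrightarrow> \<beta> x = 0"
    using smooth_bump[OF \<rho>(1), of "\<phi> q"] by metis
  obtain \<sigma> where \<sigma>: "\<sigma> \<in> smooth_sections S" "\<And>p. p \<in> U \<inter> W \<Longrightarrow> \<sigma> p = c.lift p (\<beta> (\<phi> p) *\<^sub>R \<tau> u)"
    using c.section_extension[OF \<rho>(2) \<beta>(1,3)] by blast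
  have "\<sigma> q = u" using \<sigma>(2)[OF qUW] \<beta>(2) c.lift_tau[OF _ u(1)] qUW by simp
  then show "v \<in> field_values (horizontal_fields S) q"
    unfolding field_values_def horizontal_fields_def using \<sigma>(1) u(2)
    by (auto intro!: exI[of _ "anchor S \<circ> \<sigma>"])
qed

lemma min_norm:
  assumes "q \<in> points S" "u \<in> fiber S q"
  obtains u' where "u' \<in> fiber S q" "anchor S u' = anchor S u"
    "sr_norm_sq S q (anchor S u) = fib_inner S u' u'" "fib_inner S u' u' \<le> fib_inner S u u"
proof -
  obtain W \<tau> where "(W, \<tau>) \<in> trivs S" "q \<in> W" using exists_triv[OF assms(1)] by blast
  then interpret t: sr_triv S W \<tau> by unfold_locales
  show thesis using t.min_norm_lift[OF \<open>q \<in> W\<close> assms(2)] that by blast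
qed

text \<open>If all horizontal fields vanished at \<open>q\<close>, then so would all sums, multiples and brackets of
  fields vanishing at \<open>q\<close>, that is the whole Lie algebra. This contradicts Chow's condition at \<open>q\<close>.\<close>

lemma anchor_nonzero:
  assumes q: "q \<in> points S"
  shows "\<exists>u\<in>fiber S q. anchor S u \<noteq> (\<lambda>h. 0)"
proof (rule ccontr)
  assume "\<not> ?thesis"
  then have z: "anchor S u = (\<lambda>h. 0)" if "u \<in> fiber S q" for u using that by blast
  have X0: "X q = (\<lambda>h. 0)" if "X \<in> lie_algebra S" for X
    using that
  proof induction
    case (1 X)
    then show ?case using z q by (auto simp: horizontal_fields_def smooth_sections_def)
  qed (auto simp: vfield_scale_def tvec_scale_def lie_bracket_def fun_eq_iff)
  have TX: "tangent_space (atlas S) q = {X q |X. X \<in> lie_algebra S}"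
    using sr q by (simp add: sub_riemannian_def field_values_def)
  have T0: "tangent_space (atlas S) q \<subseteq> {\<lambda>h. 0}"
    unfolding TX by (rule subsetI) (elim CollectE exE conjE, simp only: X0 singletonI)
  obtain U \<phi> where U: "(U, \<phi>) \<in> atlas S" "q \<in> U" using exists_chart[OF q] by blast
  interpret atlas_chart "atlas S" U \<phi> by unfold_locales (fact atlas_axiom, fact U(1))
  show False using tangent_space_nontrivial[OF U(2)] T0 by blast
qed

end

section \<open>Joining horizontal curves\<close>

lemma AE_unit_interval_pos: "AE s in lebesgue_on {0..1}. 0 < (s::real) \<and> s \<le> 1"
proof -
  have "AE s in lebesgue. s \<noteq> (0::real)"
    using AE_not_in[of "{0::real}" lebesgue] by (simp add: negligible_iff_null_sets[symmetric])
  then have "AE s in lebesgue. s \<in> {0..1} \<longrightarrow> 0 < (s::real) \<and> s \<le> 1"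
    by eventually_elim auto
  then show ?thesis by (simp add: AE_restrict_space_iff)
qed

text \<open>The set \<open>T\<close> localises the assumption to a neighbourhood of \<open>t\<close>: a joined curve is an affine
  reparametrisation of one of its parts on each side of the midpoint only.\<close>

lemma velocity_affine:
  fixes \<gamma> \<eta> :: "real \<Rightarrow> 'a::topological_space"
  assumes t: "t \<in> {0..1}" "open T" "t \<in> T" and \<gamma>: "curve_differentiable A \<gamma> (c * t + d)"
    and img: "\<And>s. s \<in> {0..1} \<inter> T \<Longrightarrow> c * s + d \<in> {0..1} \<and> \<eta> s = \<gamma> (c * s + d)"
  shows "curve_differentiable A \<eta> t" "velocity A \<eta> t = tvec_scale c (velocity A \<gamma> (c * t + d))"
proof -
  let ?s = "c * t + d"
  have eq: "\<eta> t = \<gamma> ?s" using img t by blast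
  have at_eq: "at t within {0..1} = at t within ({0..1} \<inter> T)"
    by (rule at_within_nhd[of t T]) (use t in auto)
  have der: "((h \<circ> \<eta>) has_vector_derivative c * vector_derivative (h \<circ> \<gamma>) (at ?s within {0..1})) (at t within {0..1})"
    if h: "smooth_near A (\<eta> t) h" for h
  proof -
    let ?D = "vector_derivative (h \<circ> \<gamma>) (at ?s within {0..1})"
    have "((h \<circ> \<gamma>) has_vector_derivative ?D) (at ?s within {0..1})"
      using \<gamma> h eq by (simp add: curve_differentiable_def vector_derivative_works)
    then have "((h \<circ> \<gamma>) has_vector_derivative ?D) (at ?s within (\<lambda>s. c * s + d) ` ({0..1} \<inter> T))"
      by (rule has_vector_derivative_within_subset) (use img in auto)
    moreover have "((\<lambda>s. c * s + d) has_vector_derivative c) (at t within ({0..1} \<inter> T))"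
      by (auto intro!: derivative_eq_intros simp flip: has_real_derivative_iff_has_vector_derivative)
    ultimately have "((h \<circ> \<gamma>) \<circ> (\<lambda>s. c * s + d) has_vector_derivative c *\<^sub>R ?D) (at t within ({0..1} \<inter> T))"
      by (intro vector_diff_chain_within)
    then have "((h \<circ> \<eta>) has_vector_derivative c *\<^sub>R ?D) (at t within ({0..1} \<inter> T))"
      by (rule has_vector_derivative_transform[rotated 2]) (use t img in auto)
    then show ?thesis unfolding at_eq by simp
  qed
  show "curve_differentiable A \<eta> t"
    unfolding curve_differentiable_def
    using der unfolding has_vector_derivative_def differentiable_def by blast
  show "velocity A \<eta> t = tvec_scale c (velocity A \<gamma> ?s)"
  proof
    fix h
    show "velocity A \<eta> t h = tvec_scale c (velocity A \<gamma> ?s) h"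
    proof (cases "smooth_near A (\<eta> t) h")
      case True
      then show ?thesis
        using vector_derivative_within_cbox[OF _ _ der[OF True, folded cbox_interval]] t(1) eq
        by (simp add: velocity_def tvec_scale_def)
    next
      case False
      then show ?thesis using eq by (simp add: velocity_def tvec_scale_def)
    qed
  qed
qed

context sr_manifold
begin

text \<open>Multiplying a minimiser for \<open>v\<close> by \<open>c\<close> gives a competitor for \<open>c v\<close>; this is the inequality
  needed for the length of a reparametrised curve.\<close>

lemma horizontal_scale:
  assumes q: "q \<in> points S" and v: "v \<in> field_values (horizontal_fields S) q"
  shows "tvec_scale c v \<in> field_values (horizontal_fields S) q"
    "sqrt (sr_norm_sq S q (tvec_scale c v)) \<le> \<bar>c\<bar> * sqrt (sr_norm_sq S q v)"
proof -
  obtain u where u: "u \<in> fiber S q" "v = anchor S u"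
    using v field_values_horizontal[OF q] by auto
  obtain u' where u': "u' \<in> fiber S q" "anchor S u' = v" "sr_norm_sq S q v = fib_inner S u' u'"
    using min_norm[OF q u(1)] u(2) by metis
  have cu: "fib_scale S c u' \<in> fiber S q" "anchor S (fib_scale S c u') = tvec_scale c v"
    using fib_closed(2)[OF q u'(1)] anchor_props(3)[OF q u'(1)] u'(2) by auto
  then show "tvec_scale c v \<in> field_values (horizontal_fields S) q"
    unfolding field_values_horizontal[OF q] by (metis imageI)
  have lin: "\<forall>v\<in>fiber S q. fib_inner S (fib_scale S c u') v = c * fib_inner S u' v"
    and sym: "\<forall>v\<in>fiber S q. fib_inner S u' v = fib_inner S v u'"
    using metric_axioms q u'(1) unfolding euclidean_structure_def by blast+
  have "fib_inner S (fib_scale S c u') (fib_scale S c u') = c * (c * fib_inner S u' u')"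
    using lin sym cu(1) u'(1) by metis
  moreover have "sr_norm_sq S q (tvec_scale c v) \<le> fib_inner S (fib_scale S c u') (fib_scale S c u')"
    using min_norm[OF q cu(1)] cu(2) by metis
  ultimately have "sqrt (sr_norm_sq S q (tvec_scale c v)) \<le> sqrt (c\<^sup>2 * sr_norm_sq S q v)"
    using u'(3) by (simp add: power2_eq_square mult.assoc)
  then show "sqrt (sr_norm_sq S q (tvec_scale c v)) \<le> \<bar>c\<bar> * sqrt (sr_norm_sq S q v)"
    by (simp add: real_sqrt_mult)
qed

text \<open>Symmetry and triangle inequality in one step: two curves with a common starting point give a
  curve between their endpoints. Both halves are run through with speed \<open>2\<close>, so the velocities are
  multiplied by \<open>- 2\<close> and \<open>2\<close>.\<close>

lemma join_horizontal_curves: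
  assumes \<gamma>1: "horizontal_curve S \<gamma>1" and \<gamma>2: "horizontal_curve S \<gamma>2" and start: "\<gamma>1 0 = \<gamma>2 0"
  shows "horizontal_curve S (reversepath \<gamma>1 +++ \<gamma>2)"
    "sr_length S (reversepath \<gamma>1 +++ \<gamma>2) \<le> sr_length S \<gamma>1 + sr_length S \<gamma>2"
proof -
  let ?\<gamma> = "reversepath \<gamma>1 +++ \<gamma>2"
  let ?H = "\<lambda>\<gamma> t. curve_differentiable (atlas S) \<gamma> t \<and>
        velocity (atlas S) \<gamma> t \<in> field_values (horizontal_fields S) (\<gamma> t)"
  let ?l = "\<lambda>\<gamma> t. ennreal (sqrt (sr_norm_sq S (\<gamma> t) (velocity (atlas S) \<gamma> t)))"
  have left: "?\<gamma> t = \<gamma>1 (-2 * t + 1)" if "t \<le> 1/2" for t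
    using that by (simp add: joinpaths_def reversepath_def)
  have right: "?\<gamma> t = \<gamma>2 (2 * t + (-1))" if "1/2 \<le> t" for t
  proof (cases "t = 1/2")
    case True
    show ?thesis unfolding True using start by (simp add: joinpaths_def reversepath_def)
  qed (use that in \<open>simp add: joinpaths_def reversepath_def\<close>)
  have ac: "abs_continuous_curve (atlas S) \<gamma>1" "abs_continuous_curve (atlas S) \<gamma>2"
    using \<gamma>1 \<gamma>2 by (auto simp: horizontal_curve_def)
  have img: "\<gamma>1 s \<in> points S" "\<gamma>2 s \<in> points S" if "s \<in> {0..1}" for s
    using ac that by (auto simp: abs_continuous_curve_def points_def)
  have cont: "continuous_on {0..1} ?\<gamma>"
  proof -
    have "path \<gamma>1" "path \<gamma>2" using ac by (auto simp: path_def abs_continuous_curve_def)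
    then have "path ?\<gamma>"
      by (intro path_join_imp) (auto simp: start pathstart_def pathfinish_def reversepath_def path_reversepath[unfolded reversepath_def])
    then show ?thesis by (simp add: path_def)
  qed
  have AC: "abs_continuous_on a b (\<phi> \<circ> ?\<gamma>)"
    if UA: "(U, \<phi>) \<in> atlas S" and ab: "0 \<le> a" "a \<le> b" "b \<le> 1" and U: "?\<gamma> ` {a..b} \<subseteq> U" for U \<phi> a b
  proof -
    have half: "abs_continuous_on a' b' (\<phi> \<circ> ?\<gamma>)"
      if acg: "abs_continuous_curve (atlas S) \<gamma>" and m: "m \<noteq> 0"
        and ab': "a \<le> a'" "a' \<le> b'" "b' \<le> b" and mq: "(\<lambda>t. m * t + d) ` {a'..b'} = {k..l}" "0 \<le> k" "k \<le> l" "l \<le> 1"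
        and eq: "\<And>t. t \<in> {a'..b'} \<Longrightarrow> ?\<gamma> t = \<gamma> (m * t + d)" for \<gamma> m d a' b' k l
    proof -
      have "\<gamma> ` {k..l} \<subseteq> U"
        unfolding mq(1)[symmetric] image_image
      proof (rule image_subsetI)
        fix t assume t: "t \<in> {a'..b'}"
        then have "?\<gamma> t \<in> U" using U ab' by (intro subsetD[OF U] imageI) auto
        then show "\<gamma> (m * t + d) \<in> U" using eq[OF t] by simp
      qed
      then have "abs_continuous_on k l (\<phi> \<circ> \<gamma>)"
        using acg UA mq(2-4) unfolding abs_continuous_curve_def by blast
      from abs_continuous_on_affine[OF this m, of d a' b'] mq(1)
      have "abs_continuous_on a' b' (\<lambda>t. (\<phi> \<circ> \<gamma>) (m * t + d))" by simp
      then show ?thesis by (rule abs_continuous_on_cong) (simp add: eq)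
    qed
    have L: "abs_continuous_on a' b' (\<phi> \<circ> ?\<gamma>)" if "a \<le> a'" "a' \<le> b'" "b' \<le> b" "b' \<le> 1/2" for a' b'
      by (rule half[OF ac(1), of "-2" a' b' 1 "1 - 2 * b'" "1 - 2 * a'"])
        (use that ab left image_affinity_atLeastAtMost[of "-2" 1 a' b'] in simp_all)
    have R: "abs_continuous_on a' b' (\<phi> \<circ> ?\<gamma>)" if "a \<le> a'" "a' \<le> b'" "b' \<le> b" "1/2 \<le> a'" for a' b'
      by (rule half[OF ac(2), of 2 a' b' "-1" "2 * a' - 1" "2 * b' - 1"])
        (use that ab right image_affinity_atLeastAtMost[of 2 "-1" a' b'] in simp_all)
    consider "b \<le> 1/2" | "1/2 \<le> a" | "a \<le> 1/2" "1/2 \<le> b" by linarith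
    then show ?thesis
    proof cases
      case 1
      with ab show ?thesis by (intro L) simp_all
    next
      case 2
      with ab show ?thesis by (intro R) simp_all
    next
      case 3
      with ab show ?thesis by (intro abs_continuous_on_join[OF L[of a "1/2"] R[of "1/2" b]]) simp_all
    qed
  qed
  have im: "?\<gamma> ` {0..1} \<subseteq> chart_union (atlas S)"
  proof (rule image_subsetI)
    fix t :: real assume t: "t \<in> {0..1}"
    show "?\<gamma> t \<in> chart_union (atlas S)"
    proof (cases "t \<le> 1/2")
      case True
      then show ?thesis unfolding left[OF True] points_def[symmetric] using t by (intro img(1)) simp
    next
      case False
      then have r: "1/2 \<le> t" by simp
      then show ?thesis unfolding right[OF r] points_def[symmetric] using t by (intro img(2)) simp
    qed
  qed
  \<comment> \<open>the parameter s = 0 is the midpoint of the joined curve, where it may have a corner\<close>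
  have ae1: "AE s in lebesgue_on {0..1}. ?H ?\<gamma> ((1 - s) / 2) \<and> ?l ?\<gamma> ((1 - s) / 2) \<le> 2 * ?l \<gamma>1 s"
    using \<gamma>1[unfolded horizontal_curve_def, THEN conjunct2] AE_unit_interval_pos
  proof eventually_elim
    case (elim s)
    let ?t = "(1 - s) / 2"
    have s: "-2 * ?t + 1 = s" by argo
    have s01: "s \<in> {0..1}" using elim by auto
    have vel: "curve_differentiable (atlas S) ?\<gamma> ?t"
      "velocity (atlas S) ?\<gamma> ?t = tvec_scale (-2) (velocity (atlas S) \<gamma>1 s)"
      using velocity_affine[of ?t "{..<1/2}" "atlas S" \<gamma>1 "-2" 1 ?\<gamma>, unfolded s] elim left by auto
    have pt: "?\<gamma> ?t = \<gamma>1 s" using left[of ?t] s elim by simp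
    note hs = horizontal_scale[OF img(1)[OF s01], of "velocity (atlas S) \<gamma>1 s" "-2"]
    have "?l ?\<gamma> ?t \<le> ennreal (2 * sqrt (sr_norm_sq S (\<gamma>1 s) (velocity (atlas S) \<gamma>1 s)))"
      unfolding vel(2) pt using hs(2) elim by (intro ennreal_leI) auto
    also have "\<dots> = 2 * ?l \<gamma>1 s" by (simp add: ennreal_mult')
    finally show ?case using vel pt hs(1) elim by auto
  qed
  have ae2: "AE s in lebesgue_on {0..1}. ?H ?\<gamma> ((1 + s) / 2) \<and> ?l ?\<gamma> ((1 + s) / 2) \<le> 2 * ?l \<gamma>2 s"
    using \<gamma>2[unfolded horizontal_curve_def, THEN conjunct2] AE_unit_interval_pos
  proof eventually_elim
    case (elim s)
    let ?t = "(1 + s) / 2"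
    have s: "2 * ?t + (-1) = s" by argo
    have s01: "s \<in> {0..1}" using elim by auto
    have vel: "curve_differentiable (atlas S) ?\<gamma> ?t"
      "velocity (atlas S) ?\<gamma> ?t = tvec_scale 2 (velocity (atlas S) \<gamma>2 s)"
      using velocity_affine[of ?t "{1/2<..}" "atlas S" \<gamma>2 2 "-1" ?\<gamma>, unfolded s] elim right by auto
    have pt: "?\<gamma> ?t = \<gamma>2 s" using right[of ?t] s elim by simp
    note hs = horizontal_scale[OF img(2)[OF s01], of "velocity (atlas S) \<gamma>2 s" 2]
    have "?l ?\<gamma> ?t \<le> ennreal (2 * sqrt (sr_norm_sq S (\<gamma>2 s) (velocity (atlas S) \<gamma>2 s)))"
      unfolding vel(2) pt using hs(2) elim by (intro ennreal_leI) auto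
    also have "\<dots> = 2 * ?l \<gamma>2 s" by (simp add: ennreal_mult')
    finally show ?case using vel pt hs(1) elim by auto
  qed
  have "AE t in lebesgue_on {0..1}. ?H ?\<gamma> t"
    by (rule AE_unit_interval_halves[of "?H ?\<gamma>"]) (use ae1 ae2 in \<open>auto elim!: eventually_mono\<close>)
  then show "horizontal_curve S ?\<gamma>"
    unfolding horizontal_curve_def abs_continuous_curve_def using cont im AC by blast
  show "sr_length S ?\<gamma> \<le> sr_length S \<gamma>1 + sr_length S \<gamma>2"
    unfolding sr_length_def
    by (rule nn_integral_unit_interval_halves) (use ae1 ae2 in \<open>auto elim!: eventually_mono\<close>)
qed

lemma sr_diam_ball_le: "0 < r \<Longrightarrow> sr_diam S (sr_ball S q r) \<le> ennreal (2 * r)"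
  unfolding sr_diam_def
proof (intro SUP_least)
  fix x y assume r: "0 < r" and "x \<in> sr_ball S q r" "y \<in> sr_ball S q r"
  then have "sr_dist S q x < ennreal r" "sr_dist S q y < ennreal r" by (auto simp: sr_ball_def)
  then obtain \<gamma>1 \<gamma>2 where 1: "horizontal_curve S \<gamma>1" "\<gamma>1 0 = q" "\<gamma>1 1 = x" "sr_length S \<gamma>1 < ennreal r"
    and 2: "horizontal_curve S \<gamma>2" "\<gamma>2 0 = q" "\<gamma>2 1 = y" "sr_length S \<gamma>2 < ennreal r"
    unfolding sr_dist_def INF_less_iff by blast
  let ?\<gamma> = "reversepath \<gamma>1 +++ \<gamma>2"
  have j: "horizontal_curve S ?\<gamma>" "sr_length S ?\<gamma> \<le> sr_length S \<gamma>1 + sr_length S \<gamma>2"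
    using join_horizontal_curves[OF 1(1) 2(1)] 1(2) 2(2) by auto
  have "sr_dist S x y \<le> sr_length S ?\<gamma>"
    unfolding sr_dist_def
    by (rule INF_lower) (use j(1) 1 2 in \<open>auto simp: joinpaths_def reversepath_def\<close>)
  also have "\<dots> \<le> ennreal r + ennreal r"
    using order_trans[OF j(2) add_mono[OF less_imp_le[OF 1(4)] less_imp_le[OF 2(4)]]] .
  also have "\<dots> = ennreal (2 * r)" using r by (simp flip: ennreal_plus)
  finally show "sr_dist S x y \<le> ennreal (2 * r)" .
qed

end

section \<open>Coordinates along horizontal curves\<close>

context sr_chart
begin

text \<open>At almost every time the velocity is the anchor of a vector of minimal norm, to which the
  hypothesis on \<open>w\<close> applies. So the coordinate function \<open>\<phi> \<bullet> w\<close> has, along the curve, a derivative that is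
  bounded by the speed.\<close>

lemma coord_increment_le_length:
  assumes \<gamma>: "horizontal_curve S \<gamma>" and b: "0 \<le> b" "b \<le> 1"
    and N: "\<And>t. t \<in> {0..b} \<Longrightarrow> \<gamma> t \<in> U \<inter> W"
    and bound: "\<And>t \<xi>. t \<in> {0..b} \<Longrightarrow> \<bar>anchor_coords (\<phi> (\<gamma> t)) \<xi> \<bullet> w\<bar> \<le> sqrt (gram (\<gamma> t) \<xi> \<xi>)"
  shows "ennreal \<bar>(\<phi> (\<gamma> b) - \<phi> (\<gamma> 0)) \<bullet> w\<bar> \<le> sr_length S \<gamma>"
proof -
  have ac: "abs_continuous_curve (atlas S) \<gamma>"
    and H: "AE t in lebesgue_on {0..1}. curve_differentiable (atlas S) \<gamma> t \<and>
        velocity (atlas S) \<gamma> t \<in> field_values (horizontal_fields S) (\<gamma> t)"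
    using \<gamma> by (auto simp: horizontal_curve_def)
  have "\<gamma> ` {0..b} \<subseteq> U" using N by blast
  then have acb: "abs_continuous_on 0 b (\<phi> \<circ> \<gamma>)"
    using ac chart.chart b unfolding abs_continuous_curve_def by blast
  have "ennreal \<bar>(\<phi> \<circ> \<gamma>) b \<bullet> w - (\<phi> \<circ> \<gamma>) 0 \<bullet> w\<bar> \<le>
      (\<integral>\<^sup>+ t. ennreal (sqrt (sr_norm_sq S (\<gamma> t) (velocity (atlas S) \<gamma> t))) \<partial>lebesgue_on {0..1})"
  proof (rule abs_continuous_increment_le[OF order_refl b abs_continuous_on_inner[OF acb]])
    show "AE t in lebesgue_on {0..1}. t \<in> {0..b} \<longrightarrow>
      (\<exists>D. ((\<lambda>t. (\<phi> \<circ> \<gamma>) t \<bullet> w) has_vector_derivative D) (at t within {0..1}) \<and>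
        ennreal \<bar>D\<bar> \<le> ennreal (sqrt (sr_norm_sq S (\<gamma> t) (velocity (atlas S) \<gamma> t))))"
    proof (rule eventually_mono[OF H], rule impI)
      fix t assume elim: "curve_differentiable (atlas S) \<gamma> t \<and>
          velocity (atlas S) \<gamma> t \<in> field_values (horizontal_fields S) (\<gamma> t)" "t \<in> {0..b}"
      let ?v = "velocity (atlas S) \<gamma> t"
      have q: "\<gamma> t \<in> U" "\<gamma> t \<in> W" using N elim by auto
      note qp = triv_point[OF q(2)]
      obtain u where u: "u \<in> fiber S (\<gamma> t)" "?v = anchor S u"
        using elim field_values_horizontal[OF qp] by auto
      obtain u' where u': "u' \<in> fiber S (\<gamma> t)" "anchor S u' = ?v" "sr_norm_sq S (\<gamma> t) ?v = fib_inner S u' u'"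
        using min_norm[OF qp u(1)] u(2) by metis
      have "((\<lambda>s. \<phi> (\<gamma> s) \<bullet> w) has_vector_derivative ?v (\<lambda>q. \<phi> q \<bullet> w)) (at t within {0..1})"
        using elim b q by (intro chart.velocity_inner) auto
      moreover have "\<bar>?v (\<lambda>q. \<phi> q \<bullet> w)\<bar> \<le> sqrt (sr_norm_sq S (\<gamma> t) ?v)"
      proof -
        have "?v (\<lambda>q. \<phi> q \<bullet> w) = anchor_coords (\<phi> (\<gamma> t)) (\<tau> u') \<bullet> w"
          using chart.coord_vec_inner[OF anchor_props(1)[OF qp u'(1)] q(1), of w] q u'
          by (simp add: anchor_coords_def lift_tau)
        moreover have "gram (\<gamma> t) (\<tau> u') (\<tau> u') = sr_norm_sq S (\<gamma> t) ?v"
          using u' q by (simp add: gram_def lift_tau)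
        ultimately show ?thesis using bound[of t "\<tau> u'"] elim by simp
      qed
      ultimately show "\<exists>D. ((\<lambda>t. (\<phi> \<circ> \<gamma>) t \<bullet> w) has_vector_derivative D) (at t within {0..1}) \<and>
          ennreal \<bar>D\<bar> \<le> ennreal (sqrt (sr_norm_sq S (\<gamma> t) ?v))"
        by (auto intro: ennreal_leI)
    qed
  qed
  then show ?thesis by (simp add: sr_length_def inner_diff_left)
qed

text \<open>Up to the first exit time the curve lies in the closed coordinate ball, where the coordinates
  change with speed at most \<open>K\<close> times the sub-Riemannian speed, and it has to travel at least the
  coordinate distance from its starting point to the sphere.\<close>

lemma length_ge_of_exit:
  assumes \<rho>: "cball x0 \<rho> \<subseteq> chart_image" and K: "K > 0"
    and bound: "\<And>x \<xi>. x \<in> cball x0 \<rho> \<Longrightarrow> norm (anchor_coords x \<xi>) \<le> K * sqrt (gram (chart.\<psi> x) \<xi> \<xi>)"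
    and \<gamma>: "horizontal_curve S \<gamma>" and start: "\<gamma> 0 \<in> U" "\<phi> (\<gamma> 0) \<in> ball x0 \<rho>"
    and exit: "\<not> \<gamma> ` {0..1} \<subseteq> U \<inter> \<phi> -` ball x0 \<rho>"
  shows "ennreal ((\<rho> - dist x0 (\<phi> (\<gamma> 0))) / K) \<le> sr_length S \<gamma>"
proof -
  let ?G = "U \<inter> \<phi> -` ball x0 \<rho>"
  have cont: "continuous_on {0..1} \<gamma>" using \<gamma> by (simp add: horizontal_curve_def abs_continuous_curve_def)
  have opG: "open ?G" by (rule chart.open_chart_preimage) simp
  define T where "T = {0..1} \<inter> \<gamma> -` (- ?G)"
  have T: "closed T" unfolding T_def
    by (rule continuous_closed_preimage[OF cont closed_atLeastAtMost closed_Compl[OF opG]])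
  have Tne: "T \<noteq> {}" "bdd_below T" using exit by (auto simp: T_def bdd_below_def)
  define t where "t = Inf T"
  have tT: "t \<in> T" unfolding t_def by (rule closed_contains_Inf[OF Tne T])
  have t0: "0 < t" "t \<le> 1" using tT start by (auto simp: T_def less_le)
  have before: "\<gamma> s \<in> ?G" if "s \<in> {0..<t}" for s
  proof (rule ccontr)
    assume "\<gamma> s \<notin> ?G"
    then have "s \<in> T" using that t0 by (auto simp: T_def)
    then show False using cInf_lower[OF _ Tne(2)] that by (force simp: t_def)
  qed
  define C where "C = chart.\<psi> ` cball x0 \<rho>"
  have "cball x0 \<rho> \<subseteq> \<phi> ` U" using \<rho> by blast
  then have "compact C"
    unfolding C_def by (intro compact_continuous_image continuous_on_subset[OF chart.chart_props(5)]) auto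
  then have clC: "closed C" by (rule compact_imp_closed)
  have CUW: "q \<in> U \<inter> W \<and> \<phi> q \<in> cball x0 \<rho> \<and> chart.\<psi> (\<phi> q) = q" if qC: "q \<in> C" for q
  proof -
    obtain x where x: "x \<in> cball x0 \<rho>" "q = chart.\<psi> x" using qC unfolding C_def by blast
    moreover obtain p where "p \<in> U \<inter> W" "x = \<phi> p" using \<rho> x(1) by blast
    ultimately show ?thesis by simp
  qed
  have "\<gamma> ` closure {0..<t} \<subseteq> C"
  proof (rule image_closure_subset[OF _ clC])
    show "continuous_on (closure {0..<t}) \<gamma>"
      using t0 by (intro continuous_on_subset[OF cont]) auto
    show "\<gamma> ` {0..<t} \<subseteq> C"
    proof (rule image_subsetI)
      fix s assume "s \<in> {0..<t}"
      then have "\<gamma> s \<in> U" "\<phi> (\<gamma> s) \<in> cball x0 \<rho>" using before[of s] by auto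
      then show "\<gamma> s \<in> C" unfolding C_def by (intro image_eqI[of _ _ "\<phi> (\<gamma> s)"]) auto
    qed
  qed
  then have inC: "\<gamma> s \<in> C" if "s \<in> {0..t}" for s
    using that t0 by auto
  let ?d = "\<phi> (\<gamma> t) - \<phi> (\<gamma> 0)"
  have "\<phi> (\<gamma> t) \<notin> ball x0 \<rho>" using tT CUW[OF inC[of t]] t0 by (auto simp: T_def)
  then have "\<rho> \<le> dist x0 (\<phi> (\<gamma> t))" by simp
  then have d: "\<rho> - dist x0 (\<phi> (\<gamma> 0)) \<le> norm ?d"
    using dist_triangle[of x0 "\<phi> (\<gamma> t)" "\<phi> (\<gamma> 0)"] by (simp add: dist_norm norm_minus_commute)
  have d0: "norm ?d > 0" using d start(2) by (auto simp: dist_commute)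
  \<comment> \<open>the coordinate in the direction of the displacement, scaled to have horizontal gradient at most 1\<close>
  let ?w = "(1 / (K * norm ?d)) *\<^sub>R ?d"
  have nw: "norm ?w = 1 / K" using K d0 unfolding norm_scaleR by (simp add: divide_simps)
  have "ennreal \<bar>?d \<bullet> ?w\<bar> \<le> sr_length S \<gamma>"
  proof (rule coord_increment_le_length[OF \<gamma>])
    fix s assume s: "s \<in> {0..t}"
    show "\<gamma> s \<in> U \<inter> W" using CUW[OF inC[OF s]] by simp
    fix \<xi>
    have "\<bar>anchor_coords (\<phi> (\<gamma> s)) \<xi> \<bullet> ?w\<bar> \<le> norm (anchor_coords (\<phi> (\<gamma> s)) \<xi>) * norm ?w"
      by (rule Cauchy_Schwarz_ineq2)
    also have "\<dots> = norm (anchor_coords (\<phi> (\<gamma> s)) \<xi>) / K" unfolding nw by simp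
    also have "\<dots> \<le> sqrt (gram (\<gamma> s) \<xi> \<xi>)"
      using bound[of "\<phi> (\<gamma> s)" \<xi>] CUW[OF inC[OF s]] K by (simp add: field_simps)
    finally show "\<bar>anchor_coords (\<phi> (\<gamma> s)) \<xi> \<bullet> ?w\<bar> \<le> sqrt (gram (\<gamma> s) \<xi> \<xi>)" .
  qed (use t0 in auto)
  moreover have "?d \<bullet> ?w = norm ?d / K"
    using d0 K by (simp add: power2_norm_eq_inner[symmetric] power2_eq_square)
  moreover have "(\<rho> - dist x0 (\<phi> (\<gamma> 0))) / K \<le> norm ?d / K"
    using d K by (simp add: divide_right_mono)
  ultimately show ?thesis
    using K by (metis abs_of_nonneg divide_nonneg_pos ennreal_leI norm_ge_zero order_trans)
qed

end

section \<open>Flow of a cut-off horizontal field\<close>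

text \<open>The derivative is continuous and vanishes outside the ball, so it is bounded, and the mean value
  inequality on the whole space gives the Lipschitz constant.\<close>

lemma smooth_compact_support_bounds:
  fixes F :: "'e::euclidean_space \<Rightarrow> 'f::euclidean_space"
  assumes F: "smooth_on UNIV F" and supp: "\<And>x. x \<notin> cball x0 \<rho> \<Longrightarrow> F x = 0"
  obtains L M where "0 \<le> L" "0 < M" "\<And>x y. norm (F x - F y) \<le> L * norm (x - y)" "\<And>x. norm (F x) \<le> M"
proof -
  have bdd: "\<exists>M. \<forall>x. norm (G x) \<le> M" if G: "continuous_on UNIV G" "\<And>x. x \<notin> cball x0 \<rho> \<Longrightarrow> G x = 0"
    for G :: "'e \<Rightarrow> 'f"
  proof -
    have "compact (G ` cball x0 \<rho>)"
      by (intro compact_continuous_image continuous_on_subset[OF G(1)]) auto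
    then obtain B where B: "\<And>x. x \<in> cball x0 \<rho> \<Longrightarrow> norm (G x) \<le> B"
      using compact_imp_bounded[of "G ` cball x0 \<rho>"] unfolding bounded_iff by blast
    have "norm (G x) \<le> max B 0" for x
      using B[of x] G(2)[of x] by (cases "x \<in> cball x0 \<rho>") auto
    then show ?thesis by blast
  qed
  let ?D = "\<lambda>x. frechet_derivative F (at x)"
  have "\<exists>M. \<forall>x. norm (?D x b) \<le> M" for b
  proof (rule bdd)
    show "continuous_on UNIV (\<lambda>x. ?D x b)" by (rule smooth_on_continuous[OF smooth_on_derivative[OF F]])
    fix x assume x: "x \<notin> cball x0 \<rho>"
    have "?D x = frechet_derivative (\<lambda>x. 0) (at x)"
      by (rule frechet_derivative_transform_within_open[of _ _ "- cball x0 \<rho>"])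
        (use smooth_on_has_derivative[OF F] x supp in \<open>auto simp: differentiable_def open_Compl\<close>)
    then show "?D x b = 0" by simp
  qed
  then obtain m where m: "\<And>b x. norm (?D x b) \<le> m b" by metis
  define L where "L = (\<Sum>b\<in>Basis. m b)"
  have m0: "0 \<le> m b" for b using order_trans[OF norm_ge_zero m] .
  have on: "onorm (?D x) \<le> L" for x
  proof (rule onorm_le)
    fix v
    have "norm (?D x v) \<le> (\<Sum>b\<in>Basis. norm ((v \<bullet> b) *\<^sub>R ?D x b))"
      using linear_eq_sum_Basis[OF has_derivative_linear[OF smooth_on_has_derivative[OF F]], of x v] norm_sum
      by (metis UNIV_I)
    also have "\<dots> \<le> (\<Sum>b\<in>Basis. norm v * m b)"
      using m m0 by (intro sum_mono) (auto intro!: mult_mono simp: Basis_le_norm)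
    finally show "norm (?D x v) \<le> L * norm v" by (simp add: L_def sum_distrib_left mult.commute)
  qed
  obtain M where M: "\<And>x. norm (F x) \<le> M"
    using bdd[OF smooth_on_continuous[OF F] supp] by blast
  show thesis
  proof (rule that[of L "max M 1"])
    show "0 \<le> L" unfolding L_def by (intro sum_nonneg m0)
    show "norm (F x - F y) \<le> L * norm (x - y)" for x y
      by (rule differentiable_bound[of UNIV F ?D])
        (use smooth_on_has_derivative[OF F] on in auto)
    show "norm (F x) \<le> max M 1" for x using M[of x] by simp
  qed simp
qed

lemma vector_derivative_increment_bound:
  fixes f :: "real \<Rightarrow> 'e::real_normed_vector"
  assumes "\<And>t. t \<in> {a..b} \<Longrightarrow> (f has_vector_derivative f' t) (at t within {a..b})"
    and "\<And>t. t \<in> {a..b} \<Longrightarrow> norm (f' t) \<le> B" and "a \<le> s" "s \<le> t" "t \<le> b"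
  shows "norm (f t - f s) \<le> B * (t - s)"
proof -
  have "norm (f t - f s) \<le> B * norm (t - s)"
  proof (rule differentiable_bound[of "{a..b}" f "\<lambda>t h. h *\<^sub>R f' t"])
    show "onorm (\<lambda>h. h *\<^sub>R f' t) \<le> B" if "t \<in> {a..b}" for t
      by (rule onorm_le)
        (use mult_right_mono[OF assms(2)[OF that] abs_ge_zero] in \<open>simp add: mult.commute\<close>)
  qed (use assms in \<open>auto simp: has_vector_derivative_def\<close>)
  then show ?thesis using assms(4) by simp
qed

context sr_chart
begin

text \<open>The coordinate expression of the horizontal field given by \<open>section_extension\<close>; the value \<open>0\<close> outside
  the chart makes it a field on the whole coordinate space.\<close>

definition cutoff_field :: "('e \<Rightarrow> real) \<Rightarrow> 'u \<Rightarrow> 'e \<Rightarrow> 'e" where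
  "cutoff_field \<beta> \<xi> x = (if x \<in> chart_image then \<beta> x *\<^sub>R anchor_coords x \<xi> else 0)"

lemma anchor_coords_smooth_fixed: "smooth_on chart_image (\<lambda>x. anchor_coords x \<xi>)"
proof -
  have "smooth_on chart_image (\<lambda>x. (x, \<xi>))" by (intro smooth_on_Pair open_chart_overlap) auto
  from smooth_on_compose[OF anchor_coords_smooth this open_chart_overlap open_Times[OF open_chart_overlap open_UNIV]]
  show ?thesis by auto
qed

lemma cutoff_field_smooth:
  assumes \<rho>: "cball x0 \<rho> \<subseteq> chart_image" and \<beta>: "smooth_on UNIV \<beta>" "\<And>x. x \<notin> ball x0 \<rho> \<Longrightarrow> \<beta> x = 0"
  shows "smooth_on UNIV (cutoff_field \<beta> \<xi>)"
proof (rule smooth_on_locally)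
  fix x
  show "\<exists>T. open T \<and> x \<in> T \<and> smooth_on T (cutoff_field \<beta> \<xi>)"
  proof (cases "x \<in> chart_image")
    case True
    have "smooth_on chart_image (\<lambda>x. \<beta> x *\<^sub>R anchor_coords x \<xi>)"
      by (intro smooth_on_scaleR open_chart_overlap smooth_on_subset[OF \<beta>(1)] anchor_coords_smooth_fixed) auto
    then have "smooth_on chart_image (cutoff_field \<beta> \<xi>)"
      by (rule smooth_on_cong[OF _ open_chart_overlap]) (simp add: cutoff_field_def)
    with True open_chart_overlap show ?thesis by blast
  next
    case False
    have op: "open (- cball x0 \<rho>)" by (simp add: open_Compl)
    have "smooth_on (- cball x0 \<rho>) (cutoff_field \<beta> \<xi>)"
    proof (rule smooth_on_cong[OF smooth_on_const[of _ 0] op])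
      fix y assume "y \<in> - cball x0 \<rho>"
      then have "y \<notin> ball x0 \<rho>" by auto
      then show "0 = cutoff_field \<beta> \<xi> y" using \<beta>(2) by (simp add: cutoff_field_def)
    qed
    with False op \<rho> show ?thesis by blast
  qed
qed

text \<open>The point \<open>p\<close> is reached from \<open>q\<close> by the flow of the horizontal field in time \<open>s\<close>, which may be
  negative. The integral curve is found in coordinates, for the scaled field and time \<open>1\<close>. It stays in
  the smaller ball because the field is bounded by \<open>M\<close>, its speed is at most \<open>|s| B\<close> because \<open>B\<close> bounds the
  norm of the section, and the coordinate \<open>\<phi> \<bullet> w\<close> changes by at least \<open>|s| m\<close> in the direction of the sign
  of \<open>s\<close> by the mean value theorem.\<close>

lemma flow_point:
  assumes \<rho>: "cball x0 \<rho> \<subseteq> chart_image" and \<beta>: "smooth_on UNIV \<beta>" "\<And>x. x \<notin> ball x0 \<rho> \<Longrightarrow> \<beta> x = 0"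
      "\<And>x. 0 \<le> \<beta> x" "\<And>x. \<beta> x \<le> 1"
    and lip: "\<And>x y. norm (cutoff_field \<beta> \<xi> x - cutoff_field \<beta> \<xi> y) \<le> L * norm (x - y)" "0 \<le> L" "\<bar>s\<bar> * L < 1"
    and M: "\<And>x. norm (cutoff_field \<beta> \<xi> x) \<le> M"
    and q: "q \<in> U \<inter> W" "dist x0 (\<phi> q) + \<bar>s\<bar> * M < \<rho>1" "\<rho>1 \<le> \<rho>"
    and B: "0 \<le> B" "\<And>x. x \<in> ball x0 \<rho>1 \<Longrightarrow> gram (chart.\<psi> x) \<xi> \<xi> \<le> B\<^sup>2"
    and m: "\<And>x. x \<in> ball x0 \<rho>1 \<Longrightarrow> m \<le> cutoff_field \<beta> \<xi> x \<bullet> w"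
  obtains p where "p \<in> points S" "p \<in> U" "\<phi> p \<in> ball x0 \<rho>1" "sr_dist S q p \<le> ennreal (\<bar>s\<bar> * B)"
    "\<bar>s\<bar> * m \<le> sgn s * ((\<phi> p - \<phi> q) \<bullet> w)"
proof -
  let ?F = "cutoff_field \<beta> \<xi>"
  have lips: "norm (s *\<^sub>R ?F x - s *\<^sub>R ?F y) \<le> (\<bar>s\<bar> * L) * norm (x - y)" for x y
    using mult_left_mono[OF lip(1)[of x y] abs_ge_zero[of s]]
    by (simp add: scaleR_diff_right[symmetric] mult.assoc)
  obtain c where c: "c 0 = \<phi> q"
    "\<And>t. t \<in> {0..1} \<Longrightarrow> (c has_vector_derivative s *\<^sub>R ?F (c t)) (at t within {0..1})"
    using ode_solution_unit_interval[OF lips mult_nonneg_nonneg[OF abs_ge_zero lip(2)] lip(3)] by metis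
  have M': "norm (s *\<^sub>R ?F x) \<le> \<bar>s\<bar> * M" for x
    using mult_left_mono[OF M[of x] abs_ge_zero[of s]] by simp
  have M0: "0 \<le> M" using order_trans[OF norm_ge_zero M] .
  have cball: "c t \<in> ball x0 \<rho>1" if t: "t \<in> {0..1}" for t
  proof -
    have "norm (c t - c 0) \<le> (\<bar>s\<bar> * M) * (t - 0)"
      by (rule vector_derivative_increment_bound[OF c(2) M']) (use t in auto)
    also have "\<dots> \<le> \<bar>s\<bar> * M" using t M0 mult_left_mono[of t 1 "\<bar>s\<bar> * M"] by simp
    finally have "dist (\<phi> q) (c t) \<le> \<bar>s\<bar> * M" by (simp add: c(1) dist_norm norm_minus_commute)
    then show ?thesis using dist_triangle[of x0 "c t" "\<phi> q"] q(2) by simp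
  qed
  have sub: "ball x0 \<rho>1 \<subseteq> chart_image" using \<rho> q(3) by auto
  have cim: "c t \<in> chart_image" if "t \<in> {0..1}" for t using cball[OF that] sub by blast
  define \<gamma> where "\<gamma> = chart.\<psi> \<circ> c"
  have \<phi>\<gamma>: "\<phi> (\<gamma> t) = c t" if "t \<in> {0..1}" for t
    using cim[OF that] by (auto simp: \<gamma>_def)
  have \<gamma>UW: "\<gamma> t \<in> U \<inter> W" if "t \<in> {0..1}" for t
    using cim[OF that] by (auto simp: \<gamma>_def)
  have cc: "continuous_on {0..1} c"
    unfolding continuous_on_eq_continuous_within
    using has_vector_derivative_continuous[OF c(2)] by blast
  have cont: "continuous_on {0..1} \<gamma>"
    unfolding \<gamma>_def using cim
    by (intro continuous_on_compose cc continuous_on_subset[OF chart.chart_props(5)]) blast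
  have der: "((\<phi> \<circ> \<gamma>) has_vector_derivative s *\<^sub>R ?F (\<phi> (\<gamma> t))) (at t within {0..1})" if t: "t \<in> {0..1}" for t
    using has_vector_derivative_transform[OF t _ c(2)[OF t], of "\<phi> \<circ> \<gamma>"] \<phi>\<gamma> t by simp
  obtain \<sigma> where \<sigma>: "\<sigma> \<in> smooth_sections S"
    "\<And>p. p \<in> U \<inter> W \<Longrightarrow> \<sigma> p = lift p (\<beta> (\<phi> p) *\<^sub>R (s *\<^sub>R \<xi>))"
    using section_extension[OF \<rho> \<beta>(1,2)] by blast
  have vel: "curve_differentiable (atlas S) \<gamma> t" "velocity (atlas S) \<gamma> t = anchor S (\<sigma> (\<gamma> t))"
    if t: "t \<in> {0..1}" for t
  proof -
    have W: "\<gamma> t \<in> W" "\<gamma> t \<in> U" using \<gamma>UW[OF t] by auto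
    have "\<sigma> (\<gamma> t) \<in> fiber S (\<gamma> t)"
      using \<sigma>(2)[OF \<gamma>UW[OF t]] lift_in[OF W(1)] by simp
    then have tv: "anchor S (\<sigma> (\<gamma> t)) \<in> tangent_space (atlas S) (\<gamma> t)"
      by (rule anchor_props(1)[OF triv_point[OF W(1)]])
    have im: "\<phi> (\<gamma> t) \<in> chart_image" using W by blast
    have "coord_vec \<phi> (anchor S (\<sigma> (\<gamma> t))) = anchor_coords (\<phi> (\<gamma> t)) (\<beta> (\<phi> (\<gamma> t)) *\<^sub>R (s *\<^sub>R \<xi>))"
      using \<sigma>(2)[OF \<gamma>UW[OF t]] W by (simp add: anchor_coords_def)
    also have "\<dots> = s *\<^sub>R ?F (\<phi> (\<gamma> t))"
      unfolding linear_scale[OF linear_anchor_coords[OF im]] using im by (simp add: cutoff_field_def mult.commute)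
    finally have "((\<phi> \<circ> \<gamma>) has_vector_derivative coord_vec \<phi> (anchor S (\<sigma> (\<gamma> t)))) (at t within {0..1})"
      using der[OF t] by simp
    from chart.velocityI[OF cont t W(2) tv this]
    show "curve_differentiable (atlas S) \<gamma> t" "velocity (atlas S) \<gamma> t = anchor S (\<sigma> (\<gamma> t))" .
  qed
  have ac: "abs_continuous_on a b (\<theta> \<circ> \<gamma>)"
    if V: "(V, \<theta>) \<in> atlas S" and ab: "0 \<le> a" "a \<le> b" "b \<le> 1" and im: "\<gamma> ` {a..b} \<subseteq> V" for V \<theta> a b
  proof -
    interpret V: atlas_chart "atlas S" V \<theta> by unfold_locales (fact atlas_axiom, fact V)
    let ?h = "\<theta> \<circ> chart.\<psi>"
    let ?D = "\<lambda>x. frechet_derivative ?h (at x)"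
    \<comment> \<open>seen in another chart the curve is continuously differentiable, hence Lipschitz\<close>
    have sm: "smooth_on (\<phi> ` (U \<inter> V)) ?h" by (rule V.transition_smooth[OF chart.chart])
    have tin: "t \<in> {0..1}" if "t \<in> {a..b}" for t using that ab by auto
    have cV: "c t \<in> \<phi> ` (U \<inter> V)" if "t \<in> {a..b}" for t
    proof -
      have "\<gamma> t \<in> U \<inter> V" using im \<gamma>UW[OF tin[OF that]] that by blast
      then have "\<phi> (\<gamma> t) \<in> \<phi> ` (U \<inter> V)" by (rule imageI)
      then show ?thesis using \<phi>\<gamma>[OF tin[OF that]] by simp
    qed
    have hd: "((?h \<circ> c) has_vector_derivative ?D (c t) (s *\<^sub>R ?F (c t))) (at t within {a..b})"
      if t: "t \<in> {a..b}" for t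
    proof -
      note dh = smooth_on_has_derivative[OF sm cV[OF t]]
      have "(c has_vector_derivative s *\<^sub>R ?F (c t)) (at t within {a..b})"
        using has_vector_derivative_within_subset[OF c(2)[OF tin[OF t]]] ab by auto
      from has_derivative_compose[OF this[unfolded has_vector_derivative_def] dh]
      show ?thesis
        using linear_scale[OF has_derivative_linear[OF dh]]
        by (simp add: has_vector_derivative_def o_def)
    qed
    have cont_der: "continuous_on {a..b} (\<lambda>t. ?D (c t) (s *\<^sub>R ?F (c t)))"
    proof -
      have cab: "continuous_on {a..b} c" by (rule continuous_on_subset[OF cc]) (use ab in auto)
      have "continuous_on {a..b} (\<lambda>t. \<Sum>i\<in>Basis. ((s *\<^sub>R ?F (c t)) \<bullet> i) *\<^sub>R ?D (c t) i)"
        by (intro continuous_intros continuous_on_compose2[OF smooth_on_continuous[OF smooth_on_derivative[OF sm]] cab]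
            continuous_on_compose2[OF smooth_on_continuous[OF cutoff_field_smooth[OF \<rho> \<beta>(1,2)]] cab])
          (use cV in auto)
      then show ?thesis
        by (rule continuous_on_eq)
          (use linear_eq_sum_Basis[OF has_derivative_linear[OF smooth_on_has_derivative[OF sm cV]]] in metis)
    qed
    then have "bounded ((\<lambda>t. ?D (c t) (s *\<^sub>R ?F (c t))) ` {a..b})"
      by (intro compact_imp_bounded compact_continuous_image) auto
    then obtain C where C: "\<And>t. t \<in> {a..b} \<Longrightarrow> norm (?D (c t) (s *\<^sub>R ?F (c t))) \<le> C"
      unfolding bounded_iff by blast
    have "abs_continuous_on a b (?h \<circ> c)"
      by (rule abs_continuous_on_lipschitz, rule vector_derivative_increment_bound[OF hd C])
    then show ?thesis by (simp add: \<gamma>_def o_assoc)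
  qed
  have img: "\<gamma> ` {0..1} \<subseteq> chart_union (atlas S)"
    using \<gamma>UW chart.chart_props(6) by blast
  have hor: "horizontal_curve S \<gamma>"
    unfolding horizontal_curve_def abs_continuous_curve_def
  proof (intro conjI cont img)
    show "\<forall>(U, \<phi>)\<in>atlas S. \<forall>a b. 0 \<le> a \<and> a \<le> b \<and> b \<le> 1 \<and> \<gamma> ` {a..b} \<subseteq> U \<longrightarrow> abs_continuous_on a b (\<phi> \<circ> \<gamma>)"
      using ac by blast
    have "curve_differentiable (atlas S) \<gamma> t \<and> velocity (atlas S) \<gamma> t \<in> field_values (horizontal_fields S) (\<gamma> t)"
      if "t \<in> {0..1}" for t
    proof
      show "velocity (atlas S) \<gamma> t \<in> field_values (horizontal_fields S) (\<gamma> t)"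
        unfolding vel(2)[OF that] field_values_def horizontal_fields_def using \<sigma>(1)
        by (intro CollectI exI[of _ "anchor S \<circ> \<sigma>"]) auto
    qed (rule vel(1)[OF that])
    then show "AE t in lebesgue_on {0..1}. curve_differentiable (atlas S) \<gamma> t \<and>
        velocity (atlas S) \<gamma> t \<in> field_values (horizontal_fields S) (\<gamma> t)"
      by (intro AE_I2) simp
  qed
  have "sr_length S \<gamma> \<le> (\<integral>\<^sup>+ t. ennreal (\<bar>s\<bar> * B) \<partial>lebesgue_on {0..1::real})"
    unfolding sr_length_def
  proof (rule nn_integral_mono)
    fix t :: real assume "t \<in> space (lebesgue_on {0..1})"
    then have t: "t \<in> {0..1}" by simp
    have W: "\<gamma> t \<in> W" "\<gamma> t \<in> U" using \<gamma>UW[OF t] by auto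
    let ?\<xi> = "\<beta> (\<phi> (\<gamma> t)) *\<^sub>R (s *\<^sub>R \<xi>)"
    have \<sigma>t: "\<sigma> (\<gamma> t) = lift (\<gamma> t) ?\<xi>" by (rule \<sigma>(2)[OF \<gamma>UW[OF t]])
    have fib: "\<sigma> (\<gamma> t) \<in> fiber S (\<gamma> t)" unfolding \<sigma>t by (rule lift_in[OF W(1)])
    have "sr_norm_sq S (\<gamma> t) (velocity (atlas S) \<gamma> t) \<le> gram (\<gamma> t) ?\<xi> ?\<xi>"
      unfolding vel(2)[OF t]
      using min_norm[OF triv_point[OF W(1)] fib] \<sigma>t unfolding gram_def[OF W(1)] by metis
    also have "\<dots> = (\<beta> (\<phi> (\<gamma> t)))\<^sup>2 * (s\<^sup>2 * gram (\<gamma> t) \<xi> \<xi>)"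
      using bilinear_lmul[OF gram_bilinear[OF W(1)]] bilinear_rmul[OF gram_bilinear[OF W(1)]]
      by (simp add: power2_eq_square algebra_simps)
    also have "\<dots> \<le> 1 * (s\<^sup>2 * B\<^sup>2)"
    proof (rule mult_mono)
      show "(\<beta> (\<phi> (\<gamma> t)))\<^sup>2 \<le> 1" using \<beta>(3,4) by (simp add: power_le_one)
      have "gram (\<gamma> t) \<xi> \<xi> \<le> B\<^sup>2"
        using B(2)[OF cball[OF t]] by (simp add: \<gamma>_def)
      then show "s\<^sup>2 * gram (\<gamma> t) \<xi> \<xi> \<le> s\<^sup>2 * B\<^sup>2" by (rule mult_left_mono) simp
    qed (simp_all add: gram_nonneg[OF W(1)])
    finally have "sqrt (sr_norm_sq S (\<gamma> t) (velocity (atlas S) \<gamma> t)) \<le> sqrt ((\<bar>s\<bar> * B)\<^sup>2)"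
      by (simp add: power_mult_distrib)
    also have "\<dots> = \<bar>s\<bar> * B" using B(1) by simp
    finally show "ennreal (sqrt (sr_norm_sq S (\<gamma> t) (velocity (atlas S) \<gamma> t))) \<le> ennreal (\<bar>s\<bar> * B)"
      by (rule ennreal_leI)
  qed
  also have "\<dots> = ennreal (\<bar>s\<bar> * B)"
    by (simp add: emeasure_restrict_space)
  finally have len: "sr_length S \<gamma> \<le> ennreal (\<bar>s\<bar> * B)" .
  have "\<gamma> 0 = q" using q(1) by (simp add: \<gamma>_def c(1))
  have inner_der: "((\<lambda>t. (\<phi> \<circ> \<gamma>) t \<bullet> w) has_derivative (\<lambda>h. (h *\<^sub>R (s *\<^sub>R ?F (\<phi> (\<gamma> t)))) \<bullet> w)) (at t within {0..1})"
    if "0 \<le> t" "t \<le> 1" for t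
    by (rule has_derivative_inner_left[OF der[unfolded has_vector_derivative_def]]) (use that in simp)
  from mvt_simple[of 0 1 "\<lambda>t. (\<phi> \<circ> \<gamma>) t \<bullet> w", OF _ inner_der]
  obtain t where t: "t \<in> {0<..<1}"
    "(\<phi> \<circ> \<gamma>) 1 \<bullet> w - (\<phi> \<circ> \<gamma>) 0 \<bullet> w = s * (?F (\<phi> (\<gamma> t)) \<bullet> w)" by auto
  have "sgn s * ((\<phi> (\<gamma> 1) - \<phi> q) \<bullet> w) = \<bar>s\<bar> * (?F (\<phi> (\<gamma> t)) \<bullet> w)"
    using t(2) \<open>\<gamma> 0 = q\<close> by (simp add: inner_diff_left abs_sgn mult.assoc[symmetric] mult.commute)
  moreover have "m \<le> ?F (\<phi> (\<gamma> t)) \<bullet> w" using m[OF cball[of t]] \<phi>\<gamma>[of t] t(1) by simp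
  ultimately have inc: "\<bar>s\<bar> * m \<le> sgn s * ((\<phi> (\<gamma> 1) - \<phi> q) \<bullet> w)"
    by (simp add: mult_left_mono)
  have "sr_dist S q (\<gamma> 1) \<le> sr_length S \<gamma>"
    unfolding sr_dist_def by (rule INF_lower) (use hor \<open>\<gamma> 0 = q\<close> in simp)
  then have "sr_dist S q (\<gamma> 1) \<le> ennreal (\<bar>s\<bar> * B)" using len order_trans by blast
  moreover have "\<gamma> 1 \<in> W" "\<gamma> 1 \<in> U" "\<phi> (\<gamma> 1) \<in> ball x0 \<rho>1"
    using \<gamma>UW[of 1] cball[of 1] \<phi>\<gamma>[of 1] by auto
  ultimately show thesis using that[of "\<gamma> 1"] triv_subset inc by blast
qed

section \<open>Calibration and the lower bound\<close>

text \<open>The covector \<open>w\<close> is scaled so that the function \<open>\<phi> \<bullet> w\<close> has a horizontal gradient of norm \<open>1\<close> at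
  \<open>q\<close>, and \<open>\<xi>0\<close> is the unit vector in the direction of this gradient. It is obtained as a maximiser of the
  quotient of the functional by the norm, starting from the functional \<open>l\<close>, which does not vanish because
  the anchor at \<open>q\<close> is nonzero.\<close>

lemma calibrating_covector:
  assumes q: "q \<in> U \<inter> W"
  obtains w \<xi>0 where "anchor_coords (\<phi> q) \<xi>0 \<bullet> w = 1" "gram q \<xi>0 \<xi>0 = 1"
    "\<And>\<xi>. \<bar>anchor_coords (\<phi> q) \<xi> \<bullet> w\<bar> \<le> sqrt (gram q \<xi> \<xi>)"
proof -
  have W: "q \<in> W" "q \<in> U" using q by auto
  have im: "\<phi> q \<in> chart_image" using q by blast
  note lin = linear_anchor_coords[OF im]
  obtain u where u: "u \<in> fiber S q" "anchor S u \<noteq> (\<lambda>h. 0)"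
    using anchor_nonzero[OF triv_point[OF W(1)]] by blast
  define \<xi>1 where "\<xi>1 = \<tau> u"
  have a1: "anchor_coords (\<phi> q) \<xi>1 \<noteq> 0"
  proof
    assume "anchor_coords (\<phi> q) \<xi>1 = 0"
    then have z: "coord_vec \<phi> (anchor S u) = coord_vec \<phi> (\<lambda>h. 0)"
      using W u(1) by (simp add: anchor_coords_def \<xi>1_def lift_tau coord_vec_def)
    have "(\<lambda>h. 0) \<in> tangent_space (atlas S) q" by (simp add: tangent_space_def)
    from chart.tangent_space_eqI[OF anchor_props(1)[OF triv_point[OF W(1)] u(1)] this W(2) z]
    show False using u(2) by simp
  qed
  define l where "l \<xi> = anchor_coords (\<phi> q) \<xi> \<bullet> anchor_coords (\<phi> q) \<xi>1" for \<xi>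
  have linl: "linear l"
    unfolding l_def by (intro linear_compose[OF lin, unfolded o_def] bounded_linear.linear bounded_linear_inner_left)
  have gs: "gram q (c *\<^sub>R \<xi>) (c *\<^sub>R \<xi>) = c\<^sup>2 * gram q \<xi> \<xi>" for c \<xi>
    using bilinear_lmul[OF gram_bilinear[OF W(1)]] bilinear_rmul[OF gram_bilinear[OF W(1)]]
    by (simp add: power2_eq_square)
  \<comment> \<open>homogeneous of degree 0, so a maximum on the Euclidean sphere is a maximum everywhere\<close>
  define f where "f \<xi> = l \<xi> / sqrt (gram q \<xi> \<xi>)" for \<xi>
  have fs: "f (c *\<^sub>R \<xi>) = f \<xi>" if "c > 0" for c \<xi>
    using that by (simp add: f_def gs real_sqrt_mult linear_scale[OF linl])
  have gp: "0 < gram q \<xi> \<xi>" if "\<xi> \<in> sphere 0 1" for \<xi> using that by (intro gram_pos[OF W(1)]) auto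
  have "continuous_on (sphere 0 1) f"
    unfolding f_def
    by (intro continuous_intros continuous_gram[OF W(1)] linear_continuous_on
        linear_conv_bounded_linear[THEN iffD1] linl) (use gp in force)
  moreover have "\<xi>1 \<noteq> 0" using a1 linear_0[OF lin] by auto
  then have s1: "(1 / norm \<xi>1) *\<^sub>R \<xi>1 \<in> sphere 0 1" by simp
  ultimately obtain \<xi>m where m: "\<xi>m \<in> sphere 0 1" "\<And>\<xi>. \<xi> \<in> sphere 0 1 \<Longrightarrow> f \<xi> \<le> f \<xi>m"
    using continuous_attains_sup[OF compact_sphere, of 0 1 f] by blast
  have max: "f \<xi> \<le> f \<xi>m" if "\<xi> \<noteq> 0" for \<xi>
    using m(2)[of "(1 / norm \<xi>) *\<^sub>R \<xi>"] fs[of "1 / norm \<xi>" \<xi>] that by simp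
  have "0 < f \<xi>1"
    using a1 \<open>\<xi>1 \<noteq> 0\<close> gram_pos[OF W(1)] by (simp add: f_def l_def)
  then have c: "0 < f \<xi>m" using max[OF \<open>\<xi>1 \<noteq> 0\<close>] by linarith
  have le: "l \<xi> \<le> f \<xi>m * sqrt (gram q \<xi> \<xi>)" for \<xi>
  proof (cases "\<xi> = 0")
    case True
    then show ?thesis using linear_0[OF linl] gram_nonneg[OF W(1)] c by simp
  next
    case False
    then show ?thesis using max[OF False] gram_pos[OF W(1) False] by (simp add: f_def pos_divide_le_eq)
  qed
  have abs: "\<bar>l \<xi>\<bar> \<le> f \<xi>m * sqrt (gram q \<xi> \<xi>)" for \<xi>
    using le[of \<xi>] le[of "- \<xi>"] gs[of "-1" \<xi>] linear_neg[OF linl] by (simp add: abs_le_iff)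
  let ?g = "sqrt (gram q \<xi>m \<xi>m)"
  have g: "?g > 0" using gp[OF m(1)] by simp
  show thesis
  proof (rule that[of "(1 / ?g) *\<^sub>R \<xi>m" "(1 / f \<xi>m) *\<^sub>R anchor_coords (\<phi> q) \<xi>1"])
    have "l ((1 / ?g) *\<^sub>R \<xi>m) = f \<xi>m" by (simp add: linear_scale[OF linl] f_def)
    then show "anchor_coords (\<phi> q) ((1 / ?g) *\<^sub>R \<xi>m) \<bullet> ((1 / f \<xi>m) *\<^sub>R anchor_coords (\<phi> q) \<xi>1) = 1"
      using c by (simp add: l_def)
    show "gram q ((1 / ?g) *\<^sub>R \<xi>m) ((1 / ?g) *\<^sub>R \<xi>m) = 1"
      unfolding gs using gp[OF m(1)] by (simp add: power_divide)
    show "\<bar>anchor_coords (\<phi> q) \<xi> \<bullet> ((1 / f \<xi>m) *\<^sub>R anchor_coords (\<phi> q) \<xi>1)\<bar> \<le> sqrt (gram q \<xi> \<xi>)" for \<xi>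
      using abs[of \<xi>] c by (simp add: l_def abs_mult pos_divide_le_eq mult.commute)
  qed
qed

text \<open>The strict inequality holds on the compact product of \<open>x0\<close> with the unit sphere, hence, by the
  tube lemma, for all \<open>x\<close> near \<open>x0\<close> and all unit vectors; homogeneity does the rest.\<close>

lemma near_quadratic_bound:
  assumes Q: "continuous_on (chart_image \<times> UNIV) (\<lambda>z. Q (fst z) (snd z))"
    and hom: "\<And>x c \<xi>. x \<in> chart_image \<Longrightarrow> Q x (c *\<^sub>R \<xi>) = c\<^sup>2 * Q x \<xi>"
    and x0: "x0 \<in> chart_image" and strict: "\<And>\<xi>. \<xi> \<noteq> 0 \<Longrightarrow> Q x0 \<xi> < gram (chart.\<psi> x0) \<xi> \<xi>"
  shows "\<exists>\<rho>>0. ball x0 \<rho> \<subseteq> chart_image \<and> (\<forall>x\<in>ball x0 \<rho>. \<forall>\<xi>. Q x \<xi> \<le> gram (chart.\<psi> x) \<xi> \<xi>)"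
proof -
  let ?f = "\<lambda>z. gram (chart.\<psi> (fst z)) (snd z) (snd z) - Q (fst z) (snd z)"
  let ?O = "(chart_image \<times> UNIV) \<inter> ?f -` {0<..}"
  have "continuous_on (chart_image \<times> UNIV) ?f" by (intro continuous_on_diff gram_continuous Q)
  then have op: "open ?O"
    by (intro continuous_open_preimage open_Times open_chart_overlap) auto
  have "{x0} \<times> sphere 0 1 \<subseteq> ?O"
  proof (rule subrelI)
    fix x and \<xi> :: 'u assume "(x, \<xi>) \<in> {x0} \<times> sphere 0 1"
    then have "x = x0" "\<xi> \<noteq> 0" by auto
    with strict[of \<xi>] x0 show "(x, \<xi>) \<in> ?O" by simp
  qed
  from Elementary_Topology.tube_lemma[OF compact_sphere op this]
  obtain X where X: "x0 \<in> X" "open X" "X \<times> sphere 0 1 \<subseteq> ?O" by blast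
  obtain \<rho> where \<rho>: "\<rho> > 0" "ball x0 \<rho> \<subseteq> X \<inter> chart_image"
    using openE[OF open_Int[OF X(2) open_chart_overlap], of x0] X(1) x0 by blast
  have "Q x \<xi> \<le> gram (chart.\<psi> x) \<xi> \<xi>" if x: "x \<in> ball x0 \<rho>" for x \<xi>
  proof (cases "\<xi> = 0")
    case True
    have xi: "x \<in> chart_image" using x \<rho>(2) by blast
    then have "chart.\<psi> x \<in> W" by auto
    from gram_nonneg[OF this, of 0] show ?thesis using hom[OF xi, of 0 0] True by simp
  next
    case False
    have xi: "x \<in> chart_image" "x \<in> X" using x \<rho>(2) by auto
    then have W: "chart.\<psi> x \<in> W" by auto
    let ?e = "(1 / norm \<xi>) *\<^sub>R \<xi>"
    have "(x, ?e) \<in> ?O" by (rule subsetD[OF X(3)]) (use xi False in auto)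
    then have lt: "Q x ?e < gram (chart.\<psi> x) ?e ?e" by simp
    have "\<xi> = norm \<xi> *\<^sub>R ?e" using False by simp
    then have "Q x \<xi> = (norm \<xi>)\<^sup>2 * Q x ?e" "gram (chart.\<psi> x) \<xi> \<xi> = (norm \<xi>)\<^sup>2 * gram (chart.\<psi> x) ?e ?e"
      using hom[OF xi(1), of "norm \<xi>" ?e]
        bilinear_lmul[OF gram_bilinear[OF W], of "norm \<xi>" ?e] bilinear_rmul[OF gram_bilinear[OF W], of _ "norm \<xi>" ?e]
      by (simp_all add: power2_eq_square)
    then show ?thesis using lt by (simp add: mult_left_mono)
  qed
  with \<rho> show ?thesis by auto
qed

text \<open>Two instances of the previous lemma. At \<open>q0\<close> the inequalities are strict: the first because of the
  factor \<open>1 + \<delta>\<close>, the second by the choice of \<open>K\<close>.\<close>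

lemma near_bounds:
  assumes q0: "q0 \<in> U \<inter> W" and \<delta>: "0 < \<delta>"
    and w: "\<And>\<xi>. \<bar>anchor_coords (\<phi> q0) \<xi> \<bullet> w\<bar> \<le> sqrt (gram q0 \<xi> \<xi>)"
  obtains \<rho> K where "0 < \<rho>" "0 < K" "ball (\<phi> q0) \<rho> \<subseteq> chart_image"
    "\<And>x \<xi>. x \<in> ball (\<phi> q0) \<rho> \<Longrightarrow> \<bar>anchor_coords x \<xi> \<bullet> w\<bar> \<le> (1 + \<delta>) * sqrt (gram (chart.\<psi> x) \<xi> \<xi>)"
    "\<And>x \<xi>. x \<in> ball (\<phi> q0) \<rho> \<Longrightarrow> norm (anchor_coords x \<xi>) \<le> K * sqrt (gram (chart.\<psi> x) \<xi> \<xi>)"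
proof -
  let ?x = "\<phi> q0"
  have x: "?x \<in> chart_image" "chart.\<psi> ?x = q0" "q0 \<in> W" using q0 by auto
  note lin = linear_anchor_coords
  have cont: "continuous_on (chart_image \<times> UNIV) (\<lambda>z. anchor_coords (fst z) (snd z))"
    by (rule smooth_on_continuous[OF anchor_coords_smooth])
  have sqrt_bound: "a \<le> k * sqrt g" if "0 < k" "0 \<le> a" "(a / k)\<^sup>2 \<le> g" for a k g :: real
    using real_le_rsqrt[OF that(3)] that(1) by (simp add: pos_divide_le_eq mult.commute)
  have "\<exists>\<rho>>0. ball ?x \<rho> \<subseteq> chart_image \<and> (\<forall>x\<in>ball ?x \<rho>. \<forall>\<xi>. (\<bar>anchor_coords x \<xi> \<bullet> w\<bar> / (1 + \<delta>))\<^sup>2 \<le> gram (chart.\<psi> x) \<xi> \<xi>)"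
  proof (rule near_quadratic_bound[OF _ _ x(1)])
    show "continuous_on (chart_image \<times> UNIV) (\<lambda>z. (\<bar>anchor_coords (fst z) (snd z) \<bullet> w\<bar> / (1 + \<delta>))\<^sup>2)"
      by (intro continuous_intros cont) (use \<delta> in auto)
    show "(\<bar>anchor_coords x (c *\<^sub>R \<xi>) \<bullet> w\<bar> / (1 + \<delta>))\<^sup>2 = c\<^sup>2 * (\<bar>anchor_coords x \<xi> \<bullet> w\<bar> / (1 + \<delta>))\<^sup>2"
      if "x \<in> chart_image" for x c \<xi>
      by (simp add: linear_scale[OF lin[OF that]] power_mult_distrib power_divide)
    fix \<xi> :: 'u assume \<xi>: "\<xi> \<noteq> 0"
    have g: "0 < gram q0 \<xi> \<xi>" by (rule gram_pos[OF x(3) \<xi>])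
    have "(\<bar>anchor_coords ?x \<xi> \<bullet> w\<bar>)\<^sup>2 \<le> gram q0 \<xi> \<xi>"
      using power_mono[OF w[of \<xi>] abs_ge_zero, of 2] g by simp
    also have "\<dots> < gram q0 \<xi> \<xi> * (1 + \<delta>)\<^sup>2"
      using g \<delta> by (simp add: one_less_power)
    finally show "(\<bar>anchor_coords ?x \<xi> \<bullet> w\<bar> / (1 + \<delta>))\<^sup>2 < gram (chart.\<psi> ?x) \<xi> \<xi>"
      unfolding x(2) using \<delta> by (simp add: power_divide pos_divide_less_eq)
  qed
  then obtain \<rho>1 where 1: "\<rho>1 > 0" "ball ?x \<rho>1 \<subseteq> chart_image"
    "\<And>x \<xi>. x \<in> ball ?x \<rho>1 \<Longrightarrow> (\<bar>anchor_coords x \<xi> \<bullet> w\<bar> / (1 + \<delta>))\<^sup>2 \<le> gram (chart.\<psi> x) \<xi> \<xi>"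
    by blast
  obtain c where c: "c > 0" "\<And>\<xi>. c * (norm \<xi>)\<^sup>2 \<le> gram q0 \<xi> \<xi>" using gram_coercive[OF x(3)] by blast
  obtain B where B: "B > 0" "\<And>\<xi>. norm (anchor_coords ?x \<xi>) \<le> B * norm \<xi>"
    using linear_bounded_pos[OF lin[OF x(1)]] by blast
  \<comment> \<open>from the operator norm B of the anchor and the coercivity constant c of the scalar product\<close>
  define K where "K = (B + 1) / sqrt c"
  have K: "K > 0" "(B + 1)\<^sup>2 = K\<^sup>2 * c" using B(1) c(1) by (auto simp: K_def power_divide)
  \<comment> \<open>the second bound, with strictness at q0 from the summand 1 in K\<close>
  have "\<exists>\<rho>>0. ball ?x \<rho> \<subseteq> chart_image \<and> (\<forall>x\<in>ball ?x \<rho>. \<forall>\<xi>. (norm (anchor_coords x \<xi>) / K)\<^sup>2 \<le> gram (chart.\<psi> x) \<xi> \<xi>)"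
  proof (rule near_quadratic_bound[OF _ _ x(1)])
    show "continuous_on (chart_image \<times> UNIV) (\<lambda>z. (norm (anchor_coords (fst z) (snd z)) / K)\<^sup>2)"
      by (intro continuous_intros cont) (use K in auto)
    show "(norm (anchor_coords x (c *\<^sub>R \<xi>)) / K)\<^sup>2 = c\<^sup>2 * (norm (anchor_coords x \<xi>) / K)\<^sup>2"
      if "x \<in> chart_image" for x c \<xi>
      by (simp add: linear_scale[OF lin[OF that]] power_mult_distrib power_divide)
    fix \<xi> :: 'u assume \<xi>: "\<xi> \<noteq> 0"
    have "norm (anchor_coords ?x \<xi>) < (B + 1) * norm \<xi>" 
      using B(2)[of \<xi>] zero_less_norm_iff[THEN iffD2, OF \<xi>] unfolding distrib_right by linarith
    then have "(norm (anchor_coords ?x \<xi>))\<^sup>2 < ((B + 1) * norm \<xi>)\<^sup>2"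
      by (intro power_strict_mono) auto
    also have "\<dots> = K\<^sup>2 * (c * (norm \<xi>)\<^sup>2)" by (simp add: power_mult_distrib K(2))
    also have "\<dots> \<le> K\<^sup>2 * gram q0 \<xi> \<xi>" by (intro mult_left_mono c(2)) simp
    finally show "(norm (anchor_coords ?x \<xi>) / K)\<^sup>2 < gram (chart.\<psi> ?x) \<xi> \<xi>"
      unfolding x(2) using K(1) by (simp add: power_divide pos_divide_less_eq mult.commute)
  qed
  then obtain \<rho>2 where 2: "\<rho>2 > 0" "ball ?x \<rho>2 \<subseteq> chart_image"
    "\<And>x \<xi>. x \<in> ball ?x \<rho>2 \<Longrightarrow> (norm (anchor_coords x \<xi>) / K)\<^sup>2 \<le> gram (chart.\<psi> x) \<xi> \<xi>"
    by blast
  show thesis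
  proof (rule that[of "min \<rho>1 \<rho>2" K])
    fix x \<xi> assume x: "x \<in> ball ?x (min \<rho>1 \<rho>2)"
    show "\<bar>anchor_coords x \<xi> \<bullet> w\<bar> \<le> (1 + \<delta>) * sqrt (gram (chart.\<psi> x) \<xi> \<xi>)"
      using 1(3)[of x \<xi>] x \<delta> by (intro sqrt_bound) auto
    show "norm (anchor_coords x \<xi>) \<le> K * sqrt (gram (chart.\<psi> x) \<xi> \<xi>)"
      using 2(3)[of x \<xi>] x K by (intro sqrt_bound) auto
  qed (use 1 2 K in auto)
qed

text \<open>A curve from \<open>p\<close> to \<open>p'\<close> either stays in the coordinate ball, where \<open>\<phi> \<bullet> w\<close> is Lipschitz with
  constant \<open>1 + \<delta>\<close>, or leaves it, and then it has to cross half of its radius.\<close>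

lemma sr_dist_lower_bound:
  assumes \<rho>: "cball x0 \<rho> \<subseteq> chart_image" and K: "0 < K" and \<delta>: "0 < \<delta>"
    and bw: "\<And>x \<xi>. x \<in> cball x0 \<rho> \<Longrightarrow> \<bar>anchor_coords x \<xi> \<bullet> w\<bar> \<le> (1 + \<delta>) * sqrt (gram (chart.\<psi> x) \<xi> \<xi>)"
    and bK: "\<And>x \<xi>. x \<in> cball x0 \<rho> \<Longrightarrow> norm (anchor_coords x \<xi>) \<le> K * sqrt (gram (chart.\<psi> x) \<xi> \<xi>)"
    and p: "p \<in> U" "\<phi> p \<in> ball x0 (\<rho> / 2)"
    and D: "D * (1 + \<delta>) \<le> \<bar>(\<phi> p' - \<phi> p) \<bullet> w\<bar>" "D \<le> \<rho> / (2 * K)"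
  shows "ennreal D \<le> sr_dist S p p'"
  unfolding sr_dist_def
proof (rule INF_greatest)
  fix \<gamma> assume "\<gamma> \<in> {\<gamma>. horizontal_curve S \<gamma> \<and> \<gamma> 0 = p \<and> \<gamma> 1 = p'}"
  then have \<gamma>: "horizontal_curve S \<gamma>" "\<gamma> 0 = p" "\<gamma> 1 = p'" by auto
  have "dist x0 (\<phi> p) < \<rho> / 2" using p(2) by simp
  then have \<rho>0: "\<rho> > 0" using zero_le_dist[of x0 "\<phi> p"] by linarith
  show "ennreal D \<le> sr_length S \<gamma>"
  proof (cases "\<gamma> ` {0..1} \<subseteq> U \<inter> \<phi> -` ball x0 \<rho>")
    case False
    have "ennreal ((\<rho> - dist x0 (\<phi> (\<gamma> 0))) / K) \<le> sr_length S \<gamma>"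
      by (rule length_ge_of_exit[OF \<rho> K bK \<gamma>(1) _ _ False]) (use \<gamma>(2) p \<rho>0 in auto)
    moreover have "D \<le> (\<rho> - dist x0 (\<phi> (\<gamma> 0))) / K"
    proof -
      have "\<rho> / 2 / K \<le> (\<rho> - dist x0 (\<phi> (\<gamma> 0))) / K"
        using p(2) K \<gamma>(2) by (intro divide_right_mono) auto
      then show ?thesis using D(2) by (simp add: mult.commute)
    qed
    ultimately show ?thesis using ennreal_leI order_trans by blast
  next
    case True
    let ?w = "(1 / (1 + \<delta>)) *\<^sub>R w"
    have "ennreal \<bar>(\<phi> (\<gamma> 1) - \<phi> (\<gamma> 0)) \<bullet> ?w\<bar> \<le> sr_length S \<gamma>"
    proof (rule coord_increment_le_length[OF \<gamma>(1)])
      fix t :: real assume t: "t \<in> {0..1}"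
      have "\<gamma> t \<in> U \<inter> \<phi> -` ball x0 \<rho>" by (rule subsetD[OF True imageI[OF t]])
      then have tU: "\<gamma> t \<in> U" "\<phi> (\<gamma> t) \<in> cball x0 \<rho>" by auto
      then obtain q where "q \<in> U \<inter> W" "\<phi> (\<gamma> t) = \<phi> q" using \<rho> by blast
      then have "\<gamma> t = q" using inj_onD[OF chart.chart_props(2)] tU(1) by blast
      then show "\<gamma> t \<in> U \<inter> W" using \<open>q \<in> U \<inter> W\<close> by simp
      fix \<xi>
      have "\<bar>anchor_coords (\<phi> (\<gamma> t)) \<xi> \<bullet> w\<bar> \<le> (1 + \<delta>) * sqrt (gram (\<gamma> t) \<xi> \<xi>)"
        using bw[OF tU(2), of \<xi>] tU(1) by simp
      then show "\<bar>anchor_coords (\<phi> (\<gamma> t)) \<xi> \<bullet> ?w\<bar> \<le> sqrt (gram (\<gamma> t) \<xi> \<xi>)"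
        using \<delta> by (simp add: abs_mult pos_divide_le_eq mult.commute)
    qed auto
    moreover have "D \<le> \<bar>(\<phi> (\<gamma> 1) - \<phi> (\<gamma> 0)) \<bullet> ?w\<bar>"
      using D(1) \<delta> \<gamma>(2,3) by (simp add: abs_mult pos_le_divide_eq)
    ultimately show ?thesis using ennreal_leI order_trans by blast
  qed
qed

text \<open>The heart of the proof. The points \<open>p\<close> and \<open>p'\<close> are reached from \<open>q\<close> by flowing in opposite
  directions along a field which is at \<open>q0\<close> the horizontal gradient of \<open>\<phi> \<bullet> w\<close>. Near \<open>q0\<close> the field has
  norm at most \<open>1 + \<delta>\<close>, the function grows along it with speed at least \<open>1 - \<delta>\<close>, and it is Lipschitz with
  constant \<open>1 + \<delta>\<close>. None of this depends on the centre \<open>q\<close>, which is why a single radius works for all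
  centres near \<open>q0\<close>.\<close>

lemma local_diam_lower_bound:
  assumes q0: "q0 \<in> U \<inter> W" and \<epsilon>: "0 < \<epsilon>" "\<epsilon> < 1"
  obtains V r0 where "open V" "q0 \<in> V" "0 < r0"
    "\<And>q r. q \<in> V \<Longrightarrow> 0 < r \<Longrightarrow> r < r0 \<Longrightarrow> ennreal (2 * r * (1 - \<epsilon>)) \<le> sr_diam S (sr_ball S q r)"
proof -
  \<comment> \<open>two factors (1 - \<delta>) / (1 + \<delta>) are lost below, and their product is at least 1 - 4 \<delta>\<close>
  define \<delta> where "\<delta> = \<epsilon> / 4"
  have \<delta>: "0 < \<delta>" "\<delta> < 1" using \<epsilon> by (auto simp: \<delta>_def)
  let ?x = "\<phi> q0"
  have x: "?x \<in> chart_image" "chart.\<psi> ?x = q0" using q0 by auto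
  obtain w \<xi>0 where w: "anchor_coords ?x \<xi>0 \<bullet> w = 1" "gram q0 \<xi>0 \<xi>0 = 1"
    "\<And>\<xi>. \<bar>anchor_coords ?x \<xi> \<bullet> w\<bar> \<le> sqrt (gram q0 \<xi> \<xi>)"
    using calibrating_covector[OF q0] by metis
  obtain \<rho>a K where a: "0 < \<rho>a" "0 < K" "ball ?x \<rho>a \<subseteq> chart_image"
    "\<And>x \<xi>. x \<in> ball ?x \<rho>a \<Longrightarrow> \<bar>anchor_coords x \<xi> \<bullet> w\<bar> \<le> (1 + \<delta>) * sqrt (gram (chart.\<psi> x) \<xi> \<xi>)"
    "\<And>x \<xi>. x \<in> ball ?x \<rho>a \<Longrightarrow> norm (anchor_coords x \<xi>) \<le> K * sqrt (gram (chart.\<psi> x) \<xi> \<xi>)"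
    using near_bounds[OF q0 \<delta>(1) w(3)] by metis
  define \<rho> where "\<rho> = \<rho>a / 2"
  have \<rho>: "0 < \<rho>" "cball ?x \<rho> \<subseteq> ball ?x \<rho>a" "cball ?x \<rho> \<subseteq> chart_image"
    using a(1,3) by (auto simp: \<rho>_def)
  obtain \<beta> :: "'e \<Rightarrow> real" where \<beta>: "smooth_on UNIV \<beta>" "\<beta> ?x = 1" "\<And>x. 0 \<le> \<beta> x" "\<And>x. \<beta> x \<le> 1"
    "\<And>x. x \<notin> ball ?x \<rho> \<Longrightarrow> \<beta> x = 0"
    using smooth_bump[OF \<rho>(1), of ?x] by metis
  let ?F = "cutoff_field \<beta> \<xi>0"
  note F_smooth = cutoff_field_smooth[OF \<rho>(3) \<beta>(1,5)]
  have F0: "?F x = 0" if "x \<notin> cball ?x \<rho>" for x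
    using \<beta>(5)[of x] that by (auto simp: cutoff_field_def)
  obtain L M where LM: "0 \<le> L" "0 < M" "\<And>x y. norm (?F x - ?F y) \<le> L * norm (x - y)" "\<And>x. norm (?F x) \<le> M"
    using smooth_compact_support_bounds[OF F_smooth F0] by metis
  have "\<forall>\<^sub>F x in nhds ?x. gram (chart.\<psi> x) \<xi>0 \<xi>0 < (1 + \<delta>)\<^sup>2"
  proof -
    have "isCont (\<lambda>x. gram (chart.\<psi> x) \<xi>0 \<xi>0) ?x"
      using smooth_on_continuous[OF gram_smooth] x(1)
      by (rule continuous_on_eq_continuous_at[OF open_chart_overlap, THEN iffD1, THEN bspec])
    from iffD1[OF tendsto_at_iff_tendsto_nhds this[unfolded isCont_def]]
    have "((\<lambda>x. gram (chart.\<psi> x) \<xi>0 \<xi>0) \<longlongrightarrow> 1) (nhds ?x)"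
      unfolding x(2) w(2) .
    moreover have "(1::real) < (1 + \<delta>)\<^sup>2" using \<delta>(1) by (intro one_less_power) auto
    ultimately show ?thesis by (rule order_tendstoD(2))
  qed
  moreover have "\<forall>\<^sub>F x in nhds ?x. 1 - \<delta> < ?F x \<bullet> w"
  proof -
    have "isCont (\<lambda>x. ?F x \<bullet> w) ?x"
      using smooth_on_continuous[OF F_smooth]
      by (intro continuous_intros) (simp add: continuous_on_eq_continuous_at)
    note t = iffD1[OF tendsto_at_iff_tendsto_nhds this[unfolded isCont_def]]
    have "?F ?x \<bullet> w = 1" using w(1) x(1) \<beta>(2) by (simp add: cutoff_field_def)
    with t have "((\<lambda>x. ?F x \<bullet> w) \<longlongrightarrow> 1) (nhds ?x)" by simp
    then show ?thesis using \<delta>(1) by (intro order_tendstoD(1)) auto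
  qed
  ultimately have "\<forall>\<^sub>F x in nhds ?x. gram (chart.\<psi> x) \<xi>0 \<xi>0 < (1 + \<delta>)\<^sup>2 \<and> 1 - \<delta> < ?F x \<bullet> w"
    by (rule eventually_conj)
  then obtain \<rho>b where b: "0 < \<rho>b" "\<And>x. x \<in> ball ?x \<rho>b \<Longrightarrow> gram (chart.\<psi> x) \<xi>0 \<xi>0 < (1 + \<delta>)\<^sup>2"
    "\<And>x. x \<in> ball ?x \<rho>b \<Longrightarrow> 1 - \<delta> < ?F x \<bullet> w"
    unfolding eventually_nhds_metric by (auto simp: dist_commute)
  define \<rho>1 where "\<rho>1 = min \<rho> \<rho>b"
  have \<rho>1: "0 < \<rho>1" "\<rho>1 \<le> \<rho>" "\<rho>1 \<le> \<rho>b" using \<rho>(1) b(1) by (auto simp: \<rho>1_def)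
  have sub: "cball ?x \<rho>1 \<subseteq> cball ?x \<rho>" using \<rho>1 by auto
  define V where "V = U \<inter> \<phi> -` ball ?x (\<rho>1 / 4) \<inter> W"
  \<comment> \<open>so that the Picard iteration contracts, the flow stays in the half ball, and leaving the ball costs at least 2 r\<close>
  define r0 where "r0 = min (1 / (L + 1)) (min (\<rho>1 / (4 * M)) (\<rho>1 / (4 * K)))"
  have r0: "0 < r0" using LM \<rho>1 a(2) by (simp add: r0_def)
  show thesis
  proof (rule that[of V r0])
    show "open V" unfolding V_def
      by (intro open_Int chart.open_chart_preimage open_triv) simp
    show "q0 \<in> V" using q0 \<rho>1 by (simp add: V_def)
    fix q r assume q: "q \<in> V" and r: "0 < r" "r < r0"
    \<comment> \<open>the flow for time s has length at most s (1 + \<delta>), which has to be smaller than r\<close>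
    define s where "s = r * ((1 - \<delta>) / (1 + \<delta>))"
    have frac: "0 < (1 - \<delta>) / (1 + \<delta>)" "(1 - \<delta>) / (1 + \<delta>) < 1" using \<delta> by auto
    have s: "0 < s" "s < r" using mult_strict_left_mono[OF frac(2) r(1)] mult_pos_pos[OF r(1) frac(1)]
      by (auto simp: s_def)
    have sL: "\<bar>s\<bar> * L < 1"
    proof -
      have "s * L \<le> s * (L + 1)" using s by (intro mult_left_mono) auto
      also have "\<dots> < (1 / (L + 1)) * (L + 1)"
        using s r LM(1) by (intro mult_strict_right_mono) (auto simp: r0_def)
      finally show ?thesis using s LM(1) by simp
    qed
    have sM: "\<bar>s\<bar> * M < \<rho>1 / 4"
    proof -
      have "s < \<rho>1 / (4 * M)" using s r by (auto simp: r0_def)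
      then show ?thesis using s LM(2) by (simp add: pos_less_divide_eq mult.commute mult.left_commute)
    qed
    have rK: "2 * r \<le> \<rho>1 / (2 * K)"
    proof -
      have "r \<le> \<rho>1 / (4 * K)" using r by (auto simp: r0_def)
      then show ?thesis using a(2) by (simp add: field_simps)
    qed
    have qUW: "q \<in> U \<inter> W" "dist ?x (\<phi> q) < \<rho>1 / 4" using q by (auto simp: V_def)
    have Bd: "gram (chart.\<psi> x) \<xi>0 \<xi>0 \<le> (1 + \<delta>)\<^sup>2" "1 - \<delta> \<le> ?F x \<bullet> w"
      if "x \<in> ball ?x (\<rho>1 / 2)" for x
      using b(2,3)[of x] that \<rho>1 by auto
    note flow = flow_point[OF \<rho>(3) \<beta>(1,5,3,4) LM(3,1) _ LM(4) qUW(1) _ _ _ Bd(1) Bd(2)]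
    obtain p where p: "p \<in> points S" "p \<in> U" "\<phi> p \<in> ball ?x (\<rho>1 / 2)"
      "sr_dist S q p \<le> ennreal (s * (1 + \<delta>))" "s * (1 - \<delta>) \<le> (\<phi> p - \<phi> q) \<bullet> w"
      by (rule flow[of s "\<rho>1 / 2"]) (use s sL sM qUW(2) \<rho>1 \<delta> in auto)
    obtain p' where p': "p' \<in> points S" "p' \<in> U" "\<phi> p' \<in> ball ?x (\<rho>1 / 2)"
      "sr_dist S q p' \<le> ennreal (s * (1 + \<delta>))" "s * (1 - \<delta>) \<le> - ((\<phi> p' - \<phi> q) \<bullet> w)"
      by (rule flow[of "- s" "\<rho>1 / 2"]) (use s sL sM qUW(2) \<rho>1 \<delta> in auto)
    have "s * (1 + \<delta>) = r * (1 - \<delta>)" using \<delta> by (simp add: s_def)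
    also have "\<dots> < r" using r \<delta> by simp
    finally have lt: "ennreal (s * (1 + \<delta>)) < ennreal r" using r by (simp add: ennreal_lessI)
    have in_ball: "p \<in> sr_ball S q r" "p' \<in> sr_ball S q r"
      using p(1,4) p'(1,4) lt le_less_trans by (auto simp: sr_ball_def)
    have key: "(1 - \<epsilon>) * (1 + \<delta>)\<^sup>2 \<le> (1 - \<delta>)\<^sup>2"
    proof -
      have "(1 - \<delta>)\<^sup>2 - (1 - 4 * \<delta>) * (1 + \<delta>)\<^sup>2 = \<delta>\<^sup>2 * (8 + 4 * \<delta>)"
        by (simp add: power2_eq_square algebra_simps)
      moreover have "0 \<le> \<delta>\<^sup>2 * (8 + 4 * \<delta>)" using \<delta> by simp
      ultimately show ?thesis by (simp add: \<delta>_def)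
    qed
    have "ennreal (2 * r * (1 - \<epsilon>)) \<le> sr_dist S p' p"
    proof (rule sr_dist_lower_bound[OF order_trans[OF sub \<rho>(3)] a(2) \<delta>(1), where w = w])
      show "\<bar>anchor_coords x \<xi> \<bullet> w\<bar> \<le> (1 + \<delta>) * sqrt (gram (chart.\<psi> x) \<xi> \<xi>)"
        "norm (anchor_coords x \<xi>) \<le> K * sqrt (gram (chart.\<psi> x) \<xi> \<xi>)" if "x \<in> cball ?x \<rho>1" for x \<xi>
        using a(4,5)[of x \<xi>] subsetD[OF order_trans[OF sub \<rho>(2)] that] by auto
      have "2 * r * (1 - \<epsilon>) * (1 + \<delta>) * (1 + \<delta>) \<le> 2 * r * (1 - \<delta>)\<^sup>2"
        using mult_left_mono[OF key, of "2 * r"] r by (simp add: power2_eq_square mult.assoc)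
      also have "\<dots> = 2 * (s * (1 - \<delta>)) * (1 + \<delta>)"
        using \<delta> by (simp add: s_def power2_eq_square)
      finally have "2 * r * (1 - \<epsilon>) * (1 + \<delta>) \<le> 2 * (s * (1 - \<delta>))"
        using \<delta> by simp
      also have "\<dots> \<le> (\<phi> p - \<phi> p') \<bullet> w"
        using p(5) p'(5) by (simp add: inner_diff_left)
      finally show "2 * r * (1 - \<epsilon>) * (1 + \<delta>) \<le> \<bar>(\<phi> p - \<phi> p') \<bullet> w\<bar>" by linarith
      have "2 * r * (1 - \<epsilon>) \<le> 2 * r" using r \<epsilon> by (simp add: mult_left_le)
      with rK show "2 * r * (1 - \<epsilon>) \<le> \<rho>1 / (2 * K)" by linarith
    qed (use p' in auto)
    also have "\<dots> \<le> sr_diam S (sr_ball S q r)"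
      unfolding sr_diam_def by (intro SUP_upper2[OF in_ball(2)] SUP_upper in_ball(1))
    finally show "ennreal (2 * r * (1 - \<epsilon>)) \<le> sr_diam S (sr_ball S q r)" .
  qed (rule r0)
qed

end

theorem theorem1p3:
  fixes S :: "('a::{t2_space, second_countable_topology}, 'e::euclidean_space, 'b, 'u::euclidean_space)
    sr_structure"
    and p :: 'a
  assumes "sub_riemannian S"
    and "p \<in> points S"
    and "regular_point S p"
  shows "\<exists>T. T \<subseteq> points S \<and> p \<in> interior T \<and>
    (\<forall>\<epsilon>::real. 0 < \<epsilon> \<and> \<epsilon> < 1 \<longrightarrow>
      (\<exists>r\<^sub>\<epsilon>::real. 0 < r\<^sub>\<epsilon> \<and>
        (\<forall>q\<in>T. \<forall>r::real. 0 < r \<and> r < r\<^sub>\<epsilon> \<longrightarrow>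
          ennreal (2 * r * (1 - \<epsilon>)) \<le> sr_diam S (sr_ball S q r) \<and>
          sr_diam S (sr_ball S q r) \<le> ennreal (2 * r))))"
proof -
  interpret sr_manifold S by unfold_locales (fact assms(1))
  obtain U \<phi> where U: "(U, \<phi>) \<in> atlas S" "p \<in> U" using exists_chart[OF assms(2)] by blast
  interpret c: atlas_chart "atlas S" U \<phi> by unfold_locales (fact atlas_axiom, fact U(1))
  obtain \<rho> where \<rho>: "\<rho> > 0" "cball (\<phi> p) \<rho> \<subseteq> \<phi> ` U"
    using open_contains_cball[of "\<phi> ` U"] c.chart_props(3) U(2) by blast
  define T where "T = c.\<psi> ` cball (\<phi> p) \<rho>"
  have compT: "compact T"
    unfolding T_def using \<rho>(2)
    by (intro compact_continuous_image continuous_on_subset[OF c.chart_props(5)]) auto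
  have TU: "T \<subseteq> U" using \<rho>(2) by (auto simp: T_def)
  then have TS: "T \<subseteq> points S" using c.chart_props(6) by (auto simp: points_def)
  have "p \<in> interior T"
  proof (rule interiorI[of "U \<inter> \<phi> -` ball (\<phi> p) \<rho>"])
    show "open (U \<inter> \<phi> -` ball (\<phi> p) \<rho>)" by (rule c.open_chart_preimage) simp
    show "U \<inter> \<phi> -` ball (\<phi> p) \<rho> \<subseteq> T"
    proof
      fix q assume q: "q \<in> U \<inter> \<phi> -` ball (\<phi> p) \<rho>"
      then have "c.\<psi> (\<phi> q) \<in> T" unfolding T_def by (intro imageI) auto
      then show "q \<in> T" using q by simp
    qed
  qed (use U \<rho> in auto)
  moreover have "\<exists>r0>0. \<forall>q\<in>T. \<forall>r. 0 < r \<and> r < r0 \<longrightarrow>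
      ennreal (2 * r * (1 - \<epsilon>)) \<le> sr_diam S (sr_ball S q r) \<and> sr_diam S (sr_ball S q r) \<le> ennreal (2 * r)"
    if \<epsilon>: "0 < \<epsilon>" "\<epsilon> < 1" for \<epsilon> :: real
  proof -
    have "\<exists>V r0. open V \<and> q0 \<in> V \<and> 0 < r0 \<and> (\<forall>q\<in>V. \<forall>r. 0 < r \<and> r < r0 \<longrightarrow>
        ennreal (2 * r * (1 - \<epsilon>)) \<le> sr_diam S (sr_ball S q r))" if q0: "q0 \<in> T" for q0
    proof -
      obtain W \<tau> U \<phi> where "sr_chart S W \<tau> U \<phi>" "q0 \<in> U \<inter> W"
        using chart_at subsetD[OF TS q0] by metis
      from sr_chart.local_diam_lower_bound[OF this \<epsilon>] show ?thesis by metis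
    qed
    then obtain V r0 where V: "\<And>q0. q0 \<in> T \<Longrightarrow> open (V q0) \<and> q0 \<in> V q0 \<and> 0 < r0 q0 \<and>
        (\<forall>q\<in>V q0. \<forall>r. 0 < r \<and> r < r0 q0 \<longrightarrow> ennreal (2 * r * (1 - \<epsilon>)) \<le> sr_diam S (sr_ball S q r))"
      by metis
    obtain C where C: "C \<subseteq> T" "finite C" "T \<subseteq> (\<Union>q\<in>C. V q)"
      using compactE_image[OF compT, of T V] V by blast
    define R where "R = Min (insert 1 (r0 ` C))"
    have "0 < R" unfolding R_def using C V by (subst Min_gr_iff) auto
    moreover have "ennreal (2 * r * (1 - \<epsilon>)) \<le> sr_diam S (sr_ball S q r)"
      if q: "q \<in> T" and r: "0 < r" "r < R" for q r
    proof -
      obtain q0 where q0: "q0 \<in> C" "q \<in> V q0" using C(3) q by blast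
      have "R \<le> r0 q0" unfolding R_def using C(2) q0(1) by (intro Min_le) auto
      then show ?thesis using V[of q0] q0 C(1) r by force
    qed
    ultimately show ?thesis using sr_diam_ball_le by blast
  qed
  ultimately show ?thesis using TS by blast
qed

end
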